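(* Let $n\ge 1$, let $f(z)=\sum_{k\in\mathbb N^n} f_k z^k$ (with $z^k=z_1^{k_1}\cdots z_n^{k_n}$) be a power series with complex coefficients, and let $\varphi$ be a function of $n$ complex variables $\zeta=\xi+i\eta$ ($\xi,\eta\in\mathbb R^n$) that interpolates the coefficients, i.e. $\varphi(k)=f_k$ for all $k\in\mathbb N^n$. Let $\tilde g$ be a piecewise affine function $$\tilde g(\eta)=\sum_{p=1}^{q}\varepsilon_p\,|a_p^1\eta_1+\dots+a_p^n\eta_n+a_p^0|,\qquad \varepsilon_p\in\{1,-1\},\ a_p^j\in\mathbb R,$$ and let $P\subset\mathbb R^n$ be the polyhedron associated with $\tilde g$ as described in the context. Assume that $\varphi$ is holomorphic in $\mathbb R_{\ge 0}^n+i\mathbb R^n$ and satisfies the estimates 1) $\log|\varphi(i\eta)|\le \tilde g(\eta)$ for all $\eta\in\mathbb R^n$ (that is, on the imaginary subspace $i\mathbb R^n$); 2) $\log|\varphi(\xi+i\eta)|\le \sum_{j=1}^n\big((\pi-\delta)|\eta_j|+b\,\xi_j\big)+C$ for all $\xi+i\eta\in\mathbb R_{\ge 0}^n+i\mathbb R^n$, for some real constants $b$, $C$ and $\delta>0$. Then the sum of the series $f$ extends analytically into the sectorial domain $\mathrm{Arg}^{-1}(P^{o})$, where $P^{o}$ is the interior of $P$.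
   Context: Here $\mathbb N=\{0,1,2,\dots\}$, $\mathbb R_{\ge0}=[0,\infty)$, and $\log 0=-\infty$. "Holomorphic in $\mathbb R_{\ge 0}^n+i\mathbb R^n$" means holomorphic in an open neighbourhood of this closed set in $\mathbb C^n$. Together with $\tilde g$ consider the piecewise linear function $$g(\eta)=\sum_{p=1}^{q}\varepsilon_p\,|a_p^1\eta_1+\dots+a_p^n\eta_n|+\pi\sum_{k=1}^{n}(\eta_k-|\eta_k|),\qquad \eta\in\mathbb R^n.$$ The hyperplanes $a_p^1\eta_1+\dots+a_p^n\eta_n=0$ ($p=1,\dots,q$; indices $p$ with $a_p^1=\dots=a_p^n=0$ are ignored) and $\eta_k=0$ ($k=1,\dots,n$) divide $\mathbb R^n$ into strongly convex polyhedral cones; these cones and all their faces form a fan $\Sigma$ (every face of a cone of $\Sigma$ is in $\Sigma$, and the intersection of two cones of $\Sigma$ is in $\Sigma$), and $g$ is linear on each cone. Let $\mu_1,\dots,\mu_d$ be generators of the one-dimensional cones of $\Sigma$ (one nonzero vector on each ray), and set $$P=\{\alpha\in\mathbb R^n:\ (\mu_\nu,\alpha)\ge g(\mu_\nu),\ \nu=1,\dots,d\},$$ where $(\cdot,\cdot)$ is the standard inner product on $\mathbb R^n$. Since $g$ is positively homogeneous, $P$ does not depend on the choice of generators. The interior $P^{o}$ may be empty; the case of interest is $P^{o}\neq\emptyset$. $\mathrm{Arg}(z)=(\arg z_1,\dots,\arg z_n)$ for $z\in(\mathbb C\setminus\mathbb R_{\ge0})^n$, with $\arg z_j\in(0,2\pi)$,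 and $\mathrm{Arg}^{-1}(P^{o})$ is the set of $z\in(\mathbb C\setminus\mathbb R_{\ge0})^n$ with $\mathrm{Arg}(z)\in P^{o}$. "The sum of the series extends analytically into $\mathrm{Arg}^{-1}(P^{o})$" means that there is a holomorphic function on $\mathrm{Arg}^{-1}(P^{o})$ that coincides with the sum of the series at all points of $\mathrm{Arg}^{-1}(P^{o})$ lying in the domain of convergence of the series (which, by 2), contains a polydisc centred at $0$). *)

theory Defs
  imports "HOL-Analysis.Analysis"
begin

definition log_ext :: "real \<Rightarrow> ereal"
  where "log_ext x = (if x = 0 then - \<infinity> else ereal (ln x))"

definition cvec :: "real ^ 'n \<Rightarrow> real ^ 'n \<Rightarrow> complex ^ 'n"
  where "cvec \<xi> \<eta> = (\<chi> j. Complex (\<xi> $ j) (\<eta> $ j))"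

text \<open>Holomorphy in several variables: an open domain, at each point of which the real
  Frechet derivative exists and is complex linear.\<close>

definition mv_holomorphic_on :: "(complex ^ 'n \<Rightarrow> complex) \<Rightarrow> (complex ^ 'n) set \<Rightarrow> bool"
  where "mv_holomorphic_on F U \<longleftrightarrow> open U \<and>
    (\<forall>z\<in>U. \<exists>D. (F has_derivative D) (at z) \<and> (\<forall>c v. D (c *s v) = c * D v))"

definition mv_holomorphic_near :: "(complex ^ 'n \<Rightarrow> complex) \<Rightarrow> (complex ^ 'n) set \<Rightarrow> bool"
  where "mv_holomorphic_near F S \<longleftrightarrow> (\<exists>U. S \<subseteq> U \<and> mv_holomorphic_on F U)"

definition right_half_space :: "(complex ^ 'n) set"
  where "right_half_space = {cvec \<xi> \<eta> | \<xi> \<eta>. \<forall>j. 0 \<le> \<xi> $ j}"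

definition monomial :: "complex ^ 'n \<Rightarrow> nat ^ 'n \<Rightarrow> complex"
  where "monomial z k = (\<Prod>j\<in>UNIV. (z $ j) ^ (k $ j))"

definition series_sum :: "(nat ^ 'n \<Rightarrow> complex) \<Rightarrow> complex ^ 'n \<Rightarrow> complex"
  where "series_sum f z = (\<Sum>\<^sub>\<infinity>k\<in>UNIV. f k * monomial z k)"

definition convergence_domain :: "(nat ^ 'n \<Rightarrow> complex) \<Rightarrow> (complex ^ 'n) set"
  where "convergence_domain f =
    interior {z. (\<lambda>k. norm (f k * monomial z k)) summable_on UNIV}"

definition g_tilde ::
    "nat \<Rightarrow> (nat \<Rightarrow> real) \<Rightarrow> (nat \<Rightarrow> real ^ 'n) \<Rightarrow> (nat \<Rightarrow> real) \<Rightarrow> real ^ 'n \<Rightarrow> real"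
  where "g_tilde q \<epsilon> a a0 \<eta> = (\<Sum>p=1..q. \<epsilon> p * \<bar>(\<Sum>j\<in>UNIV. a p $ j * \<eta> $ j) + a0 p\<bar>)"

definition g_lin ::
    "nat \<Rightarrow> (nat \<Rightarrow> real) \<Rightarrow> (nat \<Rightarrow> real ^ 'n) \<Rightarrow> real ^ 'n \<Rightarrow> real"
  where "g_lin q \<epsilon> a \<eta> =
    (\<Sum>p=1..q. \<epsilon> p * \<bar>\<Sum>j\<in>UNIV. a p $ j * \<eta> $ j\<bar>) + pi * (\<Sum>k\<in>UNIV. \<eta> $ k - \<bar>\<eta> $ k\<bar>)"

definition hyperplanes :: "nat \<Rightarrow> (nat \<Rightarrow> real ^ 'n) \<Rightarrow> (real ^ 'n) set set"
  where "hyperplanes q a =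
    {{\<eta>. (\<Sum>j\<in>UNIV. a p $ j * \<eta> $ j) = 0} | p. p \<in> {1..q} \<and> a p \<noteq> 0} \<union>
    {{\<eta>. \<eta> $ k = 0} | k. True}"

definition max_cones :: "nat \<Rightarrow> (nat \<Rightarrow> real ^ 'n) \<Rightarrow> (real ^ 'n) set set"
  where "max_cones q a = closure ` components (- \<Union>(hyperplanes q a))"

text \<open>The empty set is a face in the sense of \<open>face_of\<close>, but not a cone.\<close>

definition fan :: "nat \<Rightarrow> (nat \<Rightarrow> real ^ 'n) \<Rightarrow> (real ^ 'n) set set"
  where "fan q a = {\<tau>. \<tau> \<noteq> {} \<and> (\<exists>\<sigma>\<in>max_cones q a. \<tau> face_of \<sigma>)}"

definition fan_rays :: "nat \<Rightarrow> (nat \<Rightarrow> real ^ 'n) \<Rightarrow> (real ^ 'n) set set"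
  where "fan_rays q a = {\<tau> \<in> fan q a. aff_dim \<tau> = 1}"

definition ray_generators ::
    "nat \<Rightarrow> (nat \<Rightarrow> real ^ 'n) \<Rightarrow> nat \<Rightarrow> (nat \<Rightarrow> real ^ 'n) \<Rightarrow> bool"
  where "ray_generators q a d \<mu> \<longleftrightarrow>
    (\<forall>\<nu>\<in>{1..d}. \<mu> \<nu> \<noteq> 0) \<and> bij_betw (\<lambda>\<nu>. conic hull {\<mu> \<nu>}) {1..d} (fan_rays q a)"

definition polyhedron_P ::
    "nat \<Rightarrow> (nat \<Rightarrow> real) \<Rightarrow> (nat \<Rightarrow> real ^ 'n) \<Rightarrow> nat \<Rightarrow> (nat \<Rightarrow> real ^ 'n) \<Rightarrow> (real ^ 'n) set"
  where "polyhedron_P q \<epsilon> a d \<mu> = {\<alpha>. \<forall>\<nu>\<in>{1..d}. \<mu> \<nu> \<bullet> \<alpha> \<ge> g_lin q \<epsilon> a (\<mu> \<nu>)}"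

text \<open>\<open>Arg2pi\<close> takes values in \<open>(0, 2\<pi>)\<close> off the nonnegative real axis.\<close>

definition Arg_preimage :: "(real ^ 'n) set \<Rightarrow> (complex ^ 'n) set"
  where "Arg_preimage Q = {z. (\<forall>j. z $ j \<notin> \<real>\<^sub>\<ge>\<^sub>0) \<and> (\<chi> j. Arg2pi (z $ j)) \<in> Q}"

definition extends_analytically ::
    "(nat ^ 'n \<Rightarrow> complex) \<Rightarrow> (complex ^ 'n) set \<Rightarrow> bool"
  where "extends_analytically f W \<longleftrightarrow> (\<exists>F. mv_holomorphic_on F W \<and>
    (\<forall>z\<in>W \<inter> convergence_domain f. F z = series_sum f z))"

end

theory Submission
  imports Defs "HOL-Complex_Analysis.Residue_Theorem"
begin

text \<open>The idea is Lindeloef's: a power series with interpolated coefficients is a sum of residues, and the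
contour can be pushed back to the imaginary space. Work in the coordinates \<open>w\<^sub>j = log (- z\<^sub>j)\<close>, whose
imaginary part is \<open>\<theta> = Arg z - (\<pi>, ..., \<pi>)\<close>. In one variable and for \<open>0 < s < 1\<close>, the sum of
\<open>\<phi>(k) (-1)^k exp (k w)\<close> over \<open>k \<ge> 0\<close> equals \<open>\<phi>(0)\<close> minus one half of the integral of
\<open>\<phi>(\<zeta>) exp (\<zeta> w) / sin (\<pi> \<zeta>)\<close> over \<open>\<zeta> = s + i t\<close>, \<open>t\<close> real, provided that \<open>\<bar>Im w\<bar> < \<delta>\<close> and \<open>Re w < - b\<close>
(\<open>Lindeloef_line_integral\<close>). The integral side is an integral against one measure on \<open>\<complex>\<close>, a unit mass at 0
plus a line, and the series is an integral against counting measure on \<open>\<nat>\<close>. Under the product bound 2)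
one measure can be exchanged for the other in one coordinate at a time, by Fubini, and this gives the formula
in \<open>n\<close> variables (\<open>coordinate_swap.integral_eq_series\<close>).

The integral converges far beyond the region where it is first identified with the series. On its support every coordinate is 0
or has real part \<open>s\<close>, and the weights decay like \<open>exp (- \<pi> \<bar>\<eta>\<bar>)\<close>, where \<open>\<eta>\<close> is the imaginary part and
\<open>\<bar>\<eta>\<bar>\<close> its sum norm. Estimate 1) holds on the imaginary space only, but the three lines theorem,
with 2) as a crude bound at real part 1, shows that \<open>\<bar>\<phi>\<bar> \<le> exp (K + G \<eta> + s \<Lambda> \<bar>\<eta>\<bar>)\<close> on the
support; here \<open>G\<close> is the homogeneous part of \<open>g_tilde\<close>, and \<open>K\<close> and \<open>\<Lambda>\<close> do not depend on \<open>s\<close>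
(\<open>growth_near_imaginary_space\<close>). So the integral converges as soon as
\<open>G \<eta> + c \<bar>\<eta>\<bar> \<le> \<theta> \<bullet> \<eta> + \<pi> \<bar>\<eta>\<bar>\<close> for all \<open>\<eta>\<close>, with \<open>s\<close> small compared with \<open>c\<close>, and it is
holomorphic in \<open>w\<close> as an exponential transform (\<open>exponential_moment_has_derivative\<close>).

With \<open>\<alpha> = \<theta> + (\<pi>, ..., \<pi>)\<close> this condition reads \<open>g_lin \<eta> + c \<bar>\<eta>\<bar> \<le> \<alpha> \<bullet> \<eta>\<close>. The polyhedron \<open>P\<close>
asks for \<open>g_lin \<eta> \<le> \<alpha> \<bullet> \<eta>\<close> on the rays of the fan only; but \<open>g_lin\<close> is linear on every cone of the fan,
and a pointed cone is generated by its rays, so the inequality holds everywhere (\<open>polyhedron_P_support\<close>).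
An interior point of \<open>P\<close> has some \<open>c > 0\<close> to spare.

Since \<open>s\<close> has to shrink with \<open>c\<close>, this produces one holomorphic function for each \<open>c\<close>, on a convex tube in
the \<open>w\<close>-space. Because \<open>G\<close> is even, a nonempty tube contains all real points, and near the real points with
\<open>Re w\<close> very negative all these functions agree with the power series. The identity theorem on convex open
sets glues them together and identifies the result with the sum of the series.\<close>

section \<open>Lindeloef's formula in one variable\<close>

lemma integrable_exp_abs:
  fixes c :: real assumes "c > 0"
  shows "integrable lborel (\<lambda>t::real. exp (- c * \<bar>t\<bar>))"
proof -
  have pos: "set_integrable lborel {0..} (\<lambda>t::real. exp (- c * t))"
  proof -
    have "(\<lambda>t::real. exp (- c * t)) absolutely_integrable_on {0..}"
      by (rule nonnegative_absolutely_integrable_1[OF integrable_on_exp_minus_to_infinity[OF assms]]) auto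
    thus ?thesis unfolding set_integrable_def
      by (subst (asm) integrable_completion) auto
  qed
  have neg: "integrable lborel (\<lambda>t. indicator {0..} (-t) *\<^sub>R exp (- c * (-t)))"
    using lborel_integrable_real_affine[OF pos[unfolded set_integrable_def], of "-1" 0] by simp
  show ?thesis
    by (rule Bochner_Integration.integrable_bound[OF Bochner_Integration.integrable_add[OF pos[unfolded set_integrable_def] neg]])
       (auto simp: indicator_def)
qed

lemma tendsto_truncated_integral:
  fixes g :: "real \<Rightarrow> complex"
  assumes g: "integrable lborel g"
  shows "(\<lambda>n. integral {- real n..real n} g) \<longlonglongrightarrow> integral\<^sup>L lborel g"
proof -
  have eq: "integral {- real n..real n} g = (\<integral>t. indicator {- real n..real n} t *\<^sub>R g t \<partial>lborel)" for n
  proof -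
    have "set_integrable lborel {- real n..real n} g"
      unfolding set_integrable_def using g by (intro integrable_mult_indicator) auto
    from set_borel_integral_eq_integral(2)[OF this] show ?thesis
      by (simp add: set_lebesgue_integral_def)
  qed
  show ?thesis unfolding eq
  proof (rule integral_dominated_convergence[where w="\<lambda>t. norm (g t)"])
    show "AE t in lborel. (\<lambda>n. indicator {- real n..real n} t *\<^sub>R g t) \<longlonglongrightarrow> g t"
    proof (rule AE_I2)
      fix t :: real
      obtain N where N: "\<bar>t\<bar> \<le> real N" using real_arch_simple by blast
      have "eventually (\<lambda>n. indicator {- real n..real n} t *\<^sub>R g t = g t) sequentially"
        using eventually_ge_at_top[of N] by eventually_elim (use N in \<open>auto simp: indicator_def\<close>)
      thus "(\<lambda>n. indicator {- real n..real n} t *\<^sub>R g t) \<longlonglongrightarrow> g t" by (rule tendsto_eventually)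
    qed
  qed (use g in \<open>auto simp: indicator_def\<close>)
qed

text \<open>Residue theorem on the rectangle with vertical sides \<open>\<sigma>1\<close>, \<open>\<sigma>2\<close> and height tending to infinity: the exponential
decay removes the horizontal sides, so that only the two full lines and the residue between them remain.\<close>

lemma strip_residue:
  fixes G :: "complex \<Rightarrow> complex"
  assumes holo: "G holomorphic_on {\<zeta>. \<alpha> < Re \<zeta> \<and> Re \<zeta> < \<beta>} - {of_real p}"
    and ord: "\<alpha> < \<sigma>1" "\<sigma>1 < p" "p < \<sigma>2" "\<sigma>2 < \<beta>"
    and int1: "integrable lborel (\<lambda>t. G (Complex \<sigma>1 t))"
    and int2: "integrable lborel (\<lambda>t. G (Complex \<sigma>2 t))"
    and \<kappa>: "\<kappa> > 0"
    and bd: "\<And>\<zeta>. \<sigma>1 \<le> Re \<zeta> \<Longrightarrow> Re \<zeta> \<le> \<sigma>2 \<Longrightarrow> 1 \<le> \<bar>Im \<zeta>\<bar> \<Longrightarrow> norm (G \<zeta>) \<le> M * exp (- \<kappa> * \<bar>Im \<zeta>\<bar>)"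
  shows "(\<integral>t. G (Complex \<sigma>2 t) \<partial>lborel) - (\<integral>t. G (Complex \<sigma>1 t) \<partial>lborel) = 2 * pi * residue G (of_real p)"
proof -
  define S where "S = {\<zeta>. \<alpha> < Re \<zeta> \<and> Re \<zeta> < \<beta>}"
  have S: "S = {\<zeta>. \<alpha> < Re \<zeta>} \<inter> {\<zeta>. Re \<zeta> < \<beta>}" by (auto simp: S_def)
  have oS: "open S" unfolding S by (intro open_Int open_halfspace_Re_lt open_halfspace_Re_gt)
  have cS: "connected S" unfolding S
    by (intro convex_connected convex_Int convex_halfspace_Re_lt convex_halfspace_Re_gt)
  have M: "M \<ge> 0"
  proof -
    have "0 \<le> M * exp (- \<kappa> * \<bar>Im (Complex \<sigma>1 1)\<bar>)"
      by (rule order_trans[OF norm_ge_zero bd]) (use ord in auto)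
    thus ?thesis by (simp add: zero_le_mult_iff)
  qed
  have key: "norm ((integral {- real n..real n} (\<lambda>t. G (Complex \<sigma>2 t)) - integral {- real n..real n} (\<lambda>t. G (Complex \<sigma>1 t)))
      - 2 * pi * residue G (of_real p)) \<le> 2 * (M * exp (- \<kappa> * real n) * (\<sigma>2 - \<sigma>1))" if n: "n \<ge> 1" for n
  proof -
    define T where "T = real n"
    have T: "T \<ge> 1" using n by (simp add: T_def)
    define a1 a2 a3 a4 where "a1 = Complex \<sigma>1 (-T)" and "a2 = Complex \<sigma>2 (-T)"
      and "a3 = Complex \<sigma>2 T" and "a4 = Complex \<sigma>1 T"
    have rp: "rectpath a1 a3 = linepath a1 a2 +++ linepath a2 a3 +++ linepath a3 a4 +++ linepath a4 a1"
      by (simp add: rectpath_def Let_def a1_def a2_def a3_def a4_def)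
    have sub: "path_image (rectpath a1 a3) \<subseteq> S - {of_real p}"
      using ord T by (subst path_image_rectpath) (auto simp: a1_def a3_def S_def)
    have "contour_integral (rectpath a1 a3) G = 2 * pi * \<i> * (\<Sum>q\<in>{of_real p}. winding_number (rectpath a1 a3) q * residue G q)"
    proof (rule Residue_theorem[OF oS cS])
      show "G holomorphic_on S - {of_real p}" using holo by (simp add: S_def)
      show "\<forall>z. z \<notin> S \<longrightarrow> winding_number (rectpath a1 a3) z = 0"
        using ord T by (intro allI impI winding_number_rectpath_outside)
          (auto simp: a1_def a3_def S_def in_cbox_complex_iff)
    qed (use sub in auto)
    also have "winding_number (rectpath a1 a3) (of_real p) = 1"
      using ord T by (intro winding_number_rectpath) (auto simp: in_box_complex_iff a1_def a3_def)
    ultimately have res: "contour_integral (rectpath a1 a3) G = 2 * pi * \<i> * residue G (of_real p)" by simp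
    have cont: "continuous_on (S - {of_real p}) G" using holo by (simp add: S_def holomorphic_on_imp_continuous_on)
    have pis: "path_image (linepath a1 a2) \<subseteq> S - {of_real p}" "path_image (linepath a2 a3) \<subseteq> S - {of_real p}"
       "path_image (linepath a3 a4) \<subseteq> S - {of_real p}" "path_image (linepath a4 a1) \<subseteq> S - {of_real p}"
      using sub unfolding rp by (auto simp: path_image_join)
    have ci: "G contour_integrable_on linepath a1 a2" "G contour_integrable_on linepath a2 a3"
       "G contour_integrable_on linepath a3 a4" "G contour_integrable_on linepath a4 a1"
      by (rule contour_integrable_continuous_linepath, rule continuous_on_subset[OF cont], use pis in simp)+
    have split: "contour_integral (rectpath a1 a3) G = contour_integral (linepath a1 a2) G + contour_integral (linepath a2 a3) G
         + contour_integral (linepath a3 a4) G + contour_integral (linepath a4 a1) G"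
      unfolding rp using ci by (simp add: contour_integrable_join add.assoc)
    have r: "contour_integral (linepath a2 a3) G = \<i> * integral {-T..T} (\<lambda>t. G (Complex \<sigma>2 t))"
      using T by (intro contour_integral_linepath_same_Re) (auto simp: a2_def a3_def)
    have "contour_integral (linepath a1 a4) G = \<i> * integral {-T..T} (\<lambda>t. G (Complex \<sigma>1 t))"
      using T by (intro contour_integral_linepath_same_Re) (auto simp: a1_def a4_def)
    hence l: "contour_integral (linepath a4 a1) G = - \<i> * integral {-T..T} (\<lambda>t. G (Complex \<sigma>1 t))"
      using contour_integral_reverse_linepath[of a1 a4 G] cont pis(4)
      by (simp add: closed_segment_commute continuous_on_subset)
    have seg: "norm (G \<zeta>) \<le> M * exp (- \<kappa> * T)" if "\<zeta> \<in> closed_segment a1 a2 \<union> closed_segment a3 a4" for \<zeta>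
    proof -
      have "Re \<zeta> \<in> {\<sigma>1..\<sigma>2} \<and> \<bar>Im \<zeta>\<bar> = T"
        using that ord T
        by (auto simp: a1_def a2_def a3_def a4_def closed_segment_same_Im closed_segment_eq_real_ivl)
      thus ?thesis using bd[of \<zeta>] T by auto
    qed
    have bot: "norm (contour_integral (linepath a1 a2) G) \<le> M * exp (- \<kappa> * T) * norm (a2 - a1)"
      using M seg by (intro contour_integral_bound_linepath ci) auto
    have top: "norm (contour_integral (linepath a3 a4) G) \<le> M * exp (- \<kappa> * T) * norm (a4 - a3)"
      using M seg by (intro contour_integral_bound_linepath ci) auto
    have n21: "norm (a2 - a1) = \<sigma>2 - \<sigma>1" "norm (a4 - a3) = \<sigma>2 - \<sigma>1"
      using ord by (auto simp: a1_def a2_def a3_def a4_def cmod_def)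
    define A B where "A = contour_integral (linepath a1 a2) G" and "B = contour_integral (linepath a3 a4) G"
    have "\<i> * ((integral {-T..T} (\<lambda>t. G (Complex \<sigma>2 t)) - integral {-T..T} (\<lambda>t. G (Complex \<sigma>1 t)))
        - 2 * pi * residue G (of_real p)) = - A - B"
      using split res unfolding r l A_def B_def by (simp add: algebra_simps)
    hence "norm ((integral {-T..T} (\<lambda>t. G (Complex \<sigma>2 t)) - integral {-T..T} (\<lambda>t. G (Complex \<sigma>1 t)))
        - 2 * pi * residue G (of_real p)) = norm (- A - B)"
      by (metis mult_1 norm_ii norm_mult)
    also have "\<dots> \<le> norm A + norm B" by (metis norm_minus_cancel norm_triangle_ineq4)
    also have "\<dots> \<le> 2 * (M * exp (- \<kappa> * T) * (\<sigma>2 - \<sigma>1))"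
      using bot top unfolding n21 A_def B_def by simp
    finally show ?thesis by (simp add: T_def)
  qed
  have e0: "(\<lambda>n. exp (- \<kappa> * real n)) \<longlonglongrightarrow> 0"
  proof -
    have "(\<lambda>n. exp (- \<kappa>) ^ n) \<longlonglongrightarrow> 0" using \<kappa> by (intro LIMSEQ_power_zero) auto
    thus ?thesis by (simp add: mult.commute flip: exp_of_nat_mult)
  qed
  have lim0: "(\<lambda>n. 2 * (M * exp (- \<kappa> * real n) * (\<sigma>2 - \<sigma>1))) \<longlonglongrightarrow> 2 * (M * 0 * (\<sigma>2 - \<sigma>1))"
    by (intro tendsto_intros e0)
  hence lim0: "(\<lambda>n. 2 * (M * exp (- \<kappa> * real n) * (\<sigma>2 - \<sigma>1))) \<longlonglongrightarrow> 0"
    by (simp only: mult_zero_left mult_zero_right)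
  have "(\<lambda>n. (integral {- real n..real n} (\<lambda>t. G (Complex \<sigma>2 t)) - integral {- real n..real n} (\<lambda>t. G (Complex \<sigma>1 t)))
      - 2 * pi * residue G (of_real p)) \<longlonglongrightarrow> 0"
    by (rule Lim_null_comparison[OF _ lim0]) (use key in \<open>blast intro: eventually_sequentiallyI[of 1]\<close>)
  moreover have "(\<lambda>n. (integral {- real n..real n} (\<lambda>t. G (Complex \<sigma>2 t)) - integral {- real n..real n} (\<lambda>t. G (Complex \<sigma>1 t)))
      - 2 * pi * residue G (of_real p)) \<longlonglongrightarrow> (\<integral>t. G (Complex \<sigma>2 t) \<partial>lborel) - (\<integral>t. G (Complex \<sigma>1 t) \<partial>lborel) - 2 * pi * residue G (of_real p)"
    by (intro tendsto_intros tendsto_truncated_integral int1 int2)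
  ultimately show ?thesis using LIMSEQ_unique by fastforce
qed

lemma norm_sin_ge_vertical:
  "norm (sin z) \<ge> \<bar>sin (Re z)\<bar> * exp \<bar>Im z\<bar> / 2"
proof -
  have "\<bar>sin (Re z)\<bar> * exp \<bar>Im z\<bar> / 2 \<le> \<bar>sin (Re z)\<bar> * (exp (Im z) + exp (- Im z)) / 2"
    by (intro divide_right_mono mult_left_mono) (auto simp: abs_if)
  also have "\<dots> = \<bar>Re (sin z)\<bar>" by (simp add: Re_sin abs_mult add_nonneg_nonneg)
  also have "\<dots> \<le> norm (sin z)" by (rule abs_Re_le_cmod)
  finally show ?thesis .
qed

lemma norm_sin_ge_horizontal:
  assumes "\<bar>Im z\<bar> \<ge> 1" shows "norm (sin z) \<ge> exp \<bar>Im z\<bar> / 4"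
proof -
  define y where "y = Im z"
  have "(exp \<bar>y\<bar> / 4)\<^sup>2 \<le> (norm (sin z))\<^sup>2"
  proof -
    have e: "(exp y)\<^sup>2 = exp (2*y)" "(exp \<bar>y\<bar>)\<^sup>2 = exp (2 * \<bar>y\<bar>)" by (simp_all add: power2_eq_square flip: exp_add)
    have "(norm (sin z))\<^sup>2 \<ge> (exp (2*y) + exp (-(2*y)) - 2) / 4"
      unfolding norm_sin_squared y_def by (simp add: exp_minus)
    moreover have "exp (2*y) + exp (-(2*y)) \<ge> exp (2 * \<bar>y\<bar>)" by (auto simp: abs_if)
    moreover have "exp (2 * \<bar>y\<bar>) \<ge> 3"
      using exp_ge_add_one_self[of "2 * \<bar>y\<bar>"] assms unfolding y_def by linarith
    moreover have "E / 16 \<le> N" if "(E' - 2) / 4 \<le> N" "E \<le> E'" "3 \<le> E" for E E' N :: real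
      using that by simp
    ultimately have "exp (2 * \<bar>y\<bar>) / 16 \<le> (norm (sin z))\<^sup>2" by blast
    thus ?thesis unfolding power_divide e(2) by simp
  qed
  thus ?thesis unfolding y_def by (rule power2_le_imp_le) simp
qed

lemma sin_pi_times_eq_0_imp:
  fixes \<zeta> :: complex
  assumes "sin (of_real pi * \<zeta>) = 0" shows "\<zeta> \<in> \<int>"
proof -
  obtain n :: int where "of_real pi * \<zeta> = of_real (n * pi)" using sin_eq_0[THEN iffD1, OF assms] by blast
  hence "of_real pi * \<zeta> = of_real pi * of_int n" by (simp add: mult.commute)
  hence "\<zeta> = of_int n" by (subst (asm) mult_cancel_left) simp
  thus ?thesis by simp
qed

lemma residue_over_sin:
  assumes "open S" "of_nat m \<in> S" "F holomorphic_on S" "S \<inter> \<int> = {of_nat m}"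
  shows "residue (\<lambda>\<zeta>. F \<zeta> / sin (of_real pi * \<zeta>)) (of_nat m) = (-1)^m * F (of_nat m) / of_real pi"
proof (rule residue_simple'[OF assms(1,2)])
  have z: "sin (of_real pi * \<zeta>) \<noteq> 0" if "\<zeta> \<in> S - {of_nat m}" for \<zeta> :: complex
    using that assms(4) sin_pi_times_eq_0_imp by blast
  show "(\<lambda>\<zeta>. F \<zeta> / sin (of_real pi * \<zeta>)) holomorphic_on S - {of_nat m}"
    using z assms(3) by (intro holomorphic_intros) (auto intro: holomorphic_on_subset)
  have "((\<lambda>\<zeta>::complex. sin (of_real pi * \<zeta>)) has_field_derivative cos (of_real pi * of_nat m) * of_real pi) (at (of_nat m))"
    by (auto intro!: derivative_eq_intros)
  moreover have c: "cos (of_real pi * of_nat m :: complex) = (-1)^m"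
    by (metis cos_npi_complex' mult.commute)
  moreover have s: "sin (of_real pi * of_nat m :: complex) = 0"
    by (metis sin_npi_complex' mult.commute)
  ultimately have "((\<lambda>\<zeta>::complex. sin (of_real pi * \<zeta>) / (\<zeta> - of_nat m)) \<longlongrightarrow> (-1)^m * of_real pi) (at (of_nat m))"
    by (simp add: has_field_derivative_iff)
  moreover have "(F \<longlongrightarrow> F (of_nat m)) (at (of_nat m))"
    using assms by (metis at_within_open continuous_on_def holomorphic_on_imp_continuous_on)
  ultimately have "((\<lambda>\<zeta>. F \<zeta> / (sin (of_real pi * \<zeta>) / (\<zeta> - of_nat m))) \<longlongrightarrow> F (of_nat m) / ((-1)^m * of_real pi)) (at (of_nat m))"
    by (intro tendsto_divide) auto
  thus "((\<lambda>\<zeta>. F \<zeta> / sin (of_real pi * \<zeta>) * (\<zeta> - of_nat m)) \<longlongrightarrow> (-1)^m * F (of_nat m) / of_real pi) (at (of_nat m))"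
    by (cases "even m") simp_all
qed

text \<open>Let \<open>J k\<close> be the integral of \<open>G\<close> over the line with real part \<open>k + s\<close>. Passing from one line to the next
picks up the residue at \<open>k + 1\<close>, which is a term of the series, and \<open>J k \<rightarrow> 0\<close> because
\<open>G\<close> carries the factor \<open>exp ((Re w + b) k)\<close>. So the series telescopes to \<open>- J 0\<close>. The lines are
absolutely convergent because the growth exponent \<open>\<pi> - \<delta>\<close> and the contribution \<open>\<bar>Im w\<bar> < \<delta>\<close> of the
exponential together stay below the decay exponent \<open>\<pi>\<close> of \<open>1 / sin\<close>.\<close>

lemma Lindeloef_line_integral:
  fixes h :: "complex \<Rightarrow> complex" and w :: complex
  assumes holo: "h holomorphic_on {\<zeta>. Re \<zeta> > 0}"
    and bound: "\<And>\<zeta>. Re \<zeta> > 0 \<Longrightarrow> norm (h \<zeta>) \<le> K * exp ((pi - \<delta>) * \<bar>Im \<zeta>\<bar> + b * Re \<zeta>)"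
    and s: "0 < s" "s < 1" and w: "\<bar>Im w\<bar> < \<delta>" "Re w + b < 0"
  defines "G \<equiv> \<lambda>\<zeta>. h \<zeta> * exp (\<zeta> * w) / sin (of_real pi * \<zeta>)"
  shows "integrable lborel (\<lambda>t. G (Complex s t))"
    and "(\<lambda>k. (-1) ^ Suc k * h (of_nat (Suc k)) * exp (of_nat (Suc k) * w)) sums
           (- (1/2) * (\<integral>t. G (Complex s t) \<partial>lborel))"
proof -
  define \<kappa> where "\<kappa> = \<delta> - \<bar>Im w\<bar>"
  have \<kappa>: "\<kappa> > 0" using w by (simp add: \<kappa>_def)
  have K: "K \<ge> 0"
    using order_trans[OF norm_ge_zero bound[of 1]] by (simp add: zero_le_mult_iff)
  have num: "norm (h \<zeta> * exp (\<zeta> * w)) \<le> K * exp ((Re w + b) * Re \<zeta>) * exp ((pi - \<kappa>) * \<bar>Im \<zeta>\<bar>)"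
    if "Re \<zeta> > 0" for \<zeta>
  proof -
    have "norm (h \<zeta> * exp (\<zeta> * w)) \<le> K * exp ((pi - \<delta>) * \<bar>Im \<zeta>\<bar> + b * Re \<zeta>) * exp (Re \<zeta> * Re w - Im \<zeta> * Im w)"
      unfolding norm_mult using bound[OF that] by (simp add: mult_right_mono)
    also have "\<dots> = K * exp ((Re w + b) * Re \<zeta> + (pi - \<delta>) * \<bar>Im \<zeta>\<bar> - Im \<zeta> * Im w)"
      by (simp add: algebra_simps flip: exp_add)
    also have "\<dots> \<le> K * exp ((Re w + b) * Re \<zeta> + (pi - \<kappa>) * \<bar>Im \<zeta>\<bar>)"
    proof -
      have "- (Im \<zeta> * Im w) \<le> \<bar>Im \<zeta>\<bar> * \<bar>Im w\<bar>" by (metis abs_ge_minus_self abs_mult)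
      thus ?thesis using K by (intro mult_left_mono) (auto simp: \<kappa>_def algebra_simps)
    qed
    finally show ?thesis by (simp add: exp_add mult.assoc)
  qed
  define q where "q = exp (Re w + b)"
  have q: "0 < q" "q < 1" using w by (auto simp: q_def)
  define c where "c = sin (pi * s)"
  have c: "c > 0" unfolding c_def using s by (intro sin_gt_zero) auto
  have vert: "norm (G (Complex (real k + s) t)) \<le> (2 * K / c * q ^ k) * exp (- \<kappa> * \<bar>t\<bar>)" for k t
  proof -
    let ?z = "Complex (real k + s) t"
    have "\<bar>sin (pi * (real k + s))\<bar> = c"
      using c by (simp add: c_def distrib_left sin_add abs_mult mult.commute[of pi "real k"])
    hence s1: "norm (sin (of_real pi * ?z)) \<ge> c * exp (pi * \<bar>t\<bar>) / 2"
      using norm_sin_ge_vertical[of "of_real pi * ?z"] by (simp add: abs_mult)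
    have pos: "c * exp (pi * \<bar>t\<bar>) / 2 > 0" using c by simp
    have "norm (G ?z) = norm (h ?z * exp (?z * w)) / norm (sin (of_real pi * ?z))"
      by (simp add: G_def norm_divide)
    also have "\<dots> \<le> norm (h ?z * exp (?z * w)) / (c * exp (pi * \<bar>t\<bar>) / 2)"
      using s1 pos by (intro divide_left_mono) (auto intro!: mult_pos_pos elim: less_le_trans)
    also have "\<dots> \<le> (K * exp ((Re w + b) * (real k + s)) * exp ((pi - \<kappa>) * \<bar>t\<bar>)) / (c * exp (pi * \<bar>t\<bar>) / 2)"
      using num[of ?z] s pos by (intro divide_right_mono) auto
    also have "\<dots> = (2 * K / c * exp ((Re w + b) * (real k + s))) * exp (- \<kappa> * \<bar>t\<bar>)"
      using c by (simp add: field_simps flip: exp_add)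
    also have "\<dots> \<le> (2 * K / c * q ^ k) * exp (- \<kappa> * \<bar>t\<bar>)"
    proof -
      have "(Re w + b) * s \<le> 0" using w s by (intro mult_nonpos_nonneg) auto
      hence "(Re w + b) * (real k + s) \<le> real k * (Re w + b)" by (simp add: algebra_simps)
      hence "exp ((Re w + b) * (real k + s)) \<le> q ^ k" unfolding q_def by (simp flip: exp_of_nat_mult)
      thus ?thesis using K c by (intro mult_right_mono mult_left_mono) auto
    qed
    finally show ?thesis .
  qed
  have z: "sin (of_real pi * \<zeta>) \<noteq> 0" if "\<zeta> \<notin> \<int>" for \<zeta> :: complex
    using that sin_pi_times_eq_0_imp by blast
  have notint: "Complex (real k + s) t \<notin> \<int>" for k t
  proof
    assume "Complex (real k + s) t \<in> \<int>"
    then obtain n :: int where "Complex (real k + s) t = of_int n" by (auto simp: Ints_def)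
    hence "real k + s = of_int n" by (metis complex.sel(1) Re_complex_of_real of_real_of_int_eq)
    hence "s = of_int (n - int k)" by simp
    thus False using s by (metis of_int_0_less_iff of_int_less_1_iff zless_imp_add1_zle add_0 not_le)
  qed
  have int: "integrable lborel (\<lambda>t. G (Complex (real k + s) t))" for k
  proof (rule Bochner_Integration.integrable_bound)
    show "integrable lborel (\<lambda>t. (2 * K / c * q ^ k) * exp (- \<kappa> * \<bar>t\<bar>))"
      by (intro integrable_mult_right integrable_exp_abs \<kappa>)
    have cC: "continuous_on UNIV (\<lambda>t. Complex (real k + s) t)"
      unfolding Complex_eq by (intro continuous_intros)
    have "continuous_on UNIV (\<lambda>t. G (Complex (real k + s) t))"
      unfolding G_def
    proof (intro continuous_intros)
      show "continuous_on UNIV (\<lambda>t. h (Complex (real k + s) t))"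
        by (rule continuous_on_compose2[OF holomorphic_on_imp_continuous_on[OF holo] cC])
           (use s in auto)
      show "\<forall>x\<in>UNIV. sin (of_real pi * Complex (real k + s) x) \<noteq> 0" using z notint by blast
    qed
    thus "(\<lambda>t. G (Complex (real k + s) t)) \<in> borel_measurable lborel"
      by (simp add: borel_measurable_continuous_onI)
    show "AE t in lborel. norm (G (Complex (real k + s) t)) \<le> norm ((2 * K / c * q ^ k) * exp (- \<kappa> * \<bar>t\<bar>))"
      unfolding real_norm_def by (rule AE_I2, rule order_trans[OF vert abs_ge_self])
  qed
  show "integrable lborel (\<lambda>t. G (Complex s t))" using int[of 0] by simp
  define J where "J = (\<lambda>k. (\<integral>t. G (Complex (real k + s) t) \<partial>lborel))"
  have step: "J (Suc k) - J k = 2 * ((-1) ^ Suc k * h (of_nat (Suc k)) * exp (of_nat (Suc k) * w))" for k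
  proof -
    define S where "S = {\<zeta>. real k < Re \<zeta> \<and> Re \<zeta> < real (k + 2)}"
    have S': "S = {\<zeta>. real k < Re \<zeta>} \<inter> {\<zeta>. Re \<zeta> < real (k + 2)}" by (auto simp: S_def)
    have oS: "open S" unfolding S' by (intro open_Int open_halfspace_Re_lt open_halfspace_Re_gt)
    have SZ: "S \<inter> \<int> = {of_nat (Suc k)}"
    proof -
      have "x = of_nat (Suc k)" if x: "x \<in> S \<inter> \<int>" for x
      proof -
        obtain n :: int where n: "x = of_int n" using x by (auto elim: Ints_cases)
        have "real k < of_int n" "of_int n < real (k + 2)" using x unfolding S_def n by auto
        hence "n = int (Suc k)" by linarith
        thus ?thesis by (simp add: n)
      qed
      moreover have "of_nat (Suc k) \<in> S \<inter> \<int>" unfolding S_def by auto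
      ultimately show ?thesis by blast
    qed
    have kS: "of_nat (Suc k) \<in> S" using SZ by blast
    have hS: "(\<lambda>\<zeta>. h \<zeta> * exp (\<zeta> * w)) holomorphic_on S"
      by (intro holomorphic_intros holomorphic_on_subset[OF holo]) (auto simp: S_def)
    have "J (Suc k) - J k = 2 * pi * residue G (of_real (real (Suc k)))"
      unfolding J_def
    proof (rule strip_residue[OF _ _ _ _ _ int int \<kappa>, where \<alpha>="real k" and \<beta>="real (k+2)" and M="4*K"])
      have "sin (of_real pi * \<zeta>) \<noteq> 0" if "\<zeta> \<in> S - {of_nat (Suc k)}" for \<zeta> using that SZ z by blast
      hence "G holomorphic_on S - {of_nat (Suc k)}"
        unfolding G_def by (intro holomorphic_intros holomorphic_on_subset[OF hS]) auto
      thus "G holomorphic_on {\<zeta>. real k < Re \<zeta> \<and> Re \<zeta> < real (k+2)} - {of_real (real (Suc k))}"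
        by (simp add: S_def)
      fix \<zeta> assume \<zeta>: "real k + s \<le> Re \<zeta>" "1 \<le> \<bar>Im \<zeta>\<bar>"
      have "1 * \<bar>Im \<zeta>\<bar> \<le> pi * \<bar>Im \<zeta>\<bar>" using pi_gt3 by (intro mult_right_mono) auto
      hence s1: "norm (sin (of_real pi * \<zeta>)) \<ge> exp (pi * \<bar>Im \<zeta>\<bar>) / 4"
        using norm_sin_ge_horizontal[of "of_real pi * \<zeta>"] \<zeta> by (simp add: abs_mult)
      have "norm (G \<zeta>) = norm (h \<zeta> * exp (\<zeta> * w)) / norm (sin (of_real pi * \<zeta>))"
        by (simp add: G_def norm_divide)
      also have "\<dots> \<le> norm (h \<zeta> * exp (\<zeta> * w)) / (exp (pi * \<bar>Im \<zeta>\<bar>) / 4)"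
        using s1 by (intro divide_left_mono) (auto intro!: mult_pos_pos elim!: less_le_trans[rotated])
      also have "\<dots> \<le> (K * 1 * exp ((pi - \<kappa>) * \<bar>Im \<zeta>\<bar>)) / (exp (pi * \<bar>Im \<zeta>\<bar>) / 4)"
      proof (intro divide_right_mono order_trans[OF num] mult_right_mono mult_left_mono)
        show p: "Re \<zeta> > 0" using \<zeta> s by linarith
        show "exp ((Re w + b) * Re \<zeta>) \<le> 1" using p w by (simp add: mult_le_0_iff)
      qed (use K in auto)
      also have "\<dots> = 4 * K * exp (- \<kappa> * \<bar>Im \<zeta>\<bar>)"
        by (simp add: field_simps flip: exp_add)
      finally show "norm (G \<zeta>) \<le> 4 * K * exp (- \<kappa> * \<bar>Im \<zeta>\<bar>)" .
    qed (use s in auto)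
    also have "residue G (of_real (real (Suc k))) = (-1) ^ Suc k * (h (of_nat (Suc k)) * exp (of_nat (Suc k) * w)) / of_real pi"
      using residue_over_sin[OF oS kS hS SZ] unfolding G_def by (simp add: mult.assoc)
    finally show ?thesis by (simp add: mult.assoc)
  qed
  have J0: "J \<longlonglongrightarrow> 0"
  proof (rule Lim_null_comparison)
    define E where "E = (\<integral>t. exp (- \<kappa> * \<bar>t\<bar>) \<partial>lborel)"
    show "\<forall>\<^sub>F k in sequentially. norm (J k) \<le> 2 * K / c * q ^ k * E"
    proof (rule always_eventually, rule allI)
      fix k
      have "norm (J k) \<le> (\<integral>t. norm (G (Complex (real k + s) t)) \<partial>lborel)"
        unfolding J_def by (rule integral_norm_bound)
      also have "\<dots> \<le> (\<integral>t. (2 * K / c * q ^ k) * exp (- \<kappa> * \<bar>t\<bar>) \<partial>lborel)"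
        by (intro integral_mono vert integrable_norm int integrable_mult_right integrable_exp_abs \<kappa>)
      finally show "norm (J k) \<le> 2 * K / c * q ^ k * E" by (simp add: E_def)
    qed
    have "(\<lambda>k. 2 * K / c * q ^ k * E) \<longlonglongrightarrow> 2 * K / c * 0 * E"
      using q by (intro tendsto_intros LIMSEQ_power_zero) auto
    thus "(\<lambda>k. 2 * K / c * q ^ k * E) \<longlonglongrightarrow> 0" by simp
  qed
  have "(\<lambda>k. J (Suc k) - J k) sums (0 - J 0)" by (rule telescope_sums[OF J0])
  hence "(\<lambda>k. (1/2) * (J (Suc k) - J k)) sums ((1/2) * (0 - J 0))" by (rule sums_mult)
  thus "(\<lambda>k. (-1) ^ Suc k * h (of_nat (Suc k)) * exp (of_nat (Suc k) * w)) sums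
           (- (1/2) * (\<integral>t. G (Complex s t) \<partial>lborel))"
    unfolding step by (simp add: J_def)
qed

section \<open>Holomorphic functions of several variables\<close>

lemma bounded_linear_vector_smult: "bounded_linear (\<lambda>h. h *s (v :: complex ^ 'n))"
  by (intro linear_conv_bounded_linear[THEN iffD1] linearI) (auto simp: vec_eq_iff algebra_simps)

lemma mv_holomorphic_on_line:
  fixes F :: "complex ^ 'n \<Rightarrow> complex"
  assumes "mv_holomorphic_on F U"
  shows "open {\<theta>. p + \<theta> *s v \<in> U}"
    and "(\<lambda>\<theta>. F (p + \<theta> *s v)) holomorphic_on {\<theta>. p + \<theta> *s v \<in> U}"
proof -
  have der: "((\<lambda>\<theta>. p + \<theta> *s v) has_derivative (\<lambda>h. h *s v)) (at \<theta>)" for \<theta>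
    using has_derivative_add[OF has_derivative_const bounded_linear_imp_has_derivative[OF bounded_linear_vector_smult]] by simp
  have "continuous_on UNIV (\<lambda>\<theta>. p + \<theta> *s v)"
    by (rule has_derivative_continuous_on) (rule has_derivative_at_withinI[OF der])
  hence "open ((\<lambda>\<theta>. p + \<theta> *s v) -` U)"
    using assms open_vimage unfolding mv_holomorphic_on_def by blast
  thus op: "open {\<theta>. p + \<theta> *s v \<in> U}" by (simp add: vimage_def)
  show "(\<lambda>\<theta>. F (p + \<theta> *s v)) holomorphic_on {\<theta>. p + \<theta> *s v \<in> U}"
    unfolding holomorphic_on_open[OF op]
  proof clarsimp
    fix \<theta> assume "p + \<theta> *s v \<in> U"
    then obtain D where D: "(F has_derivative D) (at (p + \<theta> *s v))" "\<forall>c v. D (c *s v) = c * D v"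
      using assms unfolding mv_holomorphic_on_def by blast
    have "((\<lambda>\<theta>. F (p + \<theta> *s v)) has_derivative (\<lambda>h. D (h *s v))) (at \<theta>)"
      using has_derivative_compose[OF der D(1)] by simp
    moreover have "(\<lambda>h. D (h *s v)) = (*) (D v)" using D(2) by (auto simp: mult.commute)
    ultimately show "\<exists>f'. ((\<lambda>\<theta>. F (p + \<theta> *s v)) has_field_derivative f') (at \<theta>)"
      by (auto simp: has_field_derivative_def)
  qed
qed

text \<open>On a convex set any two points are joined by a segment, and the points of its complex line that lie in the set
form a convex, hence connected, plane domain. So the one-variable identity theorem suffices.\<close>

lemma mv_holomorphic_identity:
  fixes F H :: "complex ^ 'n \<Rightarrow> complex"
  assumes F: "mv_holomorphic_on F U" and H: "mv_holomorphic_on H U" and U: "convex U"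
    and V: "open V" "V \<subseteq> U" "v \<in> V" and eq: "\<And>z. z \<in> V \<Longrightarrow> F z = H z"
    and z: "z \<in> U"
  shows "F z = H z"
proof -
  define S where "S = {\<theta>. z + \<theta> *s (v - z) \<in> U}"
  define T where "T = {\<theta>. z + \<theta> *s (v - z) \<in> V}"
  have FS: "open S" "(\<lambda>\<theta>. F (z + \<theta> *s (v - z))) holomorphic_on S"
    unfolding S_def by (intro mv_holomorphic_on_line[OF F])+
  have HS: "(\<lambda>\<theta>. H (z + \<theta> *s (v - z))) holomorphic_on S"
    unfolding S_def by (intro mv_holomorphic_on_line[OF H])
  have "mv_holomorphic_on (\<lambda>_. 0) V" unfolding mv_holomorphic_on_def using V(1)
    by (auto intro!: exI[of _ "\<lambda>_. 0"])
  hence oT: "open T" unfolding T_def using mv_holomorphic_on_line(1) by blast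
  have "convex S"
  proof (rule convexI)
    fix x y :: complex and c d :: real
    assume "x \<in> S" "y \<in> S" and c: "0 \<le> c" "0 \<le> d" "c + d = 1"
    hence "c *\<^sub>R (z + x *s (v - z)) + d *\<^sub>R (z + y *s (v - z)) \<in> U"
      using convexD[OF U] by (auto simp: S_def)
    also have "c *\<^sub>R (z + x *s (v - z)) + d *\<^sub>R (z + y *s (v - z)) =
      (c + d) *\<^sub>R z + (c *\<^sub>R x + d *\<^sub>R y) *s (v - z)"
      by (simp add: vec_eq_iff algebra_simps)
    finally show "c *\<^sub>R x + d *\<^sub>R y \<in> S" using c by (simp add: S_def)
  qed
  hence con: "connected S" by (rule convex_connected)
  have T1: "1 \<in> T" using V(3) by (simp add: T_def)
  have TS: "T \<subseteq> S" using V(2) by (auto simp: S_def T_def)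
  have "F (z + 0 *s (v - z)) = H (z + 0 *s (v - z))"
  proof (rule analytic_continuation_open[OF oT FS(1) _ con TS FS(2) HS])
    show "T \<noteq> {}" using T1 by auto
    show "F (z + \<theta> *s (v - z)) = H (z + \<theta> *s (v - z))" if "\<theta> \<in> T" for \<theta>
      using that eq by (auto simp: T_def)
    show "0 \<in> S" using z by (simp add: S_def)
  qed
  thus ?thesis by simp
qed

lemma norm_exp_minus_linear:
  fixes z :: complex shows "norm (exp z - 1 - z) \<le> (norm z)\<^sup>2 * exp (norm z)"
  
using Taylor_exp_field[of z 1] by (simp add: algebra_simps power2_eq_square)

text \<open>An exponential moment slightly larger than the one at \<open>w\<close> absorbs the factors produced by
\<open>\<bar>exp y - 1 - y\<bar> \<le> \<bar>y\<bar>\<^sup>2 exp \<bar>y\<bar>\<close>, so the remainder is quadratic in the increment and no limit has to be taken under the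
integral. The measure space is arbitrary because both the contour integral and the power series are of this form.\<close>

lemma exponential_moment_has_derivative:
  fixes A :: "'a \<Rightarrow> complex" and Z :: "'a \<Rightarrow> complex ^ 'n"
  assumes A: "A \<in> borel_measurable M" and Z: "Z \<in> borel_measurable M" and r: "r > 0"
    and int: "integrable M (\<lambda>x. norm (A x * exp (\<Sum>j\<in>UNIV. Z x $ j * w $ j)) * exp (r * (\<Sum>j\<in>UNIV. norm (Z x $ j))))"
  shows "\<exists>D. ((\<lambda>w. \<integral>x. A x * exp (\<Sum>j\<in>UNIV. Z x $ j * w $ j) \<partial>M) has_derivative D) (at w) \<and>
    (\<forall>c v. D (c *s v) = c * D v)"
proof -
  define E where "E = (\<lambda>w x. A x * exp (\<Sum>j\<in>UNIV. Z x $ j * w $ j))"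
  define S where "S = (\<lambda>x. \<Sum>j\<in>UNIV. norm (Z x $ j))"
  define W where "W = (\<lambda>x. norm (E w x) * exp (r * S x))"
  have intW: "integrable M W" using int by (simp add: W_def E_def S_def)
  have S0: "S x \<ge> 0" for x by (auto simp: S_def intro: sum_nonneg)
  have Zj: "(\<lambda>x. Z x $ j) \<in> borel_measurable M" for j
    by (rule measurable_compose[OF Z borel_measurable_continuous_onI]) (intro continuous_intros)
  have ZS: "norm (Z x $ j) \<le> S x" for x j unfolding S_def by (rule member_le_sum) auto
  have meas: "E v \<in> borel_measurable M" for v
    unfolding E_def using A Zj by measurable
  define D where "D = (\<lambda>h :: complex ^ 'n. \<Sum>j\<in>UNIV. h $ j * (\<integral>x. E w x * Z x $ j \<partial>M))"
  have lin: "norm (\<Sum>j\<in>UNIV. Z x $ j * h $ j) \<le> norm h * S x" for x and h :: "complex ^ 'n"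
  proof -
    have "norm (\<Sum>j\<in>UNIV. Z x $ j * h $ j) \<le> (\<Sum>j\<in>UNIV. norm (Z x $ j) * norm h)"
      by (rule order_trans[OF norm_sum]) (auto simp: norm_mult intro!: sum_mono mult_left_mono Finite_Cartesian_Product.norm_nth_le)
    thus ?thesis by (simp add: S_def sum_distrib_left mult.commute)
  qed
  have exp1: "t \<le> exp t" for t :: real using exp_ge_add_one_self[of t] by linarith
  have SE: "S x \<le> (1 / r) * exp (r * S x)" for x
    using exp1[of "r * S x"] r by (simp add: field_simps)
  have SE2: "(S x)\<^sup>2 * exp (r / 2 * S x) \<le> (16 / r\<^sup>2) * exp (r * S x)" for x
  proof -
    have "r / 4 * S x \<le> exp (r / 4 * S x)" by (rule exp1)
    hence "(r / 4 * S x)\<^sup>2 \<le> (exp (r / 4 * S x))\<^sup>2" using r S0 by (intro power_mono) auto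
    also have "\<dots> = exp (r / 2 * S x)" by (simp add: power2_eq_square flip: exp_add)
    finally have "(r / 4 * S x)\<^sup>2 * exp (r / 2 * S x) \<le> exp (r / 2 * S x) * exp (r / 2 * S x)"
      by (intro mult_right_mono) auto
    also have "\<dots> = exp (r * S x)" by (simp flip: exp_add)
    finally show ?thesis using r by (simp add: field_simps power2_eq_square)
  qed
  have intEZ: "integrable M (\<lambda>x. E w x * Z x $ j)" for j
  proof (rule Bochner_Integration.integrable_bound)
    show "integrable M (\<lambda>x. (1/r) * W x)" using intW by simp
    show "(\<lambda>x. E w x * Z x $ j) \<in> borel_measurable M" using meas Zj by simp
    have "norm (E w x * Z x $ j) \<le> norm ((1/r) * W x)" for x
    proof -
      have "norm (E w x * Z x $ j) \<le> norm (E w x) * ((1 / r) * exp (r * S x))"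
        unfolding norm_mult using SE[of x] ZS[of x j] by (intro mult_left_mono) auto
      thus ?thesis using r by (simp add: W_def)
    qed
    thus "AE x in M. norm (E w x * Z x $ j) \<le> norm ((1/r) * W x)" by simp
  qed
  have intE: "integrable M (E v)" if "norm (v - w) \<le> r" for v
  proof (rule Bochner_Integration.integrable_bound[OF intW meas])
    have "norm (E v x) \<le> norm (W x)" for x
    proof -
      have "E v x = E w x * exp (\<Sum>j\<in>UNIV. Z x $ j * (v - w) $ j)"
        by (simp add: E_def algebra_simps sum_subtractf flip: exp_add)
      moreover have "norm (\<Sum>j\<in>UNIV. Z x $ j * (v - w) $ j) \<le> r * S x"
        using lin[of x "v - w"] mult_right_mono[OF that S0[of x]] by linarith
      hence "norm (exp (\<Sum>j\<in>UNIV. Z x $ j * (v - w) $ j)) \<le> exp (r * S x)"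
        by (meson exp_le_cancel_iff norm_exp order_trans)
      ultimately show ?thesis by (simp add: W_def norm_mult mult_left_mono)
    qed
    thus "AE x in M. norm (E v x) \<le> norm (W x)" by simp
  qed
  have Dint: "D h = (\<integral>x. E w x * (\<Sum>j\<in>UNIV. Z x $ j * h $ j) \<partial>M)"
    and intD: "integrable M (\<lambda>x. E w x * (\<Sum>j\<in>UNIV. Z x $ j * h $ j))" for h
  proof -
    have eq: "(\<lambda>x. E w x * (\<Sum>j\<in>UNIV. Z x $ j * h $ j)) = (\<lambda>x. \<Sum>j\<in>UNIV. h $ j * (E w x * Z x $ j))"
      by (simp add: sum_distrib_left mult_ac)
    show "D h = (\<integral>x. E w x * (\<Sum>j\<in>UNIV. Z x $ j * h $ j) \<partial>M)"
      unfolding eq D_def using intEZ by (subst Bochner_Integration.integral_sum) auto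
    show "integrable M (\<lambda>x. E w x * (\<Sum>j\<in>UNIV. Z x $ j * h $ j))"
      unfolding eq using intEZ by (intro Bochner_Integration.integrable_sum integrable_mult_right) auto
  qed
  define B where "B = (16 / r\<^sup>2) * (\<integral>x. W x \<partial>M)"
  have quad: "norm ((\<integral>x. E (w + h) x \<partial>M) - (\<integral>x. E w x \<partial>M) - D h) \<le> (norm h)\<^sup>2 * B" if h: "norm h \<le> r / 2" for h
  proof -
    have i1: "integrable M (E (w + h))" using h r by (intro intE) auto
    have i2: "integrable M (E w)" using r by (intro intE) auto
    have "(\<integral>x. E (w + h) x \<partial>M) - (\<integral>x. E w x \<partial>M) - D h
       = (\<integral>x. E (w + h) x - E w x - E w x * (\<Sum>j\<in>UNIV. Z x $ j * h $ j) \<partial>M)"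
      using i1 i2 intD by (simp add: Dint)
    also have "norm \<dots> \<le> (\<integral>x. (norm h)\<^sup>2 * ((16 / r\<^sup>2) * W x) \<partial>M)"
    proof (rule order_trans[OF integral_norm_bound], rule integral_mono)
      show "integrable M (\<lambda>x. norm (E (w + h) x - E w x - E w x * (\<Sum>j\<in>UNIV. Z x $ j * h $ j)))"
        using i1 i2 intD by (intro integrable_norm Bochner_Integration.integrable_diff) auto
      show "integrable M (\<lambda>x. (norm h)\<^sup>2 * ((16 / r\<^sup>2) * W x))" using intW by simp
      fix x
      define y where "y = (\<Sum>j\<in>UNIV. Z x $ j * h $ j)"
      have ny: "norm y \<le> norm h * S x" unfolding y_def by (rule lin)
      have ny2: "norm y \<le> r / 2 * S x" using ny mult_right_mono[OF h S0[of x]] by linarith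
      have "E (w + h) x = E w x * exp y"
        by (simp add: E_def y_def algebra_simps sum.distrib flip: exp_add)
      hence "norm (E (w + h) x - E w x - E w x * y) = norm (E w x) * norm (exp y - 1 - y)"
        by (simp add: algebra_simps flip: norm_mult)
      also have "\<dots> \<le> norm (E w x) * ((norm y)\<^sup>2 * exp (norm y))"
        by (intro mult_left_mono norm_exp_minus_linear) auto
      also have "\<dots> \<le> norm (E w x) * ((norm h * S x)\<^sup>2 * exp (r / 2 * S x))"
        using ny ny2 by (intro mult_left_mono mult_mono power_mono) auto
      also have "\<dots> = norm (E w x) * (norm h)\<^sup>2 * ((S x)\<^sup>2 * exp (r / 2 * S x))"
        by (simp add: power_mult_distrib)
      also have "\<dots> \<le> norm (E w x) * (norm h)\<^sup>2 * ((16 / r\<^sup>2) * exp (r * S x))"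
        by (intro mult_left_mono SE2) auto
      also have "\<dots> = (norm h)\<^sup>2 * ((16 / r\<^sup>2) * W x)" by (simp add: W_def)
      finally show "norm (E (w + h) x - E w x - E w x * (\<Sum>j\<in>UNIV. Z x $ j * h $ j)) \<le> (norm h)\<^sup>2 * ((16 / r\<^sup>2) * W x)"
        by (simp add: y_def)
    qed
    also have "\<dots> = (norm h)\<^sup>2 * B" by (simp add: B_def)
    finally show ?thesis .
  qed
  have "bounded_linear D"
    by (intro linear_conv_bounded_linear[THEN iffD1] linearI)
       (auto simp: D_def algebra_simps sum.distrib scaleR_sum_right)
  moreover have "(\<lambda>h. norm ((\<integral>x. E (w + h) x \<partial>M) - (\<integral>x. E w x \<partial>M) - D h) / norm h) \<midarrow>0\<rightarrow> 0"
  proof (rule Lim_null_comparison)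
    have "\<forall>\<^sub>F h in at 0. norm h < r / 2 \<and> h \<noteq> (0::complex^'n)"
      unfolding eventually_at using r by (intro exI[of _ "r/2"]) (auto simp: dist_norm)
    thus "\<forall>\<^sub>F h in at 0. norm (norm ((\<integral>x. E (w + h) x \<partial>M) - (\<integral>x. E w x \<partial>M) - D h) / norm h) \<le> norm h * B"
    proof eventually_elim
      case (elim h)
      thus ?case using quad[of h] by (simp add: field_simps power2_eq_square)
    qed
    have "((\<lambda>h::complex^'n. norm h * B) \<longlongrightarrow> norm (0::complex^'n) * B) (at 0)" by (intro tendsto_intros)
    thus "((\<lambda>h::complex^'n. norm h * B) \<longlongrightarrow> 0) (at 0)" by simp
  qed
  ultimately have "((\<lambda>w. \<integral>x. E w x \<partial>M) has_derivative D) (at w)"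
    unfolding has_derivative_at by blast
  moreover have "D (c *s v) = c * D v" for c v by (simp add: D_def sum_distrib_left mult_ac)
  ultimately show ?thesis unfolding E_def by blast
qed

section \<open>Growth near the imaginary space\<close>

text \<open>Dividing by the exponential that interpolates the two boundary bounds reduces the claim to the maximum modulus
principle with bound 1. The decay hypothesis makes that bound hold outside a bounded rectangle.\<close>

lemma three_lines:
  fixes u :: "complex \<Rightarrow> complex"
  assumes U: "u holomorphic_on U" "open U" "{\<theta>. 0 \<le> Re \<theta> \<and> Re \<theta> \<le> 1} \<subseteq> U"
    and left: "\<And>\<theta>. Re \<theta> = 0 \<Longrightarrow> norm (u \<theta>) \<le> exp A"
    and right: "\<And>\<theta>. Re \<theta> = 1 \<Longrightarrow> norm (u \<theta>) \<le> exp B"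
    and decay: "\<And>\<epsilon>. \<epsilon> > 0 \<Longrightarrow> \<exists>T. \<forall>\<theta>. 0 \<le> Re \<theta> \<and> Re \<theta> \<le> 1 \<and> T \<le> \<bar>Im \<theta>\<bar> \<longrightarrow> norm (u \<theta>) \<le> \<epsilon>"
    and \<theta>: "0 \<le> Re \<theta>" "Re \<theta> \<le> 1"
  shows "norm (u \<theta>) \<le> exp ((1 - Re \<theta>) * A + Re \<theta> * B)"
proof -
  define v where "v = (\<lambda>\<theta>. u \<theta> * exp (- (of_real A + \<theta> * of_real (B - A))))"
  have nv: "norm (v \<theta>) = norm (u \<theta>) * exp (- (A + Re \<theta> * (B - A)))" for \<theta>
    by (simp add: v_def norm_mult)
  obtain T where T: "\<forall>\<theta>. 0 \<le> Re \<theta> \<and> Re \<theta> \<le> 1 \<and> T \<le> \<bar>Im \<theta>\<bar> \<longrightarrow> norm (u \<theta>) \<le> exp (min A B)"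
    using decay[of "exp (min A B)"] by auto
  have v1: "norm (v z) \<le> 1" if "0 \<le> Re z" "Re z \<le> 1" "Re z = 0 \<or> Re z = 1 \<or> T \<le> \<bar>Im z\<bar>" for z
  proof -
    have "min A B \<le> A + Re z * (B - A)"
    proof (cases "A \<le> B")
      case True thus ?thesis using that by (simp add: min_def)
    next
      case False
      hence "(1 - Re z) * (A - B) \<ge> 0" using that by (intro mult_nonneg_nonneg) auto
      thus ?thesis using False by (simp add: algebra_simps)
    qed
    hence "norm (u z) \<le> exp (A + Re z * (B - A))"
      using that left[of z] right[of z] T by (auto intro: order_trans)
    hence "norm (v z) \<le> exp (A + Re z * (B - A)) * exp (- (A + Re z * (B - A)))"
      unfolding nv by (intro mult_right_mono) auto
    thus ?thesis by (simp flip: exp_add)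
  qed
  have "norm (v \<theta>) \<le> 1"
  proof (cases "T \<le> \<bar>Im \<theta>\<bar>")
    case True thus ?thesis using v1 \<theta> by auto
  next
    case False
    define S where "S = cbox (Complex 0 (-T)) (Complex 1 T)"
    have hv: "v holomorphic_on U" unfolding v_def by (intro holomorphic_intros U)
    have SU: "S \<subseteq> U" using U(3) by (auto simp: S_def in_cbox_complex_iff)
    show ?thesis
    proof (rule maximum_modulus_frontier[of v S])
      show "v holomorphic_on interior S" using hv SU interior_subset holomorphic_on_subset by blast
      show "continuous_on (closure S) v" unfolding S_def
        using hv SU by (simp add: S_def holomorphic_on_imp_continuous_on holomorphic_on_subset closure_cbox)
      show "bounded S" by (simp add: S_def)
      show "\<theta> \<in> S" using \<theta> False by (auto simp: S_def in_cbox_complex_iff)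
      fix z assume "z \<in> frontier S"
      hence "z \<in> S - box (Complex 0 (-T)) (Complex 1 T)" by (simp add: S_def frontier_cbox)
      thus "norm (v z) \<le> 1" by (intro v1) (auto simp: S_def in_cbox_complex_iff in_box_complex_iff)
    qed
  qed
  hence "norm (u \<theta>) * exp (- (A + Re \<theta> * (B - A))) * exp (A + Re \<theta> * (B - A)) \<le> 1 * exp (A + Re \<theta> * (B - A))"
    unfolding nv by (intro mult_right_mono) auto
  hence "norm (u \<theta>) \<le> exp (A + Re \<theta> * (B - A))" by (simp add: mult.assoc flip: exp_add)
  thus ?thesis by (simp add: algebra_simps)
qed

text \<open>The point with real parts in \<open>{0, s}\<close> lies on the complex line through the imaginary space in a direction \<open>e\<close> with
coordinates 0 and 1, at parameter \<open>s\<close>. On that line the three lines theorem is applied to \<open>\<phi>\<close>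
times \<open>exp (\<theta>\<^sup>2)\<close>: the Gaussian factor turns the linear growth along the line into additive constants, and the interpolated
exponent \<open>(1 - s) G \<eta> + s \<pi> \<bar>\<eta>\<bar>\<close> differs from \<open>G \<eta>\<close> by at most \<open>s (L + \<pi>) \<bar>\<eta>\<bar>\<close>. What matters is
that \<open>K\<close> does not depend on \<open>s\<close>.\<close>

lemma growth_near_imaginary_space:
  fixes \<phi> :: "complex ^ 'n \<Rightarrow> complex" and G g :: "real ^ 'n \<Rightarrow> real"
  assumes holo: "mv_holomorphic_near \<phi> right_half_space"
    and est1: "\<And>\<eta>. norm (\<phi> (cvec 0 \<eta>)) \<le> exp (g \<eta>)"
    and est2: "\<And>\<xi> \<eta>. (\<And>j. 0 \<le> \<xi> $ j) \<Longrightarrow>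
        norm (\<phi> (cvec \<xi> \<eta>)) \<le> exp ((\<Sum>j\<in>UNIV. (pi - \<delta>) * \<bar>\<eta> $ j\<bar> + b * \<xi> $ j) + C)"
    and \<delta>: "\<delta> > 0"
    and gG: "\<And>\<eta> \<tau> e. (\<And>j. \<bar>e $ j\<bar> \<le> 1) \<Longrightarrow> g (\<eta> + \<tau> *\<^sub>R e) \<le> G \<eta> + A + L * \<bar>\<tau>\<bar>"
    and G: "\<And>\<eta>. - L * (\<Sum>j\<in>UNIV. \<bar>\<eta> $ j\<bar>) \<le> G \<eta>"
  obtains K where "\<And>s \<xi> \<eta>. 0 \<le> s \<Longrightarrow> s \<le> 1 \<Longrightarrow> (\<And>j. \<xi> $ j \<in> {0, s}) \<Longrightarrow>
     norm (\<phi> (cvec \<xi> \<eta>)) \<le> exp (K + G \<eta> + s * (L + pi) * (\<Sum>j\<in>UNIV. \<bar>\<eta> $ j\<bar>))"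
proof -
  define N where "N = real CARD('n)"
  \<comment> \<open>the squares bound the maxima of \<open>x \<bar>\<tau>\<bar> - \<tau>\<^sup>2\<close> for \<open>x = L\<close> and \<open>x = N \<pi>\<close>\<close>
  define A0 where "A0 = A + L\<^sup>2"
  define B0 where "B0 = N * \<bar>b\<bar> + C + 1 + (N * pi)\<^sup>2"
  obtain U where U: "right_half_space \<subseteq> U" "mv_holomorphic_on \<phi> U"
    using holo unfolding mv_holomorphic_near_def by blast
  show ?thesis
  proof (rule that)
    fix s :: real and \<xi> \<eta> :: "real ^ 'n"
    assume s: "0 \<le> s" "s \<le> 1" and \<xi>: "\<And>j. \<xi> $ j \<in> {0, s}"
    define e :: "real ^ 'n" where "e = (\<chi> j. if \<xi> $ j = 0 then 0 else 1)"
    have e01: "0 \<le> e $ j" "e $ j \<le> 1" for j by (auto simp: e_def)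
    have \<xi>e: "\<xi> = s *\<^sub>R e" using \<xi> by (auto simp: e_def vec_eq_iff)
    define Z where "Z = (\<lambda>\<theta>. cvec 0 \<eta> + \<theta> *s (\<chi> j. of_real (e $ j)))"
    have Z: "Z \<theta> = cvec (Re \<theta> *\<^sub>R e) (\<eta> + Im \<theta> *\<^sub>R e)" for \<theta>
      by (auto simp: Z_def cvec_def vec_eq_iff complex_eq_iff)
    define u where "u = (\<lambda>\<theta>. \<phi> (Z \<theta>) * exp (\<theta>\<^sup>2))"
    define E where "E = (\<Sum>j\<in>UNIV. \<bar>\<eta> $ j\<bar>)"
    have n2: "norm (exp (\<theta>\<^sup>2)) = exp ((Re \<theta>)\<^sup>2 - (Im \<theta>)\<^sup>2)" for \<theta> :: complex
      by (simp add: power2_eq_square)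
    have am: "x * \<bar>\<tau>\<bar> - \<tau>\<^sup>2 \<le> x\<^sup>2 - \<tau>\<^sup>2 / 2" for x \<tau> :: real
    proof -
      have "2 * (x * \<bar>\<tau>\<bar>) \<le> x\<^sup>2 + \<tau>\<^sup>2" using sum_squares_bound[of x "\<bar>\<tau>\<bar>"] by (simp add: mult.assoc)
      thus ?thesis using zero_le_power2[of x] by linarith
    qed
    have left: "norm (u \<theta>) \<le> exp (G \<eta> + A0)" if "Re \<theta> = 0" for \<theta>
    proof -
      have "norm (u \<theta>) \<le> exp (G \<eta> + A + L * \<bar>Im \<theta>\<bar>) * exp (- (Im \<theta>)\<^sup>2)"
        unfolding u_def norm_mult n2 Z
        using est1[of "\<eta> + Im \<theta> *\<^sub>R e"] gG[of e \<eta> "Im \<theta>"] that e01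
        by (intro mult_mono) (auto intro: order_trans)
      also have "\<dots> = exp (G \<eta> + A + (L * \<bar>Im \<theta>\<bar> - (Im \<theta>)\<^sup>2))" by (simp flip: exp_add)
      also have "\<dots> \<le> exp (G \<eta> + A0)" 
      proof -
        have "L * \<bar>Im \<theta>\<bar> - (Im \<theta>)\<^sup>2 \<le> L\<^sup>2" using am[of L "Im \<theta>"] zero_le_power2[of "Im \<theta>"] by linarith
        thus ?thesis by (simp add: A0_def)
      qed
      finally show ?thesis .
    qed
    have mid: "norm (u \<theta>) \<le> exp (pi * E + B0 - (Im \<theta>)\<^sup>2 / 2)" if "0 \<le> Re \<theta>" "Re \<theta> \<le> 1" for \<theta>
    proof -
      have "(\<Sum>j\<in>UNIV. (pi - \<delta>) * \<bar>\<eta> $ j + Im \<theta> * e $ j\<bar> + b * (Re \<theta> * e $ j))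
          \<le> (\<Sum>j\<in>UNIV. pi * \<bar>\<eta> $ j\<bar> + (pi * \<bar>Im \<theta>\<bar> + \<bar>b\<bar>))"
      proof (rule sum_mono)
        fix j
        have "(pi - \<delta>) * \<bar>\<eta> $ j + Im \<theta> * e $ j\<bar> \<le> pi * \<bar>\<eta> $ j + Im \<theta> * e $ j\<bar>"
          using \<delta> by (intro mult_right_mono) auto
        also have "\<dots> \<le> pi * (\<bar>\<eta> $ j\<bar> + \<bar>Im \<theta>\<bar>)"
        proof (intro mult_left_mono)
          have "\<bar>Im \<theta> * e $ j\<bar> \<le> \<bar>Im \<theta>\<bar> * 1" unfolding abs_mult using e01[of j] by (intro mult_left_mono) auto
          thus "\<bar>\<eta> $ j + Im \<theta> * e $ j\<bar> \<le> \<bar>\<eta> $ j\<bar> + \<bar>Im \<theta>\<bar>" by linarith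
        qed simp
        finally have 1: "(pi - \<delta>) * \<bar>\<eta> $ j + Im \<theta> * e $ j\<bar> \<le> pi * (\<bar>\<eta> $ j\<bar> + \<bar>Im \<theta>\<bar>)" .
        have "Re \<theta> * e $ j \<le> 1" "0 \<le> Re \<theta> * e $ j" using that e01[of j] by (auto intro: mult_le_one)
        hence "b * (Re \<theta> * e $ j) \<le> \<bar>b\<bar> * 1" by (intro mult_mono) auto
        with 1 show "(pi - \<delta>) * \<bar>\<eta> $ j + Im \<theta> * e $ j\<bar> + b * (Re \<theta> * e $ j) \<le> pi * \<bar>\<eta> $ j\<bar> + (pi * \<bar>Im \<theta>\<bar> + \<bar>b\<bar>)"
          by (simp add: algebra_simps)
      qed
      also have "\<dots> = pi * E + N * (pi * \<bar>Im \<theta>\<bar> + \<bar>b\<bar>)"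
        by (simp add: sum.distrib E_def N_def sum_distrib_left)
      finally have sm: "(\<Sum>j\<in>UNIV. (pi - \<delta>) * \<bar>\<eta> $ j + Im \<theta> * e $ j\<bar> + b * (Re \<theta> * e $ j))
          \<le> pi * E + N * (pi * \<bar>Im \<theta>\<bar> + \<bar>b\<bar>)" .
      have "norm (\<phi> (Z \<theta>)) \<le> exp (pi * E + N * (pi * \<bar>Im \<theta>\<bar> + \<bar>b\<bar>) + C)"
      proof -
        have "norm (\<phi> (Z \<theta>)) \<le> exp ((\<Sum>j\<in>UNIV. (pi - \<delta>) * \<bar>(\<eta> + Im \<theta> *\<^sub>R e) $ j\<bar> + b * (Re \<theta> *\<^sub>R e) $ j) + C)"
          unfolding Z by (rule est2) (use that e01 in simp)
        also have "\<dots> \<le> exp (pi * E + N * (pi * \<bar>Im \<theta>\<bar> + \<bar>b\<bar>) + C)"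
          using sm by simp
        finally show ?thesis .
      qed
      moreover have "norm (exp (\<theta>\<^sup>2)) \<le> exp (1 - (Im \<theta>)\<^sup>2)"
        unfolding n2 using that by (simp add: power_le_one)
      ultimately have "norm (u \<theta>) \<le> exp (pi * E + N * (pi * \<bar>Im \<theta>\<bar> + \<bar>b\<bar>) + C) * exp (1 - (Im \<theta>)\<^sup>2)"
        unfolding u_def norm_mult by (intro mult_mono) auto
      also have "\<dots> = exp (pi * E + (N * \<bar>b\<bar> + C + 1) + ((N * pi) * \<bar>Im \<theta>\<bar> - (Im \<theta>)\<^sup>2))"
        by (simp add: algebra_simps flip: exp_add)
      also have "\<dots> \<le> exp (pi * E + B0 - (Im \<theta>)\<^sup>2 / 2)"
        using am[of "N * pi" "Im \<theta>"] by (simp add: B0_def)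
      finally show ?thesis .
    qed
    define V where "V = {\<theta>. Z \<theta> \<in> U}"
    have "norm (u (of_real s)) \<le> exp ((1 - Re (of_real s)) * (G \<eta> + A0) + Re (of_real s) * (pi * E + B0))"
    proof (rule three_lines[of u V])
      show "open V" unfolding V_def Z_def using mv_holomorphic_on_line(1)[OF U(2)] .
      have "(\<lambda>\<theta>. \<phi> (Z \<theta>)) holomorphic_on V" unfolding V_def Z_def using mv_holomorphic_on_line(2)[OF U(2)] .
      thus "u holomorphic_on V" unfolding u_def by (intro holomorphic_intros)
      show "{\<theta>. 0 \<le> Re \<theta> \<and> Re \<theta> \<le> 1} \<subseteq> V"
      proof -
        have "cvec (Re z *\<^sub>R e) y \<in> right_half_space" if "0 \<le> Re z" for z y
          unfolding right_half_space_def
          by (rule CollectI, rule exI[of _ "Re z *\<^sub>R e"], rule exI[of _ y]) (use that e01 in simp)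
        thus ?thesis using U(1) unfolding V_def Z by blast
      qed
      show "norm (u \<theta>) \<le> exp (pi * E + B0)" if "Re \<theta> = 1" for \<theta>
        using mid[of \<theta>] that by (auto intro: order_trans)
      fix \<epsilon> :: real assume \<epsilon>: "\<epsilon> > 0"
      define T where "T = max 1 (2 * (pi * E + B0 - ln \<epsilon>))"
      have "norm (u \<theta>) \<le> \<epsilon>" if "0 \<le> Re \<theta>" "Re \<theta> \<le> 1" "T \<le> \<bar>Im \<theta>\<bar>" for \<theta>
      proof -
        have "\<bar>Im \<theta>\<bar> * 1 \<le> \<bar>Im \<theta>\<bar> * \<bar>Im \<theta>\<bar>" using that by (intro mult_left_mono) (auto simp: T_def)
        hence "T \<le> (Im \<theta>)\<^sup>2" using that by (simp add: power2_eq_square)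
        hence "pi * E + B0 - (Im \<theta>)\<^sup>2 / 2 \<le> ln \<epsilon>" by (simp add: T_def)
        thus ?thesis using mid[OF that(1,2)] \<epsilon> by (metis exp_le_cancel_iff exp_ln order_trans)
      qed
      thus "\<exists>T. \<forall>\<theta>. 0 \<le> Re \<theta> \<and> Re \<theta> \<le> 1 \<and> T \<le> \<bar>Im \<theta>\<bar> \<longrightarrow> norm (u \<theta>) \<le> \<epsilon>" by blast
    qed (use left s in auto)
    moreover have "Z (of_real s) = cvec \<xi> \<eta>" by (simp add: Z \<xi>e)
    hence "norm (\<phi> (cvec \<xi> \<eta>)) \<le> norm (u (of_real s))"
      unfolding u_def norm_mult n2 by (simp add: mult_le_cancel_left1)
    moreover have "(1 - s) * (G \<eta> + A0) + s * (pi * E + B0) \<le> (\<bar>A0\<bar> + \<bar>B0\<bar>) + G \<eta> + s * (L + pi) * E"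
    proof -
      have "s * (- L * E) \<le> s * G \<eta>" using G[of \<eta>] s unfolding E_def by (intro mult_left_mono) auto
      moreover have "(1 - s) * A0 \<le> (1 - s) * \<bar>A0\<bar>" "(1 - s) * \<bar>A0\<bar> \<le> 1 * \<bar>A0\<bar>"
        using s by (intro mult_left_mono mult_right_mono; simp)+
      moreover have "s * B0 \<le> s * \<bar>B0\<bar>" "s * \<bar>B0\<bar> \<le> 1 * \<bar>B0\<bar>"
        using s by (intro mult_left_mono mult_right_mono; simp)+
      ultimately show ?thesis by (simp add: algebra_simps)
    qed
    ultimately show "norm (\<phi> (cvec \<xi> \<eta>)) \<le> exp ((\<bar>A0\<bar> + \<bar>B0\<bar>) + G \<eta> + s * (L + pi) * (\<Sum>j\<in>UNIV. \<bar>\<eta> $ j\<bar>))"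
      by (fold E_def) (auto intro: order_trans)
  qed
qed

section \<open>The formula as an equality of two integrals\<close>

text \<open>A path on the real line whose image measure is a unit mass at 0 plus length measure on the line with real part \<open>s\<close>:
it rests at 0 during the interval \<open>[0, 1)\<close>. In this way the constant term of the series is treated
together with the line integral, and no coordinate subspaces have to be separated.\<close>

definition line_param :: "real \<Rightarrow> real \<Rightarrow> complex" where
  "line_param s t = (if t < 0 then Complex s t else if t < 1 then 0 else Complex s (t - 1))"

definition line_measure :: "real \<Rightarrow> complex measure" where
  "line_measure s = distr lborel borel (line_param s)"

definition nat_measure :: "complex measure" where
  "nat_measure = distr (count_space (UNIV :: nat set)) borel of_nat"

text \<open>The weights vanish off the supports of the two measures. Therefore bounds that are true on the supports hold at every point
of \<open>\<complex>\<close>, and no almost-everywhere arguments are needed in the product.\<close>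

definition line_weight :: "real \<Rightarrow> complex \<Rightarrow> complex" where
  "line_weight s \<zeta> = (if \<zeta> = 0 then 1 else if Re \<zeta> = s then - (1/2) / sin (of_real pi * \<zeta>) else 0)"

definition nat_weight :: "complex \<Rightarrow> complex" where
  "nat_weight \<zeta> = (if \<zeta> \<in> \<nat> then cos (of_real pi * \<zeta>) else 0)"

lemma sets_line_measure [simp, measurable_cong]: "sets (line_measure s) = sets borel"
  and sets_nat_measure [simp, measurable_cong]: "sets nat_measure = sets borel"
  by (simp_all add: line_measure_def nat_measure_def)

lemma space_line_measure [simp]: "space (line_measure s) = UNIV"
  and space_nat_measure [simp]: "space nat_measure = UNIV"
  by (simp_all add: line_measure_def nat_measure_def)

lemma measurable_Complex_line [measurable]: "Complex s \<in> borel_measurable borel"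
  unfolding Complex_eq by measurable

lemma measurable_line_param [measurable]: "line_param s \<in> borel_measurable borel"
  unfolding line_param_def by measurable

lemma measurable_line_weight [measurable]: "line_weight s \<in> borel_measurable borel"
  unfolding line_weight_def by measurable

lemma measurable_nat_weight [measurable]: "nat_weight \<in> borel_measurable borel"
proof -
  have [measurable]: "(\<nat> :: complex set) \<in> sets borel"
    by (intro borel_closed closed_subset_Ints) (auto simp: Nats_subset_Ints)
  show ?thesis unfolding nat_weight_def by measurable
qed

lemma nat_weight_of_nat: "nat_weight (of_nat k) = (-1) ^ k"
proof -
  have "cos (of_real pi * of_nat k :: complex) = (-1) ^ k"
    by (metis cos_npi_complex' mult.commute)
  thus ?thesis by (simp add: nat_weight_def)
qed

lemma norm_line_weight_le:
  assumes s: "0 < s" "s < 1"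
  shows "norm (line_weight s \<zeta>) \<le> (1 / sin (pi * s)) * exp (- pi * \<bar>Im \<zeta>\<bar>)"
proof -
  have c: "sin (pi * s) > 0" using s by (intro sin_gt_zero) auto
  consider "\<zeta> = 0" | "\<zeta> \<noteq> 0" "Re \<zeta> = s" | "\<zeta> \<noteq> 0" "Re \<zeta> \<noteq> s" by blast
  thus ?thesis
  proof cases
    case 1 thus ?thesis using c by (simp add: line_weight_def)
  next
    case 2
    have le: "sin (pi * s) * exp (pi * \<bar>Im \<zeta>\<bar>) / 2 \<le> norm (sin (of_real pi * \<zeta>))"
      using norm_sin_ge_vertical[of "of_real pi * \<zeta>"] 2 c by (simp add: abs_mult)
    have p: "0 < sin (pi * s) * exp (pi * \<bar>Im \<zeta>\<bar>) / 2" using c by simp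
    have "(1/2) / norm (sin (of_real pi * \<zeta>)) \<le> (1/2) / (sin (pi * s) * exp (pi * \<bar>Im \<zeta>\<bar>) / 2)"
      using le p by (intro divide_left_mono mult_pos_pos) auto
    thus ?thesis using 2 c by (simp add: line_weight_def norm_divide exp_minus field_simps)
  qed (use c in \<open>simp add: line_weight_def\<close>)
qed

lemma integral_line_measure:
  fixes F :: "complex \<Rightarrow> 'b :: {banach, second_countable_topology}"
  assumes F [measurable]: "F \<in> borel_measurable borel"
    and int: "integrable lborel (\<lambda>t. F (Complex s t))"
  shows "integrable (line_measure s) F"
    and "(\<integral>\<zeta>. F \<zeta> \<partial>line_measure s) = F 0 + (\<integral>t. F (Complex s t) \<partial>lborel)"
proof -
  define L where "L = (\<lambda>t. F (Complex s t))"
  define g1 g2 g3 where "g1 = (\<lambda>t. indicator {0..<1::real} t *\<^sub>R F 0)"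
    and "g2 = (\<lambda>t. indicator {0..} t *\<^sub>R L t)" and "g3 = (\<lambda>t. indicator {..<0::real} t *\<^sub>R L t)"
  have i1: "integrable lborel g1" unfolding g1_def by simp
  have i2: "integrable lborel g2" unfolding g2_def using int by (intro integrable_mult_indicator) (auto simp: L_def)
  have i3: "integrable lborel g3" unfolding g3_def using int by (intro integrable_mult_indicator) (auto simp: L_def)
  have i2': "integrable lborel (\<lambda>t. g2 (-1 + 1 * t))" using i2 by (rule lborel_integrable_real_affine) simp
  have eq: "(\<lambda>t. F (line_param s t)) = (\<lambda>t. g1 t + (g2 (-1 + 1 * t) + g3 t))"
    by (auto simp: line_param_def g1_def g2_def g3_def L_def indicator_def algebra_simps fun_eq_iff)
  show "integrable (line_measure s) F"
    unfolding line_measure_def by (subst integrable_distr_eq) (use i1 i2' i3 in \<open>auto simp: eq\<close>)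
  have "(\<integral>\<zeta>. F \<zeta> \<partial>line_measure s) = (\<integral>t. F (line_param s t) \<partial>lborel)"
    unfolding line_measure_def by (subst integral_distr) auto
  also have "\<dots> = (\<integral>t. g1 t \<partial>lborel) + ((\<integral>t. g2 (-1 + 1 * t) \<partial>lborel) + (\<integral>t. g3 t \<partial>lborel))"
    unfolding eq using i1 i2' i3 by simp
  also have "(\<integral>t. g2 (-1 + 1 * t) \<partial>lborel) = (\<integral>t. g2 t \<partial>lborel)"
    using lborel_integral_real_affine[of 1 g2 "-1"] by simp
  also have "(\<integral>t. g2 t \<partial>lborel) + (\<integral>t. g3 t \<partial>lborel) = (\<integral>t. g2 t + g3 t \<partial>lborel)"
    using i2 i3 by simp
  also have "(\<lambda>t. g2 t + g3 t) = L" by (auto simp: g2_def g3_def indicator_def fun_eq_iff)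
  also have "(\<integral>t. g1 t \<partial>lborel) = F 0" by (simp add: g1_def)
  finally show "(\<integral>\<zeta>. F \<zeta> \<partial>line_measure s) = F 0 + (\<integral>t. F (Complex s t) \<partial>lborel)" by (simp add: L_def)
qed

lemma integral_nat_measure:
  fixes F :: "complex \<Rightarrow> 'b :: {banach, second_countable_topology}"
  assumes F [measurable]: "F \<in> borel_measurable borel"
    and sum: "summable (\<lambda>k. norm (F (of_nat k)))"
  shows "integrable nat_measure F"
    and "(\<integral>\<zeta>. F \<zeta> \<partial>nat_measure) = (\<Sum>k. F (of_nat k))"
proof -
  have i: "integrable (count_space UNIV) (\<lambda>k::nat. F (of_nat k))"
    using sum by (simp add: integrable_count_space_nat_iff)
  show "integrable nat_measure F"
    unfolding nat_measure_def by (subst integrable_distr_eq) (use i in auto)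
  show "(\<integral>\<zeta>. F \<zeta> \<partial>nat_measure) = (\<Sum>k. F (of_nat k))"
    unfolding nat_measure_def by (subst integral_distr) (use integral_count_space_nat[OF i] in auto)
qed

text \<open>Image measures need not be \<open>\<sigma>\<close>-finite; here the preimages of discs have finite measure.\<close>

lemma sigma_finite_distr_proper:
  fixes h :: "'a \<Rightarrow> complex"
  assumes h [measurable]: "h \<in> borel_measurable M"
    and fin: "\<And>n::nat. emeasure M {x \<in> space M. norm (h x) \<le> real n} \<noteq> \<infinity>"
  shows "sigma_finite_measure (distr M borel h)"
proof (rule sigma_finite_measure.intro, intro exI conjI)
  show "countable (range (\<lambda>n::nat. cball (0::complex) (real n)))" by simp
  show "range (\<lambda>n::nat. cball (0::complex) (real n)) \<subseteq> sets (distr M borel h)" by auto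
  have "x \<in> (\<Union>n::nat. cball (0::complex) (real n))" for x :: complex
    using real_arch_simple[of "norm x"] by auto
  thus "\<Union> (range (\<lambda>n::nat. cball (0::complex) (real n))) = space (distr M borel h)" by auto
  show "\<forall>a\<in>range (\<lambda>n::nat. cball (0::complex) (real n)). emeasure (distr M borel h) a \<noteq> \<infinity>"
  proof clarify
    fix n :: nat assume "emeasure (distr M borel h) (cball 0 (real n)) = \<infinity>"
    moreover have "emeasure (distr M borel h) (cball 0 (real n)) = emeasure M {x \<in> space M. norm (h x) \<le> real n}"
      by (subst emeasure_distr) (auto intro!: arg_cong[where f="emeasure M"])
    ultimately show False using fin by auto
  qed
qed

lemma sigma_finite_line_measure: "sigma_finite_measure (line_measure s)"
  unfolding line_measure_def
proof (rule sigma_finite_distr_proper)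
  fix n :: nat
  have "{t \<in> space lborel. norm (line_param s t) \<le> real n} \<subseteq> {- real n - 1 .. real n + 1}"
  proof
    fix t assume "t \<in> {t \<in> space lborel. norm (line_param s t) \<le> real n}"
    hence "\<bar>Im (line_param s t)\<bar> \<le> real n" using abs_Im_le_cmod order_trans by blast
    thus "t \<in> {- real n - 1 .. real n + 1}" by (auto simp: line_param_def split: if_splits)
  qed
  hence "emeasure lborel {t \<in> space lborel. norm (line_param s t) \<le> real n} \<le> emeasure lborel {- real n - 1 .. real n + 1}"
    by (intro emeasure_mono) auto
  also have "\<dots> < \<infinity>" by (simp add: emeasure_lborel_Icc_eq)
  finally show "emeasure lborel {t \<in> space lborel. norm (line_param s t) \<le> real n} \<noteq> \<infinity>" by simp
qed simp

lemma sigma_finite_nat_measure: "sigma_finite_measure nat_measure"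
  unfolding nat_measure_def
proof (rule sigma_finite_distr_proper)
  fix n :: nat
  have "{k \<in> space (count_space (UNIV :: nat set)). norm (of_nat k :: complex) \<le> real n} = {..n}" by auto
  thus "emeasure (count_space UNIV) {k \<in> space (count_space (UNIV :: nat set)). norm (of_nat k :: complex) \<le> real n} \<noteq> \<infinity>"
    by simp
qed simp

lemma Lindeloef_measures:
  fixes h :: "complex \<Rightarrow> complex" and w :: complex
  assumes holo: "h holomorphic_on {\<zeta>. Re \<zeta> > 0}" and meas [measurable]: "h \<in> borel_measurable borel"
    and bound: "\<And>\<zeta>. Re \<zeta> > 0 \<Longrightarrow> norm (h \<zeta>) \<le> K * exp ((pi - \<delta>) * \<bar>Im \<zeta>\<bar> + b * Re \<zeta>)"
    and s: "0 < s" "s < 1" and w: "\<bar>Im w\<bar> < \<delta>" "Re w + b < 0"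
  shows "(\<integral>\<zeta>. h \<zeta> * (line_weight s \<zeta> * exp (\<zeta> * w)) \<partial>line_measure s) =
    (\<integral>\<zeta>. h \<zeta> * (nat_weight \<zeta> * exp (\<zeta> * w)) \<partial>nat_measure)"
proof -
  let ?G = "\<lambda>t. h (Complex s t) * exp (Complex s t * w) / sin (of_real pi * Complex s t)"
  let ?L = "\<lambda>\<zeta>. h \<zeta> * (line_weight s \<zeta> * exp (\<zeta> * w))"
  let ?N = "\<lambda>\<zeta>. h \<zeta> * (nat_weight \<zeta> * exp (\<zeta> * w))"
  note LI = Lindeloef_line_integral[OF holo bound s w]
  have K: "K \<ge> 0"
    using order_trans[OF norm_ge_zero bound[of 1]] by (simp add: zero_le_mult_iff)
  have nz: "Complex s t \<noteq> 0" for t using s by (auto simp: complex_eq_iff)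
  have GL: "?L (Complex s t) = - (1/2) * ?G t" for t
    using nz by (simp add: line_weight_def)
  have "(\<integral>\<zeta>. ?L \<zeta> \<partial>line_measure s) = ?L 0 + (\<integral>t. ?L (Complex s t) \<partial>lborel)"
  proof (rule integral_line_measure(2))
    show "integrable lborel (\<lambda>t. ?L (Complex s t))" unfolding GL using LI(1) by (rule integrable_mult_right)
  qed measurable
  also have "?L 0 = h 0" by (simp add: line_weight_def)
  also have "(\<integral>t. ?L (Complex s t) \<partial>lborel) = - (1/2) * (\<integral>t. ?G t \<partial>lborel)" unfolding GL
    by (rule integral_mult_right_zero)
  also have "\<dots> = (\<Sum>k. (-1) ^ Suc k * h (of_nat (Suc k)) * exp (of_nat (Suc k) * w))"
    using LI(2) by (rule sums_unique)
  also have "\<dots> = (\<Sum>k. ?N (of_nat (Suc k)))"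
    unfolding nat_weight_of_nat by (simp add: mult_ac)
  finally have L: "(\<integral>\<zeta>. ?L \<zeta> \<partial>line_measure s) = h 0 + (\<Sum>k. ?N (of_nat (Suc k)))" .
  have nle: "norm (?N (of_nat (Suc k))) \<le> K * exp (b + Re w) ^ Suc k" for k
  proof -
    have "Re (of_nat (Suc k) * w) = real (Suc k) * Re w" by (metis of_real_of_nat_eq Re_complex_of_real times_complex.simps(1) Im_complex_of_real mult_zero_left diff_zero)
    hence "norm (?N (of_nat (Suc k))) = norm (h (of_nat (Suc k))) * exp (real (Suc k) * Re w)"
      unfolding nat_weight_of_nat norm_mult norm_power norm_exp_eq_Re by simp
    also have "\<dots> \<le> (K * exp (b * real (Suc k))) * exp (real (Suc k) * Re w)"
      using bound[of "of_nat (Suc k)"] by (intro mult_right_mono) auto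
    also have "\<dots> = K * exp (real (Suc k) * (b + Re w))"
      by (simp add: algebra_simps flip: exp_add)
    also have "\<dots> = K * exp (b + Re w) ^ Suc k" by (subst exp_of_nat_mult) simp
    finally show ?thesis .
  qed
  have sg: "summable (\<lambda>k. K * exp (b + Re w) ^ Suc k)"
    using w by (intro summable_mult summable_Suc_iff[THEN iffD2] summable_geometric) auto
  have "summable (\<lambda>k. norm (?N (of_nat (Suc k))))"
    by (rule summable_comparison_test'[OF sg, of 0]) (simp only: real_norm_def abs_norm_cancel nle)
  hence sm: "summable (\<lambda>k. norm (?N (of_nat k)))" by (rule summable_Suc_iff[THEN iffD1])
  have "(\<integral>\<zeta>. ?N \<zeta> \<partial>nat_measure) = (\<Sum>k. ?N (of_nat k))"
    using sm by (intro integral_nat_measure(2)) measurable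
  also have "\<dots> = ?N (of_nat 0) + (\<Sum>k. ?N (of_nat (Suc k)))"
    using suminf_split_head[OF summable_norm_cancel[OF sm]] by simp
  also have "?N (of_nat 0) = h 0" using nat_weight_of_nat[of 0] by simp
  finally show ?thesis using L by simp
qed

section \<open>Exchanging the measures coordinate by coordinate\<close>

lemma measurable_vec_lambda:
  assumes "\<And>j. sets (M j) = sets (borel :: complex measure)"
  shows "(\<lambda>x. vec_lambda x :: complex ^ 'n) \<in> borel_measurable (PiM UNIV M)"
  unfolding borel_measurable_euclidean_space[where 'c = "complex ^ 'n"]
proof
  have comp: "(\<lambda>x. x j) \<in> borel_measurable (PiM UNIV M)" for j
  proof -
    have "(\<lambda>x. x j) \<in> measurable (PiM UNIV M) (M j)" by (rule measurable_component_singleton) simp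
    thus ?thesis using measurable_cong_sets[OF refl assms] by blast
  qed
  fix e :: "complex ^ 'n" assume "e \<in> Basis"
  then obtain i u where "e = axis i u" by (auto simp: Basis_vec_def)
  hence "(\<lambda>x. (vec_lambda x :: complex ^ 'n) \<bullet> e) = (\<lambda>x. x i \<bullet> u)" by (simp add: inner_axis)
  thus "(\<lambda>x. (vec_lambda x :: complex ^ 'n) \<bullet> e) \<in> borel_measurable (PiM UNIV M)"
    using comp[of i] by simp
qed

lemma integral_PiM_nat_measure:
  fixes F :: "('n::finite \<Rightarrow> complex) \<Rightarrow> complex"
  assumes int: "integrable (PiM UNIV (\<lambda>_. nat_measure)) F"
  shows "(\<lambda>k :: nat ^ 'n. norm (F (\<lambda>j. of_nat (k $ j)))) summable_on UNIV"
    and "(\<integral>x. F x \<partial>PiM UNIV (\<lambda>_. nat_measure)) = (\<Sum>\<^sub>\<infinity>k :: nat ^ 'n. F (\<lambda>j. of_nat (k $ j)))"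
proof -
  let ?P = "PiM (UNIV :: 'n set) (\<lambda>_. count_space (UNIV :: nat set))"
  let ?B = "PiM (UNIV :: 'n set) (\<lambda>_. borel :: complex measure)"
  let ?f = "\<lambda>(k :: 'n \<Rightarrow> nat) j. of_nat (k j) :: complex"
  have P: "?P = count_space UNIV"
    by (subst count_space_PiM_finite) (auto simp: PiE_UNIV_domain)
  interpret N: product_sigma_finite "\<lambda>_ :: 'n. nat_measure"
    by (simp add: product_sigma_finite_def sigma_finite_nat_measure)
  interpret C: product_sigma_finite "\<lambda>_ :: 'n. count_space (UNIV :: nat set)"
    by (simp add: product_sigma_finite_def sigma_finite_measure_count_space)
  have f: "?f \<in> measurable ?P ?B"
    unfolding P measurable_count_space_eq1 by (simp add: space_PiM PiE_UNIV_domain)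
  have D: "distr ?P ?B ?f = PiM UNIV (\<lambda>_. nat_measure)"
  proof (rule N.PiM_eqI)
    show "sets (distr ?P ?B ?f) = sets (PiM UNIV (\<lambda>_. nat_measure))"
      unfolding sets_distr by (rule sets_PiM_cong) simp_all
    fix A :: "'n \<Rightarrow> complex set" assume A: "\<And>i. i \<in> UNIV \<Longrightarrow> A i \<in> sets nat_measure"
    have "emeasure (distr ?P ?B ?f) (Pi\<^sub>E UNIV A) = emeasure ?P (?f -` (Pi\<^sub>E UNIV A) \<inter> space ?P)"
      using A by (intro emeasure_distr f sets_PiM_I_finite) auto
    also have "?f -` (Pi\<^sub>E UNIV A) \<inter> space ?P = Pi\<^sub>E UNIV (\<lambda>i. of_nat -` A i)"
      by (auto simp: space_PiM)
    also have "emeasure ?P \<dots> = (\<Prod>i\<in>UNIV. emeasure (count_space (UNIV :: nat set)) (of_nat -` A i))"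
      by (rule C.emeasure_PiM) auto
    also have "\<dots> = (\<Prod>i\<in>UNIV. emeasure nat_measure (A i))"
      using A by (intro prod.cong refl) (simp add: nat_measure_def emeasure_distr)
    finally show "emeasure (distr ?P ?B ?f) (Pi\<^sub>E UNIV A) = (\<Prod>i\<in>UNIV. emeasure nat_measure (A i))" .
  qed simp
  have mF: "F \<in> borel_measurable ?B"
    using borel_measurable_integrable[OF int] by (simp cong: measurable_cong_sets sets_PiM_cong)
  have i: "integrable (count_space UNIV) (\<lambda>k. F (?f k))"
    using int unfolding D[symmetric] by (subst (asm) integrable_distr_eq[OF f mF]) (simp add: P)
  hence ab: "Infinite_Set_Sum.abs_summable_on (\<lambda>k. F (?f k)) UNIV" by (simp add: Infinite_Set_Sum.abs_summable_on_def)
  have bij: "bij_betw (\<lambda>k :: nat ^ 'n. vec_nth k) UNIV UNIV"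
    by (rule bij_betwI[where g=vec_lambda]) auto
  have "(\<lambda>k. norm (F (?f k))) summable_on UNIV" by (rule abs_summable_equivalent[THEN iffD2, OF ab])
  thus "(\<lambda>k :: nat ^ 'n. norm (F (\<lambda>j. of_nat (k $ j)))) summable_on UNIV"
    using summable_on_reindex_bij_betw[OF bij, of "\<lambda>k. norm (F (?f k))"] by simp
  have "(\<integral>x. F x \<partial>PiM UNIV (\<lambda>_. nat_measure)) = (\<integral>k. F (?f k) \<partial>count_space UNIV)"
    unfolding D[symmetric] by (subst integral_distr[OF f mF]) (simp add: P)
  also have "\<dots> = infsetsum (\<lambda>k. F (?f k)) UNIV" by (simp add: infsetsum_def)
  also have "\<dots> = infsum (\<lambda>k. F (?f k)) UNIV" using ab by (rule infsetsum_infsum)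
  also have "\<dots> = (\<Sum>\<^sub>\<infinity>k :: nat ^ 'n. F (\<lambda>j. of_nat (k $ j)))"
    using infsum_reindex_bij_betw[OF bij, of "\<lambda>k. F (?f k)"] by simp
  finally show "(\<integral>x. F x \<partial>PiM UNIV (\<lambda>_. nat_measure)) = (\<Sum>\<^sub>\<infinity>k :: nat ^ 'n. F (\<lambda>j. of_nat (k $ j)))" .
qed

text \<open>The function \<open>\<Phi>\<close> stands for \<open>\<phi>\<close> extended by 0 from the closed right half space, which makes it Borel measurable.
The set \<open>I\<close> below contains the coordinates that are already summed over \<open>\<nat>\<close>; the others are
integrated along the contour.\<close>

locale coordinate_swap =
  fixes \<Phi> :: "complex ^ 'n \<Rightarrow> complex" and w :: "complex ^ 'n" and s \<delta> b C :: real
  assumes meas: "\<Phi> \<in> borel_measurable borel"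
    and bound: "\<And>\<zeta>. (\<And>j. 0 \<le> Re (\<zeta> $ j)) \<Longrightarrow>
      norm (\<Phi> \<zeta>) \<le> exp ((\<Sum>j\<in>UNIV. (pi - \<delta>) * \<bar>Im (\<zeta> $ j)\<bar> + b * Re (\<zeta> $ j)) + C)"
    and vanish: "\<And>\<zeta> j. Re (\<zeta> $ j) < 0 \<Longrightarrow> \<Phi> \<zeta> = 0"
    and slice: "\<And>\<zeta> i. (\<And>j. 0 \<le> Re (\<zeta> $ j)) \<Longrightarrow>
      (\<lambda>y. \<Phi> (\<chi> j. if j = i then y else \<zeta> $ j)) holomorphic_on {y. Re y > 0}"
    and s: "0 < s" "s < 1"
    and w: "\<And>j. \<bar>Im (w $ j)\<bar> < \<delta>" "\<And>j. Re (w $ j) + b < 0"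
begin

definition mix_measure :: "'n set \<Rightarrow> 'n \<Rightarrow> complex measure" where
  "mix_measure I j = (if j \<in> I then nat_measure else line_measure s)"

definition mix_weight :: "'n set \<Rightarrow> 'n \<Rightarrow> complex \<Rightarrow> complex" where
  "mix_weight I j \<zeta> = (if j \<in> I then nat_weight \<zeta> else line_weight s \<zeta>) * exp (\<zeta> * w $ j)"

definition integrand :: "'n set \<Rightarrow> ('n \<Rightarrow> complex) \<Rightarrow> complex" where
  "integrand I x = \<Phi> (vec_lambda x) * (\<Prod>j\<in>UNIV. mix_weight I j (x j))"

definition majorant :: "'n set \<Rightarrow> 'n \<Rightarrow> complex \<Rightarrow> real" where
  "majorant I j \<zeta> = (if 0 \<le> Re \<zeta> then exp ((pi - \<delta>) * \<bar>Im \<zeta>\<bar> + b * Re \<zeta>) else 0) * norm (mix_weight I j \<zeta>)"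

lemma sets_mix_measure: "sets (mix_measure I j) = sets borel"
  by (simp add: mix_measure_def)

lemma sigma_finite_mix: "product_sigma_finite (mix_measure I)"
  by (simp add: product_sigma_finite_def mix_measure_def sigma_finite_line_measure sigma_finite_nat_measure)

lemma measurable_mix_weight [measurable]: "mix_weight I j \<in> borel_measurable borel"
  unfolding mix_weight_def by (cases "j \<in> I") simp_all

lemma measurable_majorant [measurable]: "majorant I j \<in> borel_measurable borel"
  unfolding majorant_def by measurable

lemma integrable_majorant: "integrable (mix_measure I j) (majorant I j)"
proof (cases "j \<in> I")
  case False
  have c: "sin (pi * s) > 0" using s by (intro sin_gt_zero) auto
  have "integrable lborel (\<lambda>t. majorant I j (Complex s t))"
  proof (rule Bochner_Integration.integrable_bound)
    let ?g = "\<lambda>t. exp (b * s + s * Re (w $ j)) / sin (pi * s) * exp (- (\<delta> - \<bar>Im (w $ j)\<bar>) * \<bar>t\<bar>)"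
    show "integrable lborel ?g" using w(1)[of j]
      by (intro integrable_mult_right integrable_exp_abs) auto
    show "(\<lambda>t. majorant I j (Complex s t)) \<in> borel_measurable lborel" by measurable
    have "norm (majorant I j (Complex s t)) \<le> norm (?g t)" for t
    proof -
      have "norm (majorant I j (Complex s t)) =
         exp ((pi - \<delta>) * \<bar>t\<bar> + b * s) * (norm (line_weight s (Complex s t)) * exp (s * Re (w $ j) - t * Im (w $ j)))"
        using s False by (simp add: majorant_def mix_weight_def norm_mult)
      also have "\<dots> \<le> exp ((pi - \<delta>) * \<bar>t\<bar> + b * s) * (((1 / sin (pi * s)) * exp (- pi * \<bar>t\<bar>)) * exp (s * Re (w $ j) + \<bar>Im (w $ j)\<bar> * \<bar>t\<bar>))"
      proof (intro mult_left_mono mult_mono)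
        show "norm (line_weight s (Complex s t)) \<le> (1 / sin (pi * s)) * exp (- pi * \<bar>t\<bar>)"
          using norm_line_weight_le[OF s, of "Complex s t"] by simp
        have "- (t * Im (w $ j)) \<le> \<bar>Im (w $ j)\<bar> * \<bar>t\<bar>" by (metis abs_ge_minus_self abs_mult mult.commute)
        thus "exp (s * Re (w $ j) - t * Im (w $ j)) \<le> exp (s * Re (w $ j) + \<bar>Im (w $ j)\<bar> * \<bar>t\<bar>)" by simp
      qed (use c in auto)
      also have "\<dots> = ?g t" by (simp add: algebra_simps flip: exp_add)
      finally show ?thesis by (simp add: abs_if)
    qed
    thus "AE t in lborel. norm (majorant I j (Complex s t)) \<le> norm (?g t)" by simp
  qed
  thus ?thesis using integral_line_measure(1)[OF measurable_majorant] False by (simp add: mix_measure_def)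
next
  case True
  have eq: "norm (majorant I j (of_nat k)) = exp (b + Re (w $ j)) ^ k" for k
  proof -
    have "norm (majorant I j (of_nat k)) = exp (b * real k) * exp (real k * Re (w $ j))"
      using True by (simp add: majorant_def mix_weight_def norm_mult nat_weight_of_nat norm_power)
    also have "\<dots> = exp (real k * (b + Re (w $ j)))" by (simp add: algebra_simps flip: exp_add)
    finally show ?thesis by (simp add: exp_of_nat_mult)
  qed
  have "summable (\<lambda>k. norm (majorant I j (of_nat k)))"
    unfolding eq using w(2)[of j] by (intro summable_geometric) auto
  thus ?thesis using integral_nat_measure(1)[OF measurable_majorant] True by (simp add: mix_measure_def)
qed

lemma norm_integrand_le: "norm (integrand I x) \<le> exp C * (\<Prod>j\<in>UNIV. majorant I j (x j))"
proof (cases "\<forall>j. 0 \<le> Re (x j)")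
  case True
  hence "norm (\<Phi> (vec_lambda x)) \<le> exp C * (\<Prod>j\<in>UNIV. exp ((pi - \<delta>) * \<bar>Im (x j)\<bar> + b * Re (x j)))"
    using bound[of "vec_lambda x"] by (simp add: exp_add mult.commute exp_sum)
  hence "norm (integrand I x) \<le> exp C * (\<Prod>j\<in>UNIV. exp ((pi - \<delta>) * \<bar>Im (x j)\<bar> + b * Re (x j))) * (\<Prod>j\<in>UNIV. norm (mix_weight I j (x j)))"
    unfolding integrand_def norm_mult prod_norm[symmetric] by (rule mult_right_mono) (auto intro: prod_nonneg)
  also have "\<dots> = exp C * (\<Prod>j\<in>UNIV. majorant I j (x j))"
    using True by (simp add: majorant_def prod.distrib)
  finally show ?thesis .
next
  case False
  then obtain j where "Re (x j) < 0" by (auto simp: not_le)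
  hence "\<Phi> (vec_lambda x) = 0" using vanish[of "vec_lambda x" j] by simp
  thus ?thesis by (simp add: integrand_def majorant_def prod_nonneg)
qed

lemma integrable_integrand: "integrable (PiM UNIV (mix_measure I)) (integrand I)"
proof (rule Bochner_Integration.integrable_bound)
  interpret product_sigma_finite "mix_measure I" by (rule sigma_finite_mix)
  show "integrable (PiM UNIV (mix_measure I)) (\<lambda>x. exp C * (\<Prod>j\<in>UNIV. majorant I j (x j)))"
    by (intro integrable_mult_right product_integrable_prod integrable_majorant) simp
  have [measurable]: "(\<lambda>x. x j) \<in> borel_measurable (PiM UNIV (mix_measure I))" for j
    using measurable_component_singleton[of j UNIV "mix_measure I"] measurable_cong_sets[OF refl sets_mix_measure] by blast
  have [measurable]: "(\<lambda>x. \<Phi> (vec_lambda x)) \<in> borel_measurable (PiM UNIV (mix_measure I))"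
    by (rule measurable_compose[OF measurable_vec_lambda[OF sets_mix_measure] meas])
  show "integrand I \<in> borel_measurable (PiM UNIV (mix_measure I))"
    unfolding integrand_def by measurable
  show "AE x in PiM UNIV (mix_measure I). norm (integrand I x) \<le> norm (exp C * (\<Prod>j\<in>UNIV. majorant I j (x j)))"
    unfolding real_norm_def by (rule AE_I2, rule order_trans[OF norm_integrand_le abs_ge_self])
qed

text \<open>Fubini isolates the coordinate \<open>i\<close>. The other factors do not change, and the inner integral is the one-variable
formula for the slice of \<open>\<Phi>\<close>, which is 0 if some other coordinate has negative real part.\<close>

lemma integral_integrand_insert:
  assumes i: "i \<notin> I"
  shows "(\<integral>x. integrand (insert i I) x \<partial>PiM UNIV (mix_measure (insert i I))) =
    (\<integral>x. integrand I x \<partial>PiM UNIV (mix_measure I))"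
proof -
  let ?J = "UNIV - {i}"
  have U: "insert i ?J = UNIV" by auto
  have fub: "(\<integral>x. integrand I x \<partial>PiM UNIV (mix_measure I)) =
     (\<integral>x. (\<integral>y. integrand I (x(i := y)) \<partial>mix_measure I i) \<partial>PiM ?J (mix_measure I))" for I
  proof -
    interpret product_sigma_finite "mix_measure I" by (rule sigma_finite_mix)
    show ?thesis using product_integral_insert[of ?J i "integrand I"] integrable_integrand[of I] unfolding U by simp
  qed
  have PJ: "PiM ?J (mix_measure (insert i I)) = PiM ?J (mix_measure I)"
    by (rule PiM_cong) (auto simp: mix_measure_def)
  have split: "integrand I (x(i := y)) = (\<Prod>j\<in>?J. mix_weight I j (x j)) * (\<Phi> (vec_lambda (x(i := y))) * mix_weight I i y)" for x y I
  proof -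
    have "(\<Prod>j\<in>UNIV. mix_weight I j ((x(i := y)) j)) = mix_weight I i y * (\<Prod>j\<in>?J. mix_weight I j (x j))"
      by (subst prod.remove[of _ i]) (auto intro!: prod.cong)
    thus ?thesis by (simp add: integrand_def)
  qed
  have inner: "(\<integral>y. integrand (insert i I) (x(i := y)) \<partial>mix_measure (insert i I) i) = (\<integral>y. integrand I (x(i := y)) \<partial>mix_measure I i)" for x
  proof -
    define h where "h = (\<lambda>y. \<Phi> (vec_lambda (x(i := y))))"
    have "(\<integral>y. h y * mix_weight (insert i I) i y \<partial>mix_measure (insert i I) i) = (\<integral>y. h y * mix_weight I i y \<partial>mix_measure I i)"
    proof (cases "\<forall>j\<in>?J. 0 \<le> Re (x j)")
      case False
      then obtain j where j: "j \<noteq> i" "Re (x j) < 0" by (auto simp: not_le)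
      have "h y = 0" for y unfolding h_def by (rule vanish[of _ j]) (use j in simp)
      thus ?thesis by simp
    next
      case True
      have eq: "vec_lambda (x(i := y)) = (\<chi> j. if j = i then y else (\<chi> j. if j = i then 0 else x j) $ j)" for y
        by (simp add: vec_eq_iff)
      have holo: "h holomorphic_on {y. Re y > 0}"
        unfolding h_def eq by (rule slice) (use True in auto)
      have "continuous_on UNIV (\<lambda>y. vec_lambda (x(i := y)) :: complex ^ 'n)"
      proof (rule continuous_on_vec_lambda)
        show "continuous_on UNIV (\<lambda>y. (x(i := y)) j)" for j by (cases "j = i") auto
      qed
      hence mh: "h \<in> borel_measurable borel"
        unfolding h_def by (intro measurable_compose[OF borel_measurable_continuous_onI meas])
      define K where "K = exp ((\<Sum>j\<in>?J. (pi - \<delta>) * \<bar>Im (x j)\<bar> + b * Re (x j)) + C)"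
      have bd: "norm (h y) \<le> K * exp ((pi - \<delta>) * \<bar>Im y\<bar> + b * Re y)" if "Re y > 0" for y
      proof -
        have "norm (h y) \<le> exp ((\<Sum>j\<in>UNIV. (pi - \<delta>) * \<bar>Im ((x(i := y)) j)\<bar> + b * Re ((x(i := y)) j)) + C)"
          unfolding h_def using bound[of "vec_lambda (x(i := y))"] True that by auto
        also have "(\<Sum>j\<in>UNIV. (pi - \<delta>) * \<bar>Im ((x(i := y)) j)\<bar> + b * Re ((x(i := y)) j)) =
           ((pi - \<delta>) * \<bar>Im y\<bar> + b * Re y) + (\<Sum>j\<in>?J. (pi - \<delta>) * \<bar>Im (x j)\<bar> + b * Re (x j))"
          by (subst sum.remove[of _ i]) (auto intro!: sum.cong)
        finally show ?thesis by (simp add: K_def algebra_simps flip: exp_add)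
      qed
      show ?thesis using Lindeloef_measures[OF holo mh bd s w(1) w(2)] i
        by (simp add: mix_weight_def mix_measure_def)
    qed
    moreover have "(\<Prod>j\<in>?J. mix_weight (insert i I) j (x j)) = (\<Prod>j\<in>?J. mix_weight I j (x j))"
      by (rule prod.cong) (auto simp: mix_weight_def)
    ultimately show ?thesis unfolding split by (simp add: h_def)
  qed
  show ?thesis unfolding fub PJ inner ..
qed

lemma integral_eq_series:
  shows "(\<integral>x. integrand {} x \<partial>PiM UNIV (\<lambda>_. line_measure s)) =
      (\<Sum>\<^sub>\<infinity>k :: nat ^ 'n. \<Phi> (\<chi> j. of_nat (k $ j)) * (\<Prod>j\<in>UNIV. (- exp (w $ j)) ^ (k $ j)))"
proof -
  have "(\<integral>x. integrand I x \<partial>PiM UNIV (mix_measure I)) = (\<integral>x. integrand {} x \<partial>PiM UNIV (mix_measure {}))" for I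
    using finite[of I]
  proof (induction I rule: finite_induct)
    case (insert i I)
    thus ?case using integral_integrand_insert by simp
  qed simp
  moreover have "mix_measure UNIV = (\<lambda>_. nat_measure)" "mix_measure {} = (\<lambda>_. line_measure s)"
    by (auto simp: mix_measure_def)
  ultimately have "(\<integral>x. integrand {} x \<partial>PiM UNIV (\<lambda>_. line_measure s)) = (\<integral>x. integrand UNIV x \<partial>PiM UNIV (\<lambda>_. nat_measure))"
    by metis
  also have "\<dots> = (\<Sum>\<^sub>\<infinity>k :: nat ^ 'n. integrand UNIV (\<lambda>j. of_nat (k $ j)))"
    using integrable_integrand[of UNIV] by (intro integral_PiM_nat_measure(2)) (simp add: mix_measure_def[abs_def])
  also have "\<dots> = (\<Sum>\<^sub>\<infinity>k :: nat ^ 'n. \<Phi> (\<chi> j. of_nat (k $ j)) * (\<Prod>j\<in>UNIV. (- exp (w $ j)) ^ (k $ j)))"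
  proof (rule infsum_cong)
    fix k :: "nat ^ 'n"
    have "mix_weight UNIV j (of_nat (k $ j)) = (- exp (w $ j)) ^ (k $ j)" for j
      by (simp add: mix_weight_def nat_weight_of_nat exp_of_nat_mult power_minus[of "exp _"])
    thus "integrand UNIV (\<lambda>j. of_nat (k $ j)) = \<Phi> (\<chi> j. of_nat (k $ j)) * (\<Prod>j\<in>UNIV. (- exp (w $ j)) ^ (k $ j))"
      by (simp add: integrand_def)
  qed
  finally show ?thesis .
qed

end

section \<open>Tubes and the extension over a tube\<close>

text \<open>The directions \<open>\<theta> = Im w\<close> for which the contour integral converges with margin \<open>c\<close>.\<close>

definition admissible :: "(real ^ 'n \<Rightarrow> real) \<Rightarrow> real \<Rightarrow> (real ^ 'n) set" where
  "admissible G c = {\<theta>. \<forall>\<eta>. G \<eta> + c * (\<Sum>j\<in>UNIV. \<bar>\<eta> $ j\<bar>) \<le> \<theta> \<bullet> \<eta> + pi * (\<Sum>j\<in>UNIV. \<bar>\<eta> $ j\<bar>)}"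

definition Im_vec :: "complex ^ 'n \<Rightarrow> real ^ 'n" where
  "Im_vec w = (\<chi> j. Im (w $ j))"

text \<open>A strictly larger margin is required so that the tube is open.\<close>

definition tube :: "(real ^ 'n \<Rightarrow> real) \<Rightarrow> real \<Rightarrow> (complex ^ 'n) set" where
  "tube G c = {w. \<exists>c'>c. Im_vec w \<in> admissible G c'}"

lemma admissible_antimono:
  fixes G :: "real ^ 'n \<Rightarrow> real"
  assumes "c \<le> c'" "\<theta> \<in> admissible G c'" shows "\<theta> \<in> admissible G c"
proof -
  have "G \<eta> + c * (\<Sum>j\<in>UNIV. \<bar>\<eta> $ j\<bar>) \<le> \<theta> \<bullet> \<eta> + pi * (\<Sum>j\<in>UNIV. \<bar>\<eta> $ j\<bar>)" for \<eta> :: "real ^ 'n"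
  proof -
    have "c * (\<Sum>j\<in>UNIV. \<bar>\<eta> $ j\<bar>) \<le> c' * (\<Sum>j\<in>UNIV. \<bar>\<eta> $ j\<bar>)"
      using assms(1) by (intro mult_right_mono sum_nonneg) auto
    moreover have "G \<eta> + c' * (\<Sum>j\<in>UNIV. \<bar>\<eta> $ j\<bar>) \<le> \<theta> \<bullet> \<eta> + pi * (\<Sum>j\<in>UNIV. \<bar>\<eta> $ j\<bar>)"
      using assms(2) unfolding admissible_def by blast
    ultimately show ?thesis by linarith
  qed
  thus ?thesis unfolding admissible_def by blast
qed

lemma convex_admissible:
  fixes G :: "real ^ 'n \<Rightarrow> real"
  shows "convex (admissible G c)"
proof (rule convexI)
  fix x y u v assume xy: "x \<in> admissible G c" "y \<in> admissible G c" and uv: "0 \<le> u" "0 \<le> v" "u + v = (1::real)"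
  show "u *\<^sub>R x + v *\<^sub>R y \<in> admissible G c"
    unfolding admissible_def
  proof (clarify)
    fix \<eta> :: "real ^ 'n"
    let ?E = "\<Sum>j\<in>UNIV. \<bar>\<eta> $ j\<bar>"
    have "G \<eta> + c * ?E = u * (G \<eta> + c * ?E) + v * (G \<eta> + c * ?E)"
      using uv(3) by (simp flip: distrib_right)
    also have "\<dots> \<le> u * (x \<bullet> \<eta> + pi * ?E) + v * (y \<bullet> \<eta> + pi * ?E)"
      using xy uv by (intro add_mono[of "u * _" _ "v * _"] mult_left_mono) (auto simp: admissible_def)
    also have "\<dots> = (u *\<^sub>R x + v *\<^sub>R y) \<bullet> \<eta> + (u + v) * (pi * ?E)"
      by (simp add: inner_add_left algebra_simps)
    finally show "G \<eta> + c * ?E \<le> (u *\<^sub>R x + v *\<^sub>R y) \<bullet> \<eta> + pi * ?E" using uv(3) by simp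
  qed
qed

text \<open>If \<open>G\<close> is even, \<open>\<theta>\<close> and \<open>- \<theta>\<close> are admissible together, and so is their midpoint 0. This is why every nonempty tube
meets the region \<open>\<bar>Im w\<bar> < \<delta>\<close> where the integral is known to represent the series.\<close>

lemma zero_admissible:
  assumes even: "\<And>\<eta>. G (- \<eta>) = G \<eta>" and \<theta>: "\<theta> \<in> admissible G c"
  shows "0 \<in> admissible G c"
proof -
  have "- \<theta> \<in> admissible G c"
    unfolding admissible_def
  proof (clarify)
    fix \<eta>
    show "G \<eta> + c * (\<Sum>j\<in>UNIV. \<bar>\<eta> $ j\<bar>) \<le> (- \<theta>) \<bullet> \<eta> + pi * (\<Sum>j\<in>UNIV. \<bar>\<eta> $ j\<bar>)"
      using \<theta>[unfolded admissible_def, THEN CollectD, rule_format, of "- \<eta>"] even[of \<eta>] by simp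
  qed
  hence "(1/2) *\<^sub>R \<theta> + (1/2) *\<^sub>R (- \<theta>) \<in> admissible G c"
    using convexD[OF convex_admissible \<theta>, of "- \<theta>" "1/2" "1/2"] by simp
  thus ?thesis by simp
qed

lemma continuous_on_Im_vec: "continuous_on UNIV Im_vec"
  unfolding Im_vec_def by (intro continuous_on_vec_lambda continuous_intros)

lemma open_tube:
  fixes G :: "real ^ 'n \<Rightarrow> real"
  shows "open (tube G c)"
proof -
  define O' where "O' = {\<theta>. \<exists>c'>c. \<theta> \<in> admissible G c'}"
  have "open O'"
    unfolding open_dist
  proof
    fix \<theta> assume "\<theta> \<in> O'"
    then obtain c' where c': "c' > c" "\<theta> \<in> admissible G c'" by (auto simp: O'_def)
    have "y \<in> O'" if y: "dist y \<theta> < (c' - c) / 2" for y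
    proof -
      have "y \<in> admissible G ((c + c') / 2)"
        unfolding admissible_def
      proof (clarify)
        fix \<eta> :: "real ^ 'n"
        let ?E = "\<Sum>j\<in>UNIV. \<bar>\<eta> $ j\<bar>"
        have E: "?E \<ge> 0" by (auto intro: sum_nonneg)
        have "\<theta> \<bullet> \<eta> - y \<bullet> \<eta> = (\<theta> - y) \<bullet> \<eta>" by (simp add: inner_diff_left)
        also have "\<dots> \<le> norm (\<theta> - y) * norm \<eta>" by (rule norm_cauchy_schwarz)
        also have "\<dots> \<le> (c' - c) / 2 * ?E"
          using y norm_le_l1_cart[of \<eta>] c'(1) by (intro mult_mono) (auto simp: dist_norm norm_minus_commute)
        finally have "\<theta> \<bullet> \<eta> - y \<bullet> \<eta> \<le> (c' - c) / 2 * ?E" .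
        moreover have "G \<eta> + c' * ?E \<le> \<theta> \<bullet> \<eta> + pi * ?E" using c'(2) by (auto simp: admissible_def)
        moreover have "c' * ?E - (c' - c) / 2 * ?E = (c + c') / 2 * ?E" by (simp add: field_simps)
        ultimately show "G \<eta> + (c + c') / 2 * ?E \<le> y \<bullet> \<eta> + pi * ?E" by linarith
      qed
      thus ?thesis using c'(1) unfolding O'_def by (intro CollectI exI[of _ "(c + c') / 2"]) auto
    qed
    thus "\<exists>e>0. \<forall>y. dist y \<theta> < e \<longrightarrow> y \<in> O'" using c'(1) by (intro exI[of _ "(c' - c) / 2"]) auto
  qed
  hence "open (Im_vec -` O')" using continuous_on_Im_vec by (rule open_vimage)
  thus ?thesis by (simp add: tube_def O'_def vimage_def)
qed

lemma convex_tube: "convex (tube G c)"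
proof (rule convexI)
  fix x y u v assume xy: "x \<in> tube G c" "y \<in> tube G c" and uv: "0 \<le> u" "0 \<le> v" "u + v = (1::real)"
  obtain c1 c2 where c: "c1 > c" "Im_vec x \<in> admissible G c1" "c2 > c" "Im_vec y \<in> admissible G c2"
    using xy by (auto simp: tube_def)
  have "u *\<^sub>R Im_vec x + v *\<^sub>R Im_vec y \<in> admissible G (min c1 c2)"
    using c uv by (intro convexD[OF convex_admissible]) (auto intro: admissible_antimono[rotated])
  moreover have "u *\<^sub>R Im_vec x + v *\<^sub>R Im_vec y = Im_vec (u *\<^sub>R x + v *\<^sub>R y)"
    by (simp add: Im_vec_def vec_eq_iff)
  ultimately show "u *\<^sub>R x + v *\<^sub>R y \<in> tube G c"
    using c unfolding tube_def by (intro CollectI exI[of _ "min c1 c2"]) auto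
qed

lemma mv_holomorphic_on_cong_open:
  assumes "open U" and "\<And>z. z \<in> U \<Longrightarrow> \<exists>D. (H has_derivative D) (at z) \<and> (\<forall>c v. D (c *s v) = c * D v)"
    and "\<And>z. z \<in> U \<Longrightarrow> F z = H z"
  shows "mv_holomorphic_on F U"
  unfolding mv_holomorphic_on_def
proof (intro conjI ballI assms(1))
  fix z assume z: "z \<in> U"
  obtain D where D: "(H has_derivative D) (at z)" "\<forall>c v. D (c *s v) = c * D v" using assms(2)[OF z] by blast
  have "(F has_derivative D) (at z)"
    using D(1) assms(1) z by (rule has_derivative_transform_within_open) (simp add: assms(3))
  thus "\<exists>D. (F has_derivative D) (at z) \<and> (\<forall>c v. D (c *s v) = c * D v)" using D(2) by blast
qed

lemma open_Re_less: "open {w :: complex ^ 'n. \<forall>j. Re (w $ j) < \<rho> j}"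
proof -
  have "{w :: complex ^ 'n. \<forall>j. Re (w $ j) < \<rho> j} = (\<Inter>j. {w. Re (w $ j) < \<rho> j})" by auto
  also have "open \<dots>" by (intro open_INT ballI open_Collect_less continuous_intros) simp
  finally show ?thesis .
qed

lemma convex_Re_less: "convex {w :: complex ^ 'n. \<forall>j. Re (w $ j) < \<rho> j}"
proof -
  have "{w :: complex ^ 'n. \<forall>j. Re (w $ j) < \<rho> j} = (\<Inter>j. {w. w \<bullet> axis j 1 < \<rho> j})"
    by (auto simp: inner_axis)
  also have "convex \<dots>"
    by (intro convex_INT) (simp add: convex_halfspace_lt inner_commute[of _ "axis _ _"])
  finally show ?thesis .
qed

text \<open>In logarithmic coordinates the power series is an exponential transform of counting measure, so its holomorphy is a
case of \<open>exponential_moment_has_derivative\<close>.\<close>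

lemma series_holomorphic_log:
  fixes f :: "nat ^ 'n \<Rightarrow> complex" and z :: "complex ^ 'n"
  assumes sum: "(\<lambda>k. norm (f k * monomial z k)) summable_on UNIV" and z: "\<And>j. z $ j \<noteq> 0"
  shows "mv_holomorphic_on (\<lambda>w. series_sum f (\<chi> j. - exp (w $ j))) {w. \<forall>j. Re (w $ j) < ln (norm (z $ j))}"
proof (rule mv_holomorphic_on_cong_open[OF open_Re_less])
  define A where "A = (\<lambda>k :: nat ^ 'n. f k * (\<Prod>j\<in>UNIV. (-1) ^ (k $ j)))"
  define Z where "Z = (\<lambda>k :: nat ^ 'n. (\<chi> j. of_nat (k $ j)) :: complex ^ 'n)"
  let ?H = "\<lambda>w. \<integral>k. A k * exp (\<Sum>j\<in>UNIV. Z k $ j * w $ j) \<partial>count_space UNIV"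
  have summand: "A k * exp (\<Sum>j\<in>UNIV. Z k $ j * w $ j) = f k * monomial (\<chi> j. - exp (w $ j)) k" for k w
    unfolding A_def Z_def monomial_def
    by (simp add: exp_sum exp_of_nat_mult power_minus[of "exp _"] prod.distrib)
  have iz: "integrable (count_space UNIV) (\<lambda>k. f k * monomial z k)"
    using abs_summable_equivalent[THEN iffD1, OF sum] by (simp add: Infinite_Set_Sum.abs_summable_on_def)
  have bd: "norm (f k * monomial (\<chi> j. - exp (w $ j)) k) * exp (r * (\<Sum>j\<in>UNIV. norm (Z k $ j))) \<le> norm (f k * monomial z k)"
    if r: "\<And>j. Re (w $ j) + r \<le> ln (norm (z $ j))" for k w r
  proof -
    have "norm (monomial (\<chi> j. - exp (w $ j)) k) * exp (r * (\<Sum>j\<in>UNIV. norm (Z k $ j)))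
        = (\<Prod>j\<in>UNIV. exp (Re (w $ j) + r) ^ (k $ j))"
      by (simp add: monomial_def Z_def prod_norm[symmetric] norm_power exp_sum sum_distrib_left power_mult_distrib
          exp_add mult.commute[of r] exp_of_nat_mult flip: prod.distrib)
    also have "\<dots> \<le> (\<Prod>j\<in>UNIV. norm (z $ j) ^ (k $ j))"
    proof (intro prod_mono conjI power_mono)
      fix j
      have "exp (Re (w $ j) + r) \<le> exp (ln (norm (z $ j)))" using r[of j] by simp
      thus "exp (Re (w $ j) + r) \<le> norm (z $ j)" using z[of j] by simp
    qed auto
    also have "\<dots> = norm (monomial z k)" by (simp add: monomial_def prod_norm[symmetric] norm_power)
    finally have "norm (f k) * (norm (monomial (\<chi> j. - exp (w $ j)) k) * exp (r * (\<Sum>j\<in>UNIV. norm (Z k $ j))))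
       \<le> norm (f k) * norm (monomial z k)" by (rule mult_left_mono) simp
    thus ?thesis by (simp only: norm_mult mult.assoc)
  qed
  fix w assume w: "w \<in> {w. \<forall>j. Re (w $ j) < ln (norm (z $ j))}"
  define r where "r = Min (range (\<lambda>j. ln (norm (z $ j)) - Re (w $ j)))"
  have r0: "r > 0" using w by (auto simp: r_def)
  have "r \<le> ln (norm (z $ j)) - Re (w $ j)" for j unfolding r_def by (rule Min_le) auto
  hence rj: "Re (w $ j) + r \<le> ln (norm (z $ j))" for j by (simp add: le_diff_eq add.commute)
  show "\<exists>D. (?H has_derivative D) (at w) \<and> (\<forall>c v. D (c *s v) = c * D v)"
  proof (rule exponential_moment_has_derivative[OF _ _ r0])
    show "integrable (count_space UNIV) (\<lambda>k. norm (A k * exp (\<Sum>j\<in>UNIV. Z k $ j * w $ j)) * exp (r * (\<Sum>j\<in>UNIV. norm (Z k $ j))))"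
      unfolding summand using bd[OF rj]
      by (intro Bochner_Integration.integrable_bound[OF iz]) auto
  qed auto
  have "integrable (count_space UNIV) (\<lambda>k. f k * monomial (\<chi> j. - exp (w $ j)) k)"
    using bd[of w 0] w by (intro Bochner_Integration.integrable_bound[OF iz]) (auto simp: less_imp_le)
  hence "Infinite_Set_Sum.abs_summable_on (\<lambda>k. f k * monomial (\<chi> j. - exp (w $ j)) k) UNIV"
    by (simp add: Infinite_Set_Sum.abs_summable_on_def)
  from infsetsum_infsum[OF this] show "series_sum f (\<chi> j. - exp (w $ j)) = ?H w"
    unfolding summand by (simp add: series_sum_def infsetsum_def)
qed

text \<open>The contour integral with \<open>s \<Lambda> \<le> c / 2\<close>: of the margin \<open>c\<close>, one half pays for the growth off the imaginary
space, one quarter for the exponential moment needed for differentiability, and the last quarter makes the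
integrand integrable.\<close>

lemma Laplace_representation:
  fixes \<phi> :: "complex ^ 'n \<Rightarrow> complex" and G :: "real ^ 'n \<Rightarrow> real"
  assumes holo: "mv_holomorphic_near \<phi> right_half_space"
    and growth: "\<And>s \<xi> \<eta>. 0 \<le> s \<Longrightarrow> s \<le> 1 \<Longrightarrow> (\<And>j. \<xi> $ j \<in> {0, s}) \<Longrightarrow>
     norm (\<phi> (cvec \<xi> \<eta>)) \<le> exp (K + G \<eta> + s * \<Lambda> * (\<Sum>j\<in>UNIV. \<bar>\<eta> $ j\<bar>))"
    and \<Lambda>: "\<Lambda> > 0"
    and est2: "\<And>\<xi> \<eta>. (\<And>j. 0 \<le> \<xi> $ j) \<Longrightarrow>
        norm (\<phi> (cvec \<xi> \<eta>)) \<le> exp ((\<Sum>j\<in>UNIV. (pi - \<delta>) * \<bar>\<eta> $ j\<bar> + b * \<xi> $ j) + C)"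
    and c: "c > 0"
  obtains H where "mv_holomorphic_on H (tube G c)"
    and "\<And>w. (\<And>j. \<bar>Im (w $ j)\<bar> < \<delta>) \<Longrightarrow> (\<And>j. Re (w $ j) + b < 0) \<Longrightarrow>
      H w = series_sum (\<lambda>k. \<phi> (\<chi> j. of_nat (k $ j))) (\<chi> j. - exp (w $ j))"
proof -
  obtain U where U: "right_half_space \<subseteq> U" "mv_holomorphic_on \<phi> U"
    using holo unfolding mv_holomorphic_near_def by blast
  have RHS: "right_half_space = {\<zeta> :: complex ^ 'n. \<forall>j. 0 \<le> Re (\<zeta> $ j)}"
  proof -
    have "\<zeta> \<in> right_half_space" if "\<forall>j. 0 \<le> Re (\<zeta> $ j)" for \<zeta> :: "complex ^ 'n"
      unfolding right_half_space_def
      by (rule CollectI, rule exI[of _ "\<chi> j. Re (\<zeta> $ j)"], rule exI[of _ "\<chi> j. Im (\<zeta> $ j)"])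
         (use that in \<open>simp add: cvec_def vec_eq_iff\<close>)
    moreover have "0 \<le> Re (\<zeta> $ j)" if "\<zeta> \<in> right_half_space" for \<zeta> :: "complex ^ 'n" and j
      using that unfolding right_half_space_def by (auto simp: cvec_def)
    ultimately show ?thesis by blast
  qed
  define s where "s = min (1/2) (c / (2 * \<Lambda>))"
  have s: "0 < s" "s < 1" using c \<Lambda> by (auto simp: s_def)
  have "s * \<Lambda> \<le> c / (2 * \<Lambda>) * \<Lambda>" using \<Lambda> by (intro mult_right_mono) (auto simp: s_def)
  hence s\<Lambda>: "s * \<Lambda> \<le> c / 2" using \<Lambda> by simp
  define \<Phi> where "\<Phi> = (\<lambda>\<zeta>. indicator right_half_space \<zeta> *\<^sub>R \<phi> \<zeta>)"
  have \<Phi>1: "\<Phi> \<zeta> = \<phi> \<zeta>" if "\<And>j. 0 \<le> Re (\<zeta> $ j)" for \<zeta> using that by (simp add: \<Phi>_def RHS)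
  have \<Phi>0: "\<Phi> \<zeta> = 0" if "Re (\<zeta> $ j) < 0" for \<zeta> j
    using that by (auto simp: \<Phi>_def RHS indicator_def not_le)
  have "closed (right_half_space :: (complex ^ 'n) set)"
    unfolding RHS by (intro closed_Collect_all closed_Collect_le continuous_intros)
  moreover have "continuous_on U \<phi>"
    using U(2) unfolding mv_holomorphic_on_def
    by (meson continuous_at_imp_continuous_on has_derivative_continuous)
  ultimately have meas: "\<Phi> \<in> borel_measurable borel"
    unfolding \<Phi>_def using U(1)
    by (intro borel_measurable_continuous_on_indicator borel_closed) (auto intro: continuous_on_subset)
  define P where "P = PiM (UNIV :: 'n set) (\<lambda>_. line_measure s)"
  define A where "A = (\<lambda>x :: 'n \<Rightarrow> complex. \<Phi> (vec_lambda x) * (\<Prod>j\<in>UNIV. line_weight s (x j)))"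
  define Z where "Z = (\<lambda>x :: 'n \<Rightarrow> complex. vec_lambda x :: complex ^ 'n)"
  define H where "H = (\<lambda>w. \<integral>x. A x * exp (\<Sum>j\<in>UNIV. Z x $ j * w $ j) \<partial>P)"
  have mZ: "Z \<in> borel_measurable P" unfolding Z_def P_def by (rule measurable_vec_lambda) simp
  have mj: "(\<lambda>x. line_weight s (x j)) \<in> borel_measurable P" for j
  proof -
    have "(\<lambda>x. Z x $ j) \<in> borel_measurable P"
      by (rule measurable_compose[OF mZ borel_measurable_continuous_onI]) (intro continuous_intros)
    thus ?thesis unfolding Z_def by (simp add: measurable_compose[OF _ measurable_line_weight])
  qed
  have mA: "A \<in> borel_measurable P"
    unfolding A_def using mj measurable_compose[OF mZ meas] unfolding Z_def
    by (intro borel_measurable_times borel_measurable_prod) auto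
  have sc: "sin (pi * s) > 0" using s by (intro sin_gt_zero) auto
  interpret L: product_sigma_finite "\<lambda>_ :: 'n. line_measure s"
    by (simp add: product_sigma_finite_def sigma_finite_line_measure)
  have intE: "integrable P (\<lambda>x. \<Prod>j\<in>UNIV. exp (- (c/4) * \<bar>Im (x j)\<bar>))"
    unfolding P_def
  proof (rule L.product_integrable_prod)
    fix j :: 'n
    have "integrable lborel (\<lambda>t. exp (- (c/4) * \<bar>t\<bar>))" using c by (intro integrable_exp_abs) simp
    thus "integrable (line_measure s) (\<lambda>\<zeta>. exp (- (c/4) * \<bar>Im \<zeta>\<bar>))"
      by (intro integral_line_measure(1)) simp_all
  qed simp
  have der: "\<exists>D. (H has_derivative D) (at w) \<and> (\<forall>c v. D (c *s v) = c * D v)" if w: "w \<in> tube G c" for w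
    unfolding H_def
  proof (rule exponential_moment_has_derivative[OF mA mZ, of "c/4"])
    show "c/4 > 0" using c by simp
    define \<theta> where "\<theta> = Im_vec w"
    obtain c' where c': "c' > c" "\<theta> \<in> admissible G c'" using w by (auto simp: tube_def \<theta>_def)
    define N where "N = (\<Sum>j\<in>(UNIV :: 'n set). s * \<bar>Re (w $ j)\<bar> + (c/4) * s)"
    define K' where "K' = exp (K + N) * (1 / sin (pi * s)) ^ CARD('n)"
    let ?F = "\<lambda>x. norm (A x * exp (\<Sum>j\<in>UNIV. Z x $ j * w $ j)) * exp (c/4 * (\<Sum>j\<in>UNIV. norm (Z x $ j)))"
    have bd: "?F x \<le> K' * (\<Prod>j\<in>UNIV. exp (- (c/4) * \<bar>Im (x j)\<bar>))" for x
    proof (cases "A x = 0")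
      case True
      thus ?thesis using sc by (simp add: K'_def prod_nonneg)
    next
      case False
      hence "line_weight s (x j) \<noteq> 0" for j by (auto simp: A_def)
      hence Re01: "Re (x j) \<in> {0, s}" for j by (metis insertI1 insertI2 line_weight_def singletonI zero_complex.sel(1))
      define \<xi> \<eta> where "\<xi> = (\<chi> j. Re (x j))" and "\<eta> = (\<chi> j. Im (x j))"
      define E where "E = (\<Sum>j\<in>UNIV. \<bar>Im (x j)\<bar>)"
      have E0: "E \<ge> 0" unfolding E_def by (auto intro: sum_nonneg)
      have x: "vec_lambda x = cvec \<xi> \<eta>" by (simp add: cvec_def \<xi>_def \<eta>_def vec_eq_iff)
      have Re0: "0 \<le> Re (x j)" "Re (x j) \<le> s" for j using Re01[of j] s by auto
      have 1: "norm (\<Phi> (vec_lambda x)) \<le> exp (K + G \<eta> + s * \<Lambda> * E)"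
      proof -
        have "\<Phi> (vec_lambda x) = \<phi> (cvec \<xi> \<eta>)" using \<Phi>1[of "vec_lambda x"] Re0 by (simp flip: x)
        moreover have "norm (\<phi> (cvec \<xi> \<eta>)) \<le> exp (K + G \<eta> + s * \<Lambda> * (\<Sum>j\<in>UNIV. \<bar>\<eta> $ j\<bar>))"
          by (rule growth) (use s Re01 in \<open>auto simp: \<xi>_def\<close>)
        ultimately show ?thesis by (simp add: E_def \<eta>_def)
      qed
      have 2: "norm (\<Prod>j\<in>UNIV. line_weight s (x j)) \<le> (1 / sin (pi * s)) ^ CARD('n) * exp (- pi * E)"
      proof -
        have "norm (\<Prod>j\<in>UNIV. line_weight s (x j)) \<le> (\<Prod>j\<in>UNIV. (1 / sin (pi * s)) * exp (- pi * \<bar>Im (x j)\<bar>))"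
          unfolding prod_norm[symmetric] by (intro prod_mono conjI norm_ge_zero norm_line_weight_le s)
        also have "\<dots> = (1 / sin (pi * s)) ^ CARD('n) * exp (- pi * E)"
          unfolding prod.distrib by (simp add: E_def sum_distrib_left exp_sum sum_negf[symmetric])
        finally show ?thesis .
      qed
      have 3: "norm (exp (\<Sum>j\<in>UNIV. Z x $ j * w $ j)) \<le> exp ((\<Sum>j\<in>UNIV. s * \<bar>Re (w $ j)\<bar>) - \<theta> \<bullet> \<eta>)"
      proof -
        have "Re (\<Sum>j\<in>UNIV. Z x $ j * w $ j) = (\<Sum>j\<in>UNIV. Re (x j) * Re (w $ j)) - \<theta> \<bullet> \<eta>"
          by (simp add: Z_def \<theta>_def Im_vec_def \<eta>_def inner_vec_def sum_subtractf mult.commute)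
        moreover have "(\<Sum>j\<in>UNIV. Re (x j) * Re (w $ j)) \<le> (\<Sum>j\<in>UNIV. s * \<bar>Re (w $ j)\<bar>)"
        proof (rule sum_mono)
          fix j
          have "Re (x j) * Re (w $ j) \<le> Re (x j) * \<bar>Re (w $ j)\<bar>" using Re0 by (intro mult_left_mono) auto
          also have "\<dots> \<le> s * \<bar>Re (w $ j)\<bar>" using Re0 by (intro mult_right_mono) auto
          finally show "Re (x j) * Re (w $ j) \<le> s * \<bar>Re (w $ j)\<bar>" .
        qed
        ultimately show ?thesis unfolding norm_exp_eq_Re by simp
      qed
      have 4: "exp (c/4 * (\<Sum>j\<in>UNIV. norm (Z x $ j))) \<le> exp ((\<Sum>j\<in>(UNIV :: 'n set). (c/4) * s) + c/4 * E)"
      proof -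
        have "norm (Z x $ j) \<le> s + \<bar>Im (x j)\<bar>" for j
          using cmod_le[of "x j"] Re0[of j] by (simp add: Z_def)
        hence "(\<Sum>j\<in>UNIV. norm (Z x $ j)) \<le> (\<Sum>j\<in>(UNIV :: 'n set). s) + E"
          unfolding E_def sum.distrib[symmetric] by (intro sum_mono)
        hence "c/4 * (\<Sum>j\<in>UNIV. norm (Z x $ j)) \<le> c/4 * ((\<Sum>j\<in>(UNIV :: 'n set). s) + E)"
          using c by (intro mult_left_mono) auto
        thus ?thesis by (simp add: algebra_simps)
      qed
      have "?F x \<le> (exp (K + G \<eta> + s * \<Lambda> * E) * ((1 / sin (pi * s)) ^ CARD('n) * exp (- pi * E))
          * exp ((\<Sum>j\<in>UNIV. s * \<bar>Re (w $ j)\<bar>) - \<theta> \<bullet> \<eta>)) * exp ((\<Sum>j\<in>(UNIV :: 'n set). (c/4) * s) + c/4 * E)"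
        unfolding A_def norm_mult using sc by (intro mult_mono 1 2 3 4) auto
      also have "\<dots> = (1 / sin (pi * s)) ^ CARD('n) *
          exp (K + N + (G \<eta> + s * \<Lambda> * E - pi * E - \<theta> \<bullet> \<eta> + c/4 * E))"
      proof -
        have e: "exp x1 * (a * exp x2) * exp x3 * exp x4 = a * exp (x1 + x2 + x3 + x4)" for a x1 x2 x3 x4 :: real
          by (simp add: exp_add)
        have "K + G \<eta> + s * \<Lambda> * E + - pi * E + ((\<Sum>j\<in>UNIV. s * \<bar>Re (w $ j)\<bar>) - \<theta> \<bullet> \<eta>)
            + ((\<Sum>j\<in>(UNIV :: 'n set). (c/4) * s) + c/4 * E)
          = K + N + (G \<eta> + s * \<Lambda> * E - pi * E - \<theta> \<bullet> \<eta> + c/4 * E)"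
          unfolding N_def sum.distrib by simp
        thus ?thesis unfolding e by simp
      qed
      also have "\<dots> \<le> (1 / sin (pi * s)) ^ CARD('n) * exp (K + N + - (c/4) * E)"
      proof -
        have "G \<eta> + c' * E \<le> \<theta> \<bullet> \<eta> + pi * E"
          using c'(2)[unfolded admissible_def, THEN CollectD, rule_format, of \<eta>] by (simp add: E_def \<eta>_def)
        moreover have "s * \<Lambda> * E \<le> c / 2 * E" using s\<Lambda> E0 by (rule mult_right_mono)
        moreover have "c * E \<le> c' * E" using c'(1) E0 by (intro mult_right_mono) auto
        ultimately have "G \<eta> + s * \<Lambda> * E - pi * E - \<theta> \<bullet> \<eta> + c/4 * E \<le> - (c/4) * E" by (simp add: field_simps)
        thus ?thesis using sc by (intro mult_left_mono) auto
      qed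
      also have "\<dots> = K' * exp (- (c/4) * E)" unfolding K'_def exp_add[of "K + N"] by (simp only: mult_ac)
      also have "exp (- (c/4) * E) = (\<Prod>j\<in>UNIV. exp (- (c/4) * \<bar>Im (x j)\<bar>))"
        unfolding E_def sum_distrib_left by (rule exp_sum) simp
      finally show ?thesis .
    qed
    show "integrable P ?F"
    proof (rule Bochner_Integration.integrable_bound[OF integrable_mult_right[OF intE, of K']])
      have mZj: "(\<lambda>x. Z x $ j) \<in> borel_measurable P" for j
        by (rule measurable_compose[OF mZ borel_measurable_continuous_onI]) (intro continuous_intros)
      show "?F \<in> borel_measurable P" using mA mZj by measurable
      show "AE x in P. norm (?F x) \<le> norm (K' * (\<Prod>j\<in>UNIV. exp (- (c/4) * \<bar>Im (x j)\<bar>)))"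
      proof (rule AE_I2)
        fix x
        have "norm (?F x) = ?F x" by simp
        also note bd[of x]
        also have "K' * (\<Prod>j\<in>UNIV. exp (- (c/4) * \<bar>Im (x j)\<bar>)) \<le> norm (K' * (\<Prod>j\<in>UNIV. exp (- (c/4) * \<bar>Im (x j)\<bar>)))"
          unfolding real_norm_def by (rule abs_ge_self)
        finally show "norm (?F x) \<le> norm (K' * (\<Prod>j\<in>UNIV. exp (- (c/4) * \<bar>Im (x j)\<bar>)))" .
      qed
    qed
  qed
  show ?thesis
  proof (rule that)
    show "mv_holomorphic_on H (tube G c)" unfolding mv_holomorphic_on_def using open_tube der by blast
    fix w :: "complex ^ 'n" assume w: "\<And>j. \<bar>Im (w $ j)\<bar> < \<delta>" "\<And>j. Re (w $ j) + b < 0"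
    have "coordinate_swap \<Phi> w s \<delta> b C"
    proof
      fix \<zeta> :: "complex ^ 'n" assume \<zeta>: "\<And>j. 0 \<le> Re (\<zeta> $ j)"
      have "\<zeta> = cvec (\<chi> j. Re (\<zeta> $ j)) (\<chi> j. Im (\<zeta> $ j))" by (simp add: cvec_def vec_eq_iff)
      thus "norm (\<Phi> \<zeta>) \<le> exp ((\<Sum>j\<in>UNIV. (pi - \<delta>) * \<bar>Im (\<zeta> $ j)\<bar> + b * Re (\<zeta> $ j)) + C)"
        using est2[of "\<chi> j. Re (\<zeta> $ j)" "\<chi> j. Im (\<zeta> $ j)"] \<zeta> \<Phi>1[OF \<zeta>] by simp
      fix i
      define p where "p = (\<chi> j. if j = i then 0 else \<zeta> $ j)"
      have line: "(\<chi> j. if j = i then y else \<zeta> $ j) = p + y *s axis i 1" for y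
        by (auto simp: p_def vec_eq_iff axis_def)
      have "p + y *s axis i 1 \<in> U" if "Re y > 0" for y
        using U(1) that \<zeta> unfolding RHS line[symmetric] by auto
      hence "(\<lambda>y. \<phi> (p + y *s axis i 1)) holomorphic_on {y. Re y > 0}"
        by (intro holomorphic_on_subset[OF mv_holomorphic_on_line(2)[OF U(2)]]) auto
      thus "(\<lambda>y. \<Phi> (\<chi> j. if j = i then y else \<zeta> $ j)) holomorphic_on {y. Re y > 0}"
      proof (rule holomorphic_transform)
        fix y assume "y \<in> {y. Re y > 0}"
        thus "\<phi> (p + y *s axis i 1) = \<Phi> (\<chi> j. if j = i then y else \<zeta> $ j)"
          unfolding line[symmetric] using \<zeta> by (intro \<Phi>1[symmetric]) auto
      qed
    qed (use meas \<Phi>0 s w in auto)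
    then interpret S: coordinate_swap \<Phi> w s \<delta> b C .
    have "A x * exp (\<Sum>j\<in>UNIV. Z x $ j * w $ j) = S.integrand {} x" for x
      by (simp add: A_def Z_def S.integrand_def S.mix_weight_def prod.distrib exp_sum)
    hence "H w = (\<Sum>\<^sub>\<infinity>k :: nat ^ 'n. \<Phi> (\<chi> j. of_nat (k $ j)) * (\<Prod>j\<in>UNIV. (- exp (w $ j)) ^ (k $ j)))"
      unfolding H_def P_def using S.integral_eq_series by simp
    also have "\<dots> = series_sum (\<lambda>k. \<phi> (\<chi> j. of_nat (k $ j))) (\<chi> j. - exp (w $ j))"
      unfolding series_sum_def monomial_def by (intro infsum_cong) (simp add: \<Phi>1)
    finally show "H w = series_sum (\<lambda>k. \<phi> (\<chi> j. of_nat (k $ j))) (\<chi> j. - exp (w $ j))" .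
  qed
qed

section \<open>The support inequality of the polyhedron\<close>

text \<open>The slice \<open>u \<bullet> v = 1\<close> of a pointed cone is compact, hence the convex hull of its extreme points, and
the half-line through an extreme point of the slice is a face of the cone.\<close>

lemma pointed_cone_eq_hull_rays:
  fixes \<sigma> :: "'a::euclidean_space set"
  assumes cl: "closed \<sigma>" and cv: "convex \<sigma>"
    and cone: "\<And>x c. x \<in> \<sigma> \<Longrightarrow> 0 \<le> c \<Longrightarrow> c *\<^sub>R x \<in> \<sigma>"
    and pointed: "\<And>x. x \<in> \<sigma> \<Longrightarrow> norm x \<le> u \<bullet> x"
    and x: "x \<in> \<sigma>" "x \<noteq> 0"
  shows "(1 / (u \<bullet> x)) *\<^sub>R x \<in>
    convex hull {v \<in> \<sigma>. u \<bullet> v = 1 \<and> conic hull {v} face_of \<sigma>}"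
proof -
  define K where "K = {v \<in> \<sigma>. u \<bullet> v = 1}"
  have K: "K = \<sigma> \<inter> {v. u \<bullet> v = 1}" by (auto simp: K_def)
  have "bounded K" unfolding bounded_iff K_def using pointed by (intro exI[of _ 1]) force
  moreover have "closed K" unfolding K by (intro closed_Int cl closed_hyperplane)
  ultimately have cK: "compact K" by (simp add: compact_eq_bounded_closed)
  have vK: "convex K" unfolding K by (intro convex_Int cv convex_hyperplane)
  have ux: "u \<bullet> x > 0" using pointed[OF x(1)] x(2) by (smt (verit) zero_less_norm_iff)
  have "(1 / (u \<bullet> x)) *\<^sub>R x \<in> K" using ux x cone by (auto simp: K_def)
  also have "K = convex hull {v. v extreme_point_of K}"
    by (rule Krein_Milman_Minkowski[OF cK vK])
  also have "\<dots> \<subseteq> convex hull {v \<in> \<sigma>. u \<bullet> v = 1 \<and> conic hull {v} face_of \<sigma>}"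
  proof (rule hull_mono, clarsimp)
    fix v assume v: "v extreme_point_of K"
    hence vs: "v \<in> \<sigma>" "u \<bullet> v = 1" by (auto simp: extreme_point_of_def K_def)
    have ch: "conic hull {v} = {c *\<^sub>R v | c. 0 \<le> c}" by (auto simp: conic_hull_explicit)
    have "conic hull {v} face_of \<sigma>"
      unfolding face_of_def
    proof (intro conjI ballI impI)
      show "conic hull {v} \<subseteq> \<sigma>" using vs cone by (auto simp: ch)
      show "convex (conic hull {v})" by (simp add: convex_conic_hull)
      fix a b y assume a: "a \<in> \<sigma>" and b: "b \<in> \<sigma>" and y: "y \<in> conic hull {v}" and os: "y \<in> open_segment a b"
      obtain c where c: "y = c *\<^sub>R v" "c \<ge> 0" using y by (auto simp: ch)
      obtain t where t: "0 < t" "t < 1" "y = (1-t) *\<^sub>R a + t *\<^sub>R b" "a \<noteq> b"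
        using os by (auto simp: in_segment)
      define \<alpha> \<beta> where "\<alpha> = u \<bullet> a" and "\<beta> = u \<bullet> b"
      have nn: "norm a \<le> \<alpha>" "norm b \<le> \<beta>" using pointed a b by (auto simp: \<alpha>_def \<beta>_def)
      have ge: "\<alpha> \<ge> 0" "\<beta> \<ge> 0" using nn by (smt (verit) norm_ge_zero)+
      have cc: "c = (1-t)*\<alpha> + t*\<beta>"
      proof -
        have "u \<bullet> y = c" using c vs by simp
        thus ?thesis using t(3) by (simp add: inner_add_right \<alpha>_def \<beta>_def)
      qed
      consider "\<alpha> = 0" | "\<beta> = 0" | "\<alpha> > 0" "\<beta> > 0" using ge by linarith
      hence "a \<in> conic hull {v} \<and> b \<in> conic hull {v}"
      proof cases
        case 1
        hence a0: "a = 0" using nn by simp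
        hence "t *\<^sub>R b = c *\<^sub>R v" using t c by simp
        hence "(1/t) *\<^sub>R (t *\<^sub>R b) = (1/t) *\<^sub>R (c *\<^sub>R v)" by simp
        hence "b = (c/t) *\<^sub>R v" using t by simp
        thus ?thesis using a0 t c unfolding ch by (auto intro!: exI[of _ "0::real"] exI[of _ "c/t"])
      next
        case 2
        hence a0: "b = 0" using nn by simp
        hence "(1-t) *\<^sub>R a = c *\<^sub>R v" using t c by simp
        hence "(1/(1-t)) *\<^sub>R ((1-t) *\<^sub>R a) = (1/(1-t)) *\<^sub>R (c *\<^sub>R v)" by simp
        hence "a = (c/(1-t)) *\<^sub>R v" using t by simp
        thus ?thesis using a0 t c unfolding ch by (auto intro!: exI[of _ "0::real"] exI[of _ "c/(1-t)"])
      next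
        case 3
        define a' b' where "a' = (1/\<alpha>) *\<^sub>R a" and "b' = (1/\<beta>) *\<^sub>R b"
        have ab: "a = \<alpha> *\<^sub>R a'" "b = \<beta> *\<^sub>R b'" using 3 by (auto simp: a'_def b'_def)
        have "a' \<in> K" "b' \<in> K" using a b cone 3 by (auto simp: a'_def b'_def K_def \<alpha>_def \<beta>_def)
        hence nos: "v \<notin> open_segment a' b'" using v by (auto simp: extreme_point_of_def)
        have c0: "c > 0" unfolding cc using 3 t by (intro add_pos_pos mult_pos_pos) auto
        define r where "r = t*\<beta>/c"
        have r: "0 < r" "r < 1" "1 - r = (1-t)*\<alpha>/c"
          using c0 t 3 by (auto simp: r_def field_simps cc)
        have "v = (1/c) *\<^sub>R y" using c c0 by simp
        also have "\<dots> = (1-r) *\<^sub>R a' + r *\<^sub>R b'" unfolding r(3) unfolding t(3) ab r_def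
          by (simp add: scaleR_add_right)
        finally have ve: "v = (1-r) *\<^sub>R a' + r *\<^sub>R b'" .
        hence e: "a' = b'" using nos r by (auto simp: in_segment)
        hence "v = a'" using ve by (simp add: scaleR_left_distrib[symmetric])
        thus ?thesis using ab e ge unfolding ch by auto
      qed
      thus "a \<in> conic hull {v}" "b \<in> conic hull {v}" by auto
    qed
    thus "v \<in> \<sigma> \<and> u \<bullet> v = 1 \<and> conic hull {v} face_of \<sigma>" using vs by auto
  qed
  finally show ?thesis .
qed

lemma aff_dim_ray:
  fixes v :: "'a::euclidean_space"
  assumes "v \<noteq> 0" shows "aff_dim (conic hull {v}) = 1"
proof -
  have ch: "conic hull {v} = {c *\<^sub>R v | c. 0 \<le> c}" by (auto simp: conic_hull_explicit)
  have "0 \<in> conic hull {v}" unfolding ch by (auto intro!: exI[of _ "0::real"])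
  hence "aff_dim (conic hull {v}) = int (dim (conic hull {v}))"
    using aff_dim_zero[of "conic hull {v}"] hull_inc[of 0 "conic hull {v}" affine] by blast
  also have "span (conic hull {v}) = span {v}"
  proof (rule span_eq[THEN iffD2], intro conjI)
    show "conic hull {v} \<subseteq> span {v}" unfolding ch by (auto intro: span_mul span_base)
    have "v \<in> conic hull {v}" by (simp add: hull_inc)
    thus "{v} \<subseteq> span (conic hull {v})" by (auto intro: span_base)
  qed
  hence "dim (conic hull {v}) = dim {v}" by (metis dim_span)
  also have "dim {v} = 1" using assms by (simp add: dim_insert)
  finally show ?thesis by simp
qed

text \<open>The components of the complement of a central hyperplane arrangement are the open sign cones, because a linear form
cannot change sign on a connected set on which it does not vanish.\<close>

lemma sign_cone_component:
  fixes V :: "'a::euclidean_space set"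
  assumes x: "\<And>v. v \<in> V \<Longrightarrow> v \<bullet> x \<noteq> 0"
  defines "X \<equiv> {y. \<forall>v\<in>V. v \<bullet> y \<noteq> 0}"
  shows "closure {y. \<forall>v\<in>V. (v \<bullet> x) * (v \<bullet> y) > 0} = {y. \<forall>v\<in>V. (v \<bullet> x) * (v \<bullet> y) \<ge> 0}"
    and "{y. \<forall>v\<in>V. (v \<bullet> x) * (v \<bullet> y) > 0} \<in> components X"
proof -
  define S where "S = {y. \<forall>v\<in>V. (v \<bullet> x) * (v \<bullet> y) > 0}"
  define T where "T = {y. \<forall>v\<in>V. (v \<bullet> x) * (v \<bullet> y) \<ge> 0}"
  have S': "S = (\<Inter>v\<in>V. {y. ((v \<bullet> x) *\<^sub>R v) \<bullet> y > 0})" by (auto simp: S_def)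
  have T': "T = (\<Inter>v\<in>V. {y. ((v \<bullet> x) *\<^sub>R v) \<bullet> y \<ge> 0})" by (auto simp: T_def)
  have xS: "x \<in> S" using x unfolding S_def by (auto simp flip: power2_eq_square)
  have cS: "convex S" unfolding S' by (intro convex_INT convex_halfspace_gt)
  have "closed T" unfolding T' by (intro closed_INT ballI closed_halfspace_ge)
  moreover have "S \<subseteq> T" by (auto simp: S_def T_def less_imp_le)
  ultimately have 1: "closure S \<subseteq> T" by (simp add: closure_minimal)
  have "T \<subseteq> closure S"
  proof
    fix y assume y: "y \<in> T"
    have S: "y + t *\<^sub>R x \<in> S" if "t > 0" for t
      using y that x unfolding S_def T_def
      by (auto simp: inner_add_right algebra_simps intro!: add_nonneg_pos simp flip: power2_eq_square)
    have "((\<lambda>t. y + t *\<^sub>R x) \<longlongrightarrow> y + 0 *\<^sub>R x) (at_right 0)"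
      by (intro tendsto_intros)
    moreover have "\<forall>\<^sub>F t in at_right 0. y + t *\<^sub>R x \<in> closure S"
      using S closure_subset[of S] by (auto simp: eventually_at_right_field intro!: exI[of _ 1])
    ultimately show "y \<in> closure S"
      using Lim_in_closed_set[OF closed_closure] by fastforce
  qed
  with 1 show "closure S = T" by auto
  define C where "C = connected_component_set X x"
  have xX: "x \<in> X" using x by (auto simp: X_def)
  have C: "C \<in> components X" unfolding C_def using xX by (auto simp: components_def)
  have xC: "x \<in> C" unfolding C_def using xX by auto
  have "S \<subseteq> C" unfolding C_def
    by (rule connected_component_maximal[OF xS convex_connected[OF cS]]) (auto simp: S_def X_def)
  moreover have "C \<subseteq> S"
  proof
    fix y assume y: "y \<in> C"
    have "(v \<bullet> x) * (v \<bullet> y) > 0" if v: "v \<in> V" for v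
    proof (rule ccontr)
      assume "\<not> ?thesis"
      hence le: "(v \<bullet> x) * (v \<bullet> y) \<le> 0" by simp
      have "\<exists>z\<in>C. v \<bullet> z = 0"
      proof (cases "v \<bullet> x \<ge> 0")
        case True
        hence "v \<bullet> y \<le> 0" using le x[OF v] by (simp add: mult_le_0_iff)
        thus ?thesis using True connected_ivt_hyperplane[of C y x v 0] y xC C in_components_connected by auto
      next
        case False
        hence "v \<bullet> y \<ge> 0" using le by (simp add: mult_le_0_iff)
        thus ?thesis using False connected_ivt_hyperplane[of C x y v 0] y xC C in_components_connected by auto
      qed
      thus False using in_components_subset[OF C] v by (auto simp: X_def)
    qed
    thus "y \<in> S" by (auto simp: S_def)
  qed
  ultimately have "S = C" by auto
  with C show "S \<in> components X" by simp
qed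

lemma abs_eq_sgn_mult:
  assumes "(s::real) * t \<ge> 0" "s \<noteq> 0" shows "\<bar>t\<bar> = sgn s * t"
  using assms by (auto simp: sgn_if zero_le_mult_iff)

text \<open>Off the hyperplanes the inequality follows from the one on the rays, since \<open>g_lin\<close> is linear on the cone through the
point; the coordinate hyperplanes belong to the arrangement, which makes that cone pointed. The complement of the
hyperplanes is dense and both sides are continuous.\<close>

lemma polyhedron_P_support:
  fixes a \<mu> :: "nat \<Rightarrow> real ^ 'n"
  assumes gens: "ray_generators q a d \<mu>" and \<alpha>: "\<alpha> \<in> polyhedron_P q \<epsilon> a d \<mu>"
  shows "g_lin q \<epsilon> a \<eta> \<le> \<alpha> \<bullet> \<eta>"
proof -
  define V where "V = {a p |p. p \<in> {1..q} \<and> a p \<noteq> 0} \<union> range (\<lambda>k. axis k (1::real))"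
  define X where "X = {y. \<forall>v\<in>V. v \<bullet> y \<noteq> 0}"
  have inn: "(\<Sum>j\<in>UNIV. a p $ j * y $ j) = a p \<bullet> y" for p y by (simp add: inner_vec_def)
  have X: "- \<Union>(hyperplanes q a) = X"
  proof -
    have "hyperplanes q a = (\<lambda>v. {\<eta>. v \<bullet> \<eta> = 0}) ` V"
      unfolding V_def hyperplanes_def inn image_Un image_image
      by (intro arg_cong2[of _ _ _ _ "(\<union>)"]) (auto simp: inner_axis')
    thus ?thesis by (auto simp: X_def)
  qed
  have gX: "g_lin q \<epsilon> a x \<le> \<alpha> \<bullet> x" if "x \<in> X" for x
  proof -
    have nz: "\<And>v. v \<in> V \<Longrightarrow> v \<bullet> x \<noteq> 0" using that by (auto simp: X_def)
    define \<sigma> where "\<sigma> = {y. \<forall>v\<in>V. (v \<bullet> x) * (v \<bullet> y) \<ge> 0}"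
    have \<sigma>: "\<sigma> \<in> max_cones q a"
      unfolding max_cones_def X
    proof (rule image_eqI)
      show "\<sigma> = closure {y. \<forall>v\<in>V. (v \<bullet> x) * (v \<bullet> y) > 0}"
        unfolding \<sigma>_def by (rule sign_cone_component(1)[OF nz, symmetric])
      show "{y. \<forall>v\<in>V. (v \<bullet> x) * (v \<bullet> y) > 0} \<in> components X"
        unfolding X_def by (rule sign_cone_component(2)[OF nz])
    qed
    have \<sigma>': "\<sigma> = (\<Inter>v\<in>V. {y. ((v \<bullet> x) *\<^sub>R v) \<bullet> y \<ge> 0})" by (auto simp: \<sigma>_def)
    have cl: "closed \<sigma>" unfolding \<sigma>' by (intro closed_INT ballI closed_halfspace_ge)
    have cv: "convex \<sigma>" unfolding \<sigma>' by (intro convex_INT convex_halfspace_ge)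
    have cone: "c *\<^sub>R y \<in> \<sigma>" if "y \<in> \<sigma>" "0 \<le> c" for y c
      using that by (auto simp: \<sigma>_def mult.left_commute)
    have xk: "x $ k \<noteq> 0" for k using nz[of "axis k 1"] by (auto simp: V_def inner_axis')
    have yk: "\<bar>y $ k\<bar> = sgn (x $ k) * y $ k" if "y \<in> \<sigma>" for y k
    proof -
      have "axis k 1 \<in> V" by (auto simp: V_def)
      hence "x $ k * y $ k \<ge> 0" using that unfolding \<sigma>_def by (force simp: inner_axis')
      thus ?thesis using xk by (rule abs_eq_sgn_mult)
    qed
    have yp: "\<bar>a p \<bullet> y\<bar> = sgn (a p \<bullet> x) * (a p \<bullet> y)" if "y \<in> \<sigma>" "p \<in> {1..q}" for y p
    proof (cases "a p = 0")
      case False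
      hence "a p \<in> V" using that by (auto simp: V_def)
      thus ?thesis using that nz by (intro abs_eq_sgn_mult) (auto simp: \<sigma>_def)
    qed auto
    define u :: "real^'n" where "u = (\<chi> k. sgn (x $ k))"
    have pointed: "norm y \<le> u \<bullet> y" if "y \<in> \<sigma>" for y
      using norm_le_l1_cart[of y] by (simp add: u_def inner_vec_def yk[OF that])
    \<comment> \<open>the vector that represents the linear restriction of \<open>g_lin\<close> to the cone\<close>
    define G where "G = (\<Sum>p=1..q. (\<epsilon> p * sgn (a p \<bullet> x)) *\<^sub>R a p) + pi *\<^sub>R (\<chi> k. 1 - sgn (x $ k))"
    have G: "g_lin q \<epsilon> a y = G \<bullet> y" if "y \<in> \<sigma>" for y
    proof -
      have "(\<Sum>k\<in>UNIV. y $ k - \<bar>y $ k\<bar>) = (\<chi> k. 1 - sgn (x $ k)) \<bullet> y"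
        by (simp add: inner_vec_def yk[OF that] algebra_simps)
      moreover have "(\<Sum>p=1..q. \<epsilon> p * \<bar>a p \<bullet> y\<bar>) = (\<Sum>p=1..q. (\<epsilon> p * sgn (a p \<bullet> x)) *\<^sub>R a p) \<bullet> y"
        by (auto simp: inner_sum_left yp[OF that] intro!: sum.cong)
      ultimately show ?thesis unfolding g_lin_def inn by (simp add: G_def inner_add_left)
    qed
    have x0: "x \<noteq> 0" using xk by auto
    have xs: "x \<in> \<sigma>" by (auto simp: \<sigma>_def)
    have ux: "u \<bullet> x > 0" using pointed[OF xs] x0 by (smt (verit) zero_less_norm_iff)
    have "(1 / (u \<bullet> x)) *\<^sub>R x \<in>
      convex hull {v \<in> \<sigma>. u \<bullet> v = 1 \<and> conic hull {v} face_of \<sigma>}"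
      by (rule pointed_cone_eq_hull_rays[OF cl cv cone pointed xs x0])
    also have "\<dots> \<subseteq> {y. (G - \<alpha>) \<bullet> y \<le> 0}"
    proof (rule hull_minimal)
      show "convex {y. (G - \<alpha>) \<bullet> y \<le> 0}" by (rule convex_halfspace_le)
      show "{v \<in> \<sigma>. u \<bullet> v = 1 \<and> conic hull {v} face_of \<sigma>} \<subseteq> {y. (G - \<alpha>) \<bullet> y \<le> 0}"
      proof clarify
        fix v assume v: "v \<in> \<sigma>" "u \<bullet> v = 1" "conic hull {v} face_of \<sigma>"
        have "v \<noteq> 0" using v by auto
        hence "conic hull {v} \<in> fan_rays q a"
          using v \<sigma> aff_dim_ray[of v] unfolding fan_rays_def fan_def by (auto simp: hull_inc)
        also have "fan_rays q a = (\<lambda>\<nu>. conic hull {\<mu> \<nu>}) ` {1..d}"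
          using gens unfolding ray_generators_def bij_betw_def by blast
        finally obtain \<nu> where \<nu>: "\<nu> \<in> {1..d}" "conic hull {v} = conic hull {\<mu> \<nu>}"
          by blast
        have "v \<in> conic hull {\<mu> \<nu>}" using \<nu>(2) hull_inc[of v "{v}"] by auto
        then obtain c where c: "v = c *\<^sub>R \<mu> \<nu>" "c \<ge> 0" by (auto simp: conic_hull_explicit)
        have "\<mu> \<nu> \<in> conic hull {v}" using \<nu>(2) hull_inc[of "\<mu> \<nu>" "{\<mu> \<nu>}"] by auto
        hence "\<mu> \<nu> \<in> \<sigma>" using v face_of_imp_subset by blast
        hence "G \<bullet> \<mu> \<nu> \<le> \<alpha> \<bullet> \<mu> \<nu>"
          using \<alpha> \<nu>(1) G unfolding polyhedron_P_def by (force simp: inner_commute)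
        thus "(G - \<alpha>) \<bullet> v \<le> 0" using c by (simp add: inner_diff_left mult_nonneg_nonpos)
      qed
    qed
    finally have "(G - \<alpha>) \<bullet> x \<le> 0" using ux by (simp add: divide_le_0_iff)
    thus ?thesis using G[OF xs] by (simp add: inner_diff_left)
  qed
  have neg: "negligible (- X)"
  proof -
    have "- X = (\<Union>v\<in>V. {y. v \<bullet> y = 0})" by (auto simp: X_def)
    moreover have "finite V" unfolding V_def by auto
    moreover have "v \<noteq> 0" if "v \<in> V" for v using that unfolding V_def by auto
    ultimately show ?thesis by (auto intro!: negligible_Union negligible_hyperplane)
  qed
  have "interior (- X) = {}"
    using open_not_negligible[of "interior (-X)"] negligible_subset[OF neg interior_subset] by auto
  hence "closure X = UNIV" unfolding interior_complement by blast
  moreover have "closed {y. g_lin q \<epsilon> a y \<le> \<alpha> \<bullet> y}"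
    unfolding g_lin_def by (intro closed_Collect_le continuous_intros)
  hence "closure X \<subseteq> {y. g_lin q \<epsilon> a y \<le> \<alpha> \<bullet> y}" using gX by (intro closure_minimal) auto
  ultimately show ?thesis by auto
qed

section \<open>The piecewise linear data\<close>

lemma log_ext_le_imp:
  assumes "log_ext (norm z) \<le> ereal y" shows "norm z \<le> exp y"
proof (cases "z = 0")
  case False
  hence "ln (norm z) \<le> y" using assms by (simp add: log_ext_def)
  thus ?thesis using False by (metis exp_le_cancel_iff exp_ln zero_less_norm_iff)
qed simp

definition g_hom :: "nat \<Rightarrow> (nat \<Rightarrow> real) \<Rightarrow> (nat \<Rightarrow> real ^ 'n) \<Rightarrow> real ^ 'n \<Rightarrow> real" where
  "g_hom q \<epsilon> a \<eta> = (\<Sum>p=1..q. \<epsilon> p * \<bar>\<Sum>j\<in>UNIV. a p $ j * \<eta> $ j\<bar>)"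

definition slope_bound :: "nat \<Rightarrow> (nat \<Rightarrow> real) \<Rightarrow> (nat \<Rightarrow> real ^ 'n) \<Rightarrow> real" where
  "slope_bound q \<epsilon> a = (\<Sum>p=1..q. \<bar>\<epsilon> p\<bar> * (\<Sum>j\<in>UNIV. \<bar>a p $ j\<bar>))"

lemma slope_bound_nonneg: "slope_bound q \<epsilon> a \<ge> 0"
  unfolding slope_bound_def by (intro sum_nonneg mult_nonneg_nonneg) auto

lemma g_hom_even: "g_hom q \<epsilon> a (- \<eta>) = g_hom q \<epsilon> a \<eta>"
  by (simp add: g_hom_def sum_negf)

lemma g_hom_lower: "- slope_bound q \<epsilon> a * (\<Sum>j\<in>UNIV. \<bar>\<eta> $ j\<bar>) \<le> g_hom q \<epsilon> a \<eta>"
proof -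
  let ?E = "\<Sum>j\<in>UNIV. \<bar>\<eta> $ j\<bar>"
  have lin: "\<bar>\<Sum>j\<in>UNIV. a p $ j * \<eta> $ j\<bar> \<le> (\<Sum>j\<in>UNIV. \<bar>a p $ j\<bar>) * ?E" for p
  proof -
    have "\<bar>\<Sum>j\<in>UNIV. a p $ j * \<eta> $ j\<bar> \<le> (\<Sum>j\<in>UNIV. \<bar>a p $ j * \<eta> $ j\<bar>)" by (rule sum_abs)
    also have "\<dots> \<le> (\<Sum>j\<in>UNIV. \<bar>a p $ j\<bar> * ?E)"
      unfolding abs_mult by (intro sum_mono mult_left_mono member_le_sum) auto
    finally show ?thesis by (simp add: sum_distrib_right)
  qed
  have "- (\<bar>\<epsilon> p\<bar> * (\<Sum>j\<in>UNIV. \<bar>a p $ j\<bar>) * ?E) \<le> \<epsilon> p * \<bar>\<Sum>j\<in>UNIV. a p $ j * \<eta> $ j\<bar>" for p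
  proof -
    have "\<bar>\<epsilon> p * \<bar>\<Sum>j\<in>UNIV. a p $ j * \<eta> $ j\<bar>\<bar> \<le> \<bar>\<epsilon> p\<bar> * ((\<Sum>j\<in>UNIV. \<bar>a p $ j\<bar>) * ?E)"
      unfolding abs_mult using lin[of p] by (intro mult_left_mono) auto
    thus ?thesis by (simp add: mult.assoc)
  qed
  hence "(\<Sum>p=1..q. - (\<bar>\<epsilon> p\<bar> * (\<Sum>j\<in>UNIV. \<bar>a p $ j\<bar>) * ?E)) \<le> g_hom q \<epsilon> a \<eta>"
    unfolding g_hom_def by (intro sum_mono)
  thus ?thesis by (simp add: slope_bound_def sum_negf sum_distrib_right)
qed

lemma g_tilde_le_g_hom:
  assumes e: "\<And>j. \<bar>e $ j\<bar> \<le> 1"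
  shows "g_tilde q \<epsilon> a a0 (\<eta> + \<tau> *\<^sub>R e) \<le>
    g_hom q \<epsilon> a \<eta> + (\<Sum>p=1..q. \<bar>\<epsilon> p\<bar> * \<bar>a0 p\<bar>) + slope_bound q \<epsilon> a * \<bar>\<tau>\<bar>"
proof -
  have "\<epsilon> p * \<bar>(\<Sum>j\<in>UNIV. a p $ j * (\<eta> + \<tau> *\<^sub>R e) $ j) + a0 p\<bar> \<le>
      \<epsilon> p * \<bar>\<Sum>j\<in>UNIV. a p $ j * \<eta> $ j\<bar> + (\<bar>\<epsilon> p\<bar> * \<bar>a0 p\<bar> + \<bar>\<epsilon> p\<bar> * (\<Sum>j\<in>UNIV. \<bar>a p $ j\<bar>) * \<bar>\<tau>\<bar>)" for p
  proof -
    define X where "X = (\<Sum>j\<in>UNIV. a p $ j * \<eta> $ j)"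
    define Y where "Y = (\<Sum>j\<in>UNIV. a p $ j * (\<tau> * e $ j)) + a0 p"
    define S where "S = (\<Sum>j\<in>UNIV. \<bar>a p $ j\<bar>)"
    have eq: "(\<Sum>j\<in>UNIV. a p $ j * (\<eta> + \<tau> *\<^sub>R e) $ j) + a0 p = X + Y"
      by (simp add: X_def Y_def distrib_left sum.distrib)
    have "\<bar>\<Sum>j\<in>UNIV. a p $ j * (\<tau> * e $ j)\<bar> \<le> (\<Sum>j\<in>UNIV. \<bar>a p $ j\<bar> * \<bar>\<tau>\<bar>)"
    proof (rule order_trans[OF sum_abs], rule sum_mono)
      fix j
      have "\<bar>\<tau>\<bar> * \<bar>e $ j\<bar> \<le> \<bar>\<tau>\<bar> * 1" using e by (intro mult_left_mono) auto
      thus "\<bar>a p $ j * (\<tau> * e $ j)\<bar> \<le> \<bar>a p $ j\<bar> * \<bar>\<tau>\<bar>" by (simp add: abs_mult mult_left_mono)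
    qed
    hence Y: "\<bar>Y\<bar> \<le> S * \<bar>\<tau>\<bar> + \<bar>a0 p\<bar>" unfolding Y_def S_def sum_distrib_right by linarith
    have "\<epsilon> p * (\<bar>X + Y\<bar> - \<bar>X\<bar>) \<le> \<bar>\<epsilon> p * (\<bar>X + Y\<bar> - \<bar>X\<bar>)\<bar>" by (rule abs_ge_self)
    also have "\<dots> \<le> \<bar>\<epsilon> p\<bar> * (S * \<bar>\<tau>\<bar> + \<bar>a0 p\<bar>)"
      unfolding abs_mult using Y by (intro mult_left_mono) auto
    finally show ?thesis unfolding eq by (fold X_def S_def) (simp add: algebra_simps)
  qed
  hence "g_tilde q \<epsilon> a a0 (\<eta> + \<tau> *\<^sub>R e) \<le> (\<Sum>p=1..q. \<epsilon> p * \<bar>\<Sum>j\<in>UNIV. a p $ j * \<eta> $ j\<bar> +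
     (\<bar>\<epsilon> p\<bar> * \<bar>a0 p\<bar> + \<bar>\<epsilon> p\<bar> * (\<Sum>j\<in>UNIV. \<bar>a p $ j\<bar>) * \<bar>\<tau>\<bar>))"
    unfolding g_tilde_def by (intro sum_mono)
  thus ?thesis by (simp add: g_hom_def slope_bound_def sum.distrib sum_distrib_right)
qed

text \<open>Moving \<open>\<alpha>\<close> by \<open>r\<close> against \<open>\<eta>\<close> stays in \<open>P\<close> and lowers \<open>\<alpha> \<bullet> \<eta>\<close> by \<open>r\<close> times the norm of \<open>\<eta>\<close>; this is
the margin. The shift by \<open>\<pi>\<close> turns \<open>Arg z\<close> into the imaginary part of \<open>log (- z)\<close>.\<close>

lemma interior_P_admissible:
  fixes a \<mu> :: "nat \<Rightarrow> real ^ 'n"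
  assumes gens: "ray_generators q a d \<mu>" and \<alpha>: "\<alpha> \<in> interior (polyhedron_P q \<epsilon> a d \<mu>)"
  shows "\<exists>c>0. (\<chi> j. \<alpha> $ j - pi) \<in> admissible (g_hom q \<epsilon> a) c"
proof -
  obtain r where r: "r > 0" "cball \<alpha> r \<subseteq> polyhedron_P q \<epsilon> a d \<mu>"
    using \<alpha> by (meson mem_interior_cball)
  define N where "N = real CARD('n)"
  have N: "N > 0" by (simp add: N_def)
  have "(\<chi> j. \<alpha> $ j - pi) \<in> admissible (g_hom q \<epsilon> a) (r / N)"
    unfolding admissible_def
  proof clarify
    fix \<eta> :: "real ^ 'n"
    let ?E = "\<Sum>j\<in>UNIV. \<bar>\<eta> $ j\<bar>"
    define \<alpha>' where "\<alpha>' = \<alpha> - (r / norm \<eta>) *\<^sub>R \<eta>"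
    have "\<alpha>' \<in> cball \<alpha> r" using r(1) by (simp add: \<alpha>'_def dist_norm)
    hence "g_lin q \<epsilon> a \<eta> \<le> \<alpha>' \<bullet> \<eta>" using r(2) polyhedron_P_support[OF gens] by blast
    also have "\<alpha>' \<bullet> \<eta> = \<alpha> \<bullet> \<eta> - r * norm \<eta>"
      by (cases "\<eta> = 0") (simp_all add: \<alpha>'_def inner_diff_left dot_square_norm power2_eq_square)
    finally have 1: "g_lin q \<epsilon> a \<eta> \<le> \<alpha> \<bullet> \<eta> - r * norm \<eta>" .
    have "?E \<le> (\<Sum>j\<in>(UNIV :: 'n set). norm \<eta>)" by (intro sum_mono component_le_norm_cart)
    hence "r / N * ?E \<le> r / N * (N * norm \<eta>)" using r N by (intro mult_left_mono) (auto simp: N_def)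
    hence 2: "r / N * ?E \<le> r * norm \<eta>" using N by simp
    have 3: "g_lin q \<epsilon> a \<eta> = g_hom q \<epsilon> a \<eta> + pi * (\<Sum>j\<in>UNIV. \<eta> $ j) - pi * ?E"
      by (simp add: g_lin_def g_hom_def sum_subtractf right_diff_distrib)
    have 4: "(\<chi> j. \<alpha> $ j - pi) \<bullet> \<eta> = \<alpha> \<bullet> \<eta> - pi * (\<Sum>j\<in>UNIV. \<eta> $ j)"
      by (simp add: inner_vec_def left_diff_distrib sum_subtractf sum_distrib_left)
    show "g_hom q \<epsilon> a \<eta> + r / N * ?E \<le> (\<chi> j. \<alpha> $ j - pi) \<bullet> \<eta> + pi * ?E"
      using 1 2 unfolding 3 4 by linarith
  qed
  thus ?thesis using r N by (intro exI[of _ "r / N"]) auto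
qed

section \<open>Gluing\<close>

text \<open>The principal logarithm of \<open>- z\<^sub>j\<close> has its cut exactly along the half-line that is removed from the
\<open>z\<^sub>j\<close>-plane.\<close>

definition Ln_neg :: "complex ^ 'n \<Rightarrow> complex ^ 'n" where
  "Ln_neg z = (\<chi> j. Ln (- z $ j))"

lemma exp_Ln_neg: "(\<And>j. z $ j \<noteq> 0) \<Longrightarrow> (\<chi> j. - exp (Ln_neg z $ j)) = z"
  by (simp add: Ln_neg_def vec_eq_iff)

lemma Arg2pi_eq_Im_Ln_neg:
  assumes "z $ j \<notin> \<real>\<^sub>\<ge>\<^sub>0" shows "Arg2pi (z $ j) = Im_vec (Ln_neg z) $ j + pi"
proof -
  have "Arg2pi (z $ j) \<noteq> 0" using assms by (metis Arg2pi_eq_0 complex_nonneg_Reals_iff complex_is_Real_iff)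
  hence "Arg2pi (z $ j) > 0" using Arg2pi_ge_0[of "z $ j"] by simp
  thus ?thesis using Arg2pi_Ln[of "z $ j"] by (simp add: Im_vec_def Ln_neg_def)
qed

lemma Ln_neg_has_derivative:
  fixes z :: "complex ^ 'n"
  assumes "\<And>j. z $ j \<notin> \<real>\<^sub>\<ge>\<^sub>0"
  shows "(Ln_neg has_derivative (\<lambda>h. \<chi> j. h $ j / z $ j)) (at z)"
proof -
  have "((\<lambda>z. Ln (- z $ j)) has_derivative (\<lambda>h. h $ j / z $ j)) (at z)" for j
  proof -
    have neg: "- z $ j \<notin> \<real>\<^sub>\<le>\<^sub>0" using assms[of j] by (auto simp: complex_nonpos_Reals_iff complex_nonneg_Reals_iff)
    have "(Ln has_derivative (\<lambda>h. inverse (- z $ j) * h)) (at (- z $ j))"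
      using has_field_derivative_Ln[OF neg] unfolding has_field_derivative_def .
    moreover have "((\<lambda>z :: complex ^ 'n. - z $ j) has_derivative (\<lambda>h. - h $ j)) (at z)"
      by (intro has_derivative_minus bounded_linear_imp_has_derivative bounded_linear_vec_nth)
    ultimately have "((\<lambda>z. Ln (- z $ j)) has_derivative (\<lambda>h. inverse (- z $ j) * (- h $ j))) (at z)"
      by (rule has_derivative_compose[rotated])
    moreover have "(\<lambda>h. inverse (- z $ j) * (- h $ j)) = (\<lambda>h :: complex ^ 'n. h $ j / z $ j)"
      by (simp add: divide_inverse mult.commute)
    ultimately show ?thesis by simp
  qed
  hence "((\<lambda>z. \<Sum>j\<in>UNIV. Ln (- z $ j) *s (axis j 1 :: complex ^ 'n)) has_derivative
      (\<lambda>h. \<Sum>j\<in>UNIV. (h $ j / z $ j) *s axis j 1)) (at z)"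
    by (intro has_derivative_sum bounded_linear.has_derivative[OF bounded_linear_vector_smult])
  moreover have "(\<Sum>j\<in>UNIV. x j *s (axis j 1 :: complex ^ 'n)) = (\<chi> j. x j)" for x :: "'n \<Rightarrow> complex"
    by (simp add: vec_eq_iff axis_def if_distrib cong: if_cong)
  ultimately show ?thesis by (simp add: Ln_neg_def[abs_def])
qed

lemma mv_holomorphic_on_subset:
  "mv_holomorphic_on F U \<Longrightarrow> open V \<Longrightarrow> V \<subseteq> U \<Longrightarrow> mv_holomorphic_on F V"
  unfolding mv_holomorphic_on_def by blast

lemma open_base_region: "open {w :: complex ^ 'n. \<forall>j. \<bar>Im (w $ j)\<bar> < \<delta> \<and> Re (w $ j) + b < 0}"
proof -
  have "{w :: complex ^ 'n. \<forall>j. \<bar>Im (w $ j)\<bar> < \<delta> \<and> Re (w $ j) + b < 0}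
     = (\<Inter>j. {w. \<bar>Im (w $ j)\<bar> < \<delta>} \<inter> {w. Re (w $ j) + b < 0})" by auto
  also have "open \<dots>" by (intro open_INT ballI open_Int open_Collect_less continuous_intros) simp
  finally show ?thesis .
qed

lemma convergence_domain_enlarge:
  assumes "z \<in> convergence_domain f"
  obtains t where "t > 1" "(\<lambda>k. norm (f k * monomial (t *\<^sub>R z) k)) summable_on UNIV"
proof -
  let ?S = "{z. (\<lambda>k. norm (f k * monomial z k)) summable_on UNIV}"
  have "z \<in> interior ?S" using assms by (simp add: convergence_domain_def)
  moreover have "((\<lambda>t. t *\<^sub>R z) \<longlongrightarrow> 1 *\<^sub>R z) (at_right 1)" by (intro tendsto_intros)
  ultimately have "\<forall>\<^sub>F t in at_right 1. t *\<^sub>R z \<in> interior ?S"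
    using topological_tendstoD[OF _ open_interior] by fastforce
  then obtain b where "b > 1" "\<And>t. 1 < t \<Longrightarrow> t < b \<Longrightarrow> t *\<^sub>R z \<in> interior ?S"
    by (auto simp: eventually_at_right_field)
  hence "((1 + b) / 2) *\<^sub>R z \<in> ?S" by (intro subsetD[OF interior_subset[of ?S]]) simp
  thus ?thesis using that[of "(1 + b) / 2"] \<open>b > 1\<close> by simp
qed

theorem mainTheorem1:
  fixes f :: "nat ^ 'n \<Rightarrow> complex"
    and \<phi> :: "complex ^ 'n \<Rightarrow> complex"
    and q d :: nat
    and \<epsilon> a0 :: "nat \<Rightarrow> real"
    and a \<mu> :: "nat \<Rightarrow> real ^ 'n"
    and b C \<delta> :: real
  assumes interp: "\<And>k. \<phi> (\<chi> j. of_nat (k $ j)) = f k"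
    and eps: "\<And>p. p \<in> {1..q} \<Longrightarrow> \<epsilon> p \<in> {1, -1}"
    and gens: "ray_generators q a d \<mu>"
    and holo: "mv_holomorphic_near \<phi> right_half_space"
    and est1: "\<And>\<eta>. log_ext (cmod (\<phi> (cvec 0 \<eta>))) \<le> ereal (g_tilde q \<epsilon> a a0 \<eta>)"
    and delta: "\<delta> > 0"
    and est2: "\<And>\<xi> \<eta>. (\<And>j. 0 \<le> \<xi> $ j) \<Longrightarrow>
      log_ext (cmod (\<phi> (cvec \<xi> \<eta>))) \<le>
        ereal ((\<Sum>j\<in>UNIV. (pi - \<delta>) * \<bar>\<eta> $ j\<bar> + b * \<xi> $ j) + C)"
  shows "extends_analytically f (Arg_preimage (interior (polyhedron_P q \<epsilon> a d \<mu>)))"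
proof -
  define G where "G = g_hom q \<epsilon> a"
  define W where "W = Arg_preimage (interior (polyhedron_P q \<epsilon> a d \<mu>))"
  define B where "B = {w :: complex ^ 'n. \<forall>j. \<bar>Im (w $ j)\<bar> < \<delta> \<and> Re (w $ j) + b < 0}"
  have e1: "norm (\<phi> (cvec 0 \<eta>)) \<le> exp (g_tilde q \<epsilon> a a0 \<eta>)" for \<eta>
    by (rule log_ext_le_imp[OF est1])
  have e2: "norm (\<phi> (cvec \<xi> \<eta>)) \<le> exp ((\<Sum>j\<in>UNIV. (pi - \<delta>) * \<bar>\<eta> $ j\<bar> + b * \<xi> $ j) + C)"
    if "\<And>j. 0 \<le> \<xi> $ j" for \<xi> \<eta> by (rule log_ext_le_imp[OF est2[OF that]])
  obtain K where K: "\<And>s \<xi> \<eta>. 0 \<le> s \<Longrightarrow> s \<le> 1 \<Longrightarrow> (\<And>j. \<xi> $ j \<in> {0, s}) \<Longrightarrow>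
     norm (\<phi> (cvec \<xi> \<eta>)) \<le> exp (K + G \<eta> + s * (slope_bound q \<epsilon> a + pi) * (\<Sum>j\<in>UNIV. \<bar>\<eta> $ j\<bar>))"
    using growth_near_imaginary_space[OF holo e1 e2 delta g_tilde_le_g_hom g_hom_lower] unfolding G_def by blast
  have slope: "slope_bound q \<epsilon> a + pi > 0" using slope_bound_nonneg[of q \<epsilon> a] pi_gt_zero by linarith
  have "\<exists>H. mv_holomorphic_on H (tube G c) \<and> (\<forall>w\<in>B. H w = series_sum f (\<chi> j. - exp (w $ j)))" if c: "c > 0" for c
  proof (rule Laplace_representation[OF holo])
    show "norm (\<phi> (cvec \<xi> \<eta>)) \<le> exp (K + G \<eta> + s * (slope_bound q \<epsilon> a + pi) * (\<Sum>j\<in>UNIV. \<bar>\<eta> $ j\<bar>))"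
      if "0 \<le> s" "s \<le> 1" "\<And>j. \<xi> $ j \<in> {0, s}" for s \<xi> \<eta> by (rule K[OF that])
    show "norm (\<phi> (cvec \<xi> \<eta>)) \<le> exp ((\<Sum>j\<in>UNIV. (pi - \<delta>) * \<bar>\<eta> $ j\<bar> + b * \<xi> $ j) + C)"
      if "\<And>j. 0 \<le> \<xi> $ j" for \<xi> \<eta> by (rule e2[OF that])
    fix H assume "mv_holomorphic_on H (tube G c)"
      and "\<And>w. (\<And>j. \<bar>Im (w $ j)\<bar> < \<delta>) \<Longrightarrow> (\<And>j. Re (w $ j) + b < 0) \<Longrightarrow>
        H w = series_sum (\<lambda>k. \<phi> (\<chi> j. of_nat (k $ j))) (\<chi> j. - exp (w $ j))"
    thus ?thesis unfolding interp B_def by auto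
  qed (fact slope c)+
  then obtain H where H: "\<And>c. c > 0 \<Longrightarrow> mv_holomorphic_on (H c) (tube G c)"
    and HB: "\<And>c w. c > 0 \<Longrightarrow> w \<in> B \<Longrightarrow> H c w = series_sum f (\<chi> j. - exp (w $ j))"
    by metis
  have real_tube: "w \<in> tube G c" if v: "v \<in> tube G c" and w: "Im_vec w = 0" for v w c
  proof -
    obtain c' where c': "c' > c" "Im_vec v \<in> admissible G c'" using v unfolding tube_def by blast
    have "0 \<in> admissible G c'" by (rule zero_admissible[OF _ c'(2)]) (simp add: G_def g_hom_even)
    thus ?thesis using c'(1) w unfolding tube_def by auto
  qed
  have consistent: "H c w = H c' w" if c: "c > 0" "c' > 0" and w: "w \<in> tube G c \<inter> tube G c'" for c c' w
  proof (rule mv_holomorphic_identity)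
    \<comment> \<open>a real point in the region where every \<open>H c\<close> is the series\<close>
    define v :: "complex ^ 'n" where "v = (\<chi> j. of_real (- b - 1))"
    have op: "open (tube G c \<inter> tube G c')" by (intro open_Int open_tube)
    show "mv_holomorphic_on (H c) (tube G c \<inter> tube G c')"
      by (rule mv_holomorphic_on_subset[OF H[OF c(1)] op]) simp
    show "mv_holomorphic_on (H c') (tube G c \<inter> tube G c')"
      by (rule mv_holomorphic_on_subset[OF H[OF c(2)] op]) simp
    show "convex (tube G c \<inter> tube G c')" by (intro convex_Int convex_tube)
    show "open (tube G c \<inter> tube G c' \<inter> B)" unfolding B_def by (intro open_Int op open_base_region)
    have "Im_vec v = 0" by (simp add: Im_vec_def v_def vec_eq_iff)
    thus "v \<in> tube G c \<inter> tube G c' \<inter> B" using w real_tube delta by (auto simp: B_def v_def)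
    show "H c x = H c' x" if "x \<in> tube G c \<inter> tube G c' \<inter> B" for x using that HB c by simp
  qed (use w in auto)
  have W: "z $ j \<notin> \<real>\<^sub>\<ge>\<^sub>0" "z $ j \<noteq> 0" if "z \<in> W" for z j
  proof -
    show 1: "z $ j \<notin> \<real>\<^sub>\<ge>\<^sub>0" using that by (simp add: W_def Arg_preimage_def)
    thus "z $ j \<noteq> 0" by (metis nonneg_Reals_zero_I)
  qed
  have in_tube: "\<exists>c>0. Ln_neg z \<in> tube G c" if z: "z \<in> W" for z
  proof -
    obtain c where c: "c > 0" "(\<chi> j. (\<chi> j. Arg2pi (z $ j)) $ j - pi) \<in> admissible G c"
      using interior_P_admissible[OF gens] z unfolding W_def Arg_preimage_def G_def by blast
    have "(\<chi> j. (\<chi> j. Arg2pi (z $ j)) $ j - pi) = Im_vec (Ln_neg z)"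
      by (simp add: vec_eq_iff Arg2pi_eq_Im_Ln_neg[OF W(1)[OF z]])
    hence "Ln_neg z \<in> tube G (c/2)" using c unfolding tube_def by (intro CollectI exI[of _ c]) simp
    thus ?thesis using c(1) by (intro exI[of _ "c/2"]) simp
  qed
  \<comment> \<open>the margin may vary with the point; \<open>consistent\<close> makes the choice immaterial\<close>
  define choice where "choice = (\<lambda>z. SOME c. c > 0 \<and> Ln_neg z \<in> tube G c)"
  have choice: "choice z > 0 \<and> Ln_neg z \<in> tube G (choice z)" if "z \<in> W" for z
    unfolding choice_def using someI_ex[OF in_tube[OF that]] by blast
  define F where "F = (\<lambda>z. H (choice z) (Ln_neg z))"
  define S where "S = {z :: complex ^ 'n. \<forall>j. z $ j \<notin> \<real>\<^sub>\<ge>\<^sub>0}"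
  have oS: "open S"
  proof -
    have "S = (\<Inter>j. (\<lambda>z. z $ j) -` (- \<real>\<^sub>\<ge>\<^sub>0))" by (auto simp: S_def)
    also have "open \<dots>"
      by (intro open_INT ballI open_vimage continuous_intros) (auto simp: open_Compl closed_nonneg_Reals_complex)
    finally show ?thesis .
  qed
  have cL: "continuous_on S Ln_neg"
    using Ln_neg_has_derivative unfolding S_def
    by (intro continuous_at_imp_continuous_on ballI) (blast intro: has_derivative_continuous)
  have oW: "open W"
  proof -
    define T where "T = (\<lambda>w :: complex ^ 'n. (\<chi> j. Im_vec w $ j + pi)) -` interior (polyhedron_P q \<epsilon> a d \<mu>)"
    have "open T" unfolding T_def
      by (intro open_vimage open_interior continuous_on_vec_lambda continuous_intros
          continuous_on_compose2[OF continuous_on_component continuous_on_Im_vec]) auto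
    hence "open (S \<inter> Ln_neg -` T)" using cL oS by (simp add: continuous_on_open_vimage Int_commute)
    also have "S \<inter> Ln_neg -` T = W"
    proof -
      have "(\<chi> j. Im_vec (Ln_neg z) $ j + pi) = (\<chi> j. Arg2pi (z $ j))" if "z \<in> S" for z
        using that by (simp add: S_def Arg2pi_eq_Im_Ln_neg)
      thus ?thesis by (auto simp: S_def T_def W_def Arg_preimage_def)
    qed
    finally show ?thesis .
  qed
  have hF: "mv_holomorphic_on F W"
    unfolding mv_holomorphic_on_def
  proof (intro conjI ballI oW)
    fix z assume z: "z \<in> W"
    define c where "c = choice z"
    have c: "c > 0" "Ln_neg z \<in> tube G c" using choice[OF z] by (auto simp: c_def)
    have WS: "W \<subseteq> S" using W(1) by (auto simp: S_def)
    have oN: "open (W \<inter> Ln_neg -` tube G c)"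
      using continuous_on_subset[OF cL WS] oW open_tube by (metis Int_commute continuous_on_open_vimage)
    obtain D where D: "(H c has_derivative D) (at (Ln_neg z))" "\<forall>c v. D (c *s v) = c * D v"
      using H[OF c(1)] c(2) unfolding mv_holomorphic_on_def by blast
    have "((\<lambda>z. H c (Ln_neg z)) has_derivative (\<lambda>h. D (\<chi> j. h $ j / z $ j))) (at z)"
      by (rule has_derivative_compose[OF Ln_neg_has_derivative[OF W(1)[OF z]] D(1)])
    hence "(F has_derivative (\<lambda>h. D (\<chi> j. h $ j / z $ j))) (at z)"
    proof (rule has_derivative_transform_within_open[OF _ oN])
      show "z \<in> W \<inter> Ln_neg -` tube G c" using z c by simp
      show "H c (Ln_neg x) = F x" if "x \<in> W \<inter> Ln_neg -` tube G c" for x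
        unfolding F_def using that choice[of x] c by (intro consistent) auto
    qed
    moreover have "D (\<chi> j. (u *s v) $ j / z $ j) = u * D (\<chi> j. v $ j / z $ j)" for u v
    proof -
      have "(\<chi> j. (u *s v) $ j / z $ j) = u *s (\<chi> j. v $ j / z $ j)" by (simp add: vec_eq_iff)
      thus ?thesis using D(2) by simp
    qed
    ultimately show "\<exists>D. (F has_derivative D) (at z) \<and> (\<forall>c v. D (c *s v) = c * D v)" by blast
  qed
  have eqF: "F z = series_sum f z" if z: "z \<in> W" "z \<in> convergence_domain f" for z
  proof -
    define c where "c = choice z"
    have c: "c > 0" "Ln_neg z \<in> tube G c" using choice[OF z(1)] by (auto simp: c_def)
    obtain t where t: "t > 1" "(\<lambda>k. norm (f k * monomial (t *\<^sub>R z) k)) summable_on UNIV"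
      using convergence_domain_enlarge[OF z(2)] .
    \<comment> \<open>a polydisc is a product of half-planes, hence convex, in logarithmic coordinates\<close>
    define \<rho> where "\<rho> = (\<lambda>j. ln (norm ((t *\<^sub>R z) $ j)))"
    define R where "R = {w :: complex ^ 'n. \<forall>j. Re (w $ j) < \<rho> j}"
    have "(t *\<^sub>R z) $ j \<noteq> 0" for j using t(1) W(2)[OF z(1)] by simp
    from series_holomorphic_log[OF t(2) this]
    have hS: "mv_holomorphic_on (\<lambda>w. series_sum f (\<chi> j. - exp (w $ j))) R" by (simp add: R_def \<rho>_def)
    have op: "open (tube G c \<inter> R)" unfolding R_def by (intro open_Int open_tube open_Re_less)
    define v :: "complex ^ 'n" where "v = (\<chi> j. of_real (min (- b) (\<rho> j) - 1))"
    have "H c (Ln_neg z) = series_sum f (\<chi> j. - exp (Ln_neg z $ j))"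
    proof (rule mv_holomorphic_identity[where H="\<lambda>w. series_sum f (\<chi> j. - exp (w $ j))"
          and U="tube G c \<inter> R" and V="tube G c \<inter> R \<inter> B"])
      show "mv_holomorphic_on (H c) (tube G c \<inter> R)"
        by (rule mv_holomorphic_on_subset[OF H[OF c(1)] op]) simp
      show "mv_holomorphic_on (\<lambda>w. series_sum f (\<chi> j. - exp (w $ j))) (tube G c \<inter> R)"
        by (rule mv_holomorphic_on_subset[OF hS op]) simp
      show "convex (tube G c \<inter> R)" unfolding R_def by (intro convex_Int convex_tube convex_Re_less)
      show "open (tube G c \<inter> R \<inter> B)" unfolding B_def by (intro open_Int[OF op] open_base_region)
      have "Im_vec v = 0" by (simp add: Im_vec_def v_def vec_eq_iff)
      thus "v \<in> tube G c \<inter> R \<inter> B" using c(2) real_tube delta by (auto simp: B_def R_def v_def)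
      show "H c x = series_sum f (\<chi> j. - exp (x $ j))" if "x \<in> tube G c \<inter> R \<inter> B" for x
        using that HB c by simp
      have "Re (Ln_neg z $ j) < \<rho> j" for j
      proof -
        have "norm (z $ j) < norm ((t *\<^sub>R z) $ j)" using t(1) W(2)[OF z(1), of j] by simp
        thus ?thesis using W(2)[OF z(1), of j] by (simp add: Ln_neg_def \<rho>_def)
      qed
      thus "Ln_neg z \<in> tube G c \<inter> R" using c(2) by (simp add: R_def)
    qed auto
    thus ?thesis unfolding F_def c_def[symmetric] using exp_Ln_neg W(2)[OF z(1)] by metis
  qed
  show ?thesis
    unfolding extends_analytically_def W_def[symmetric] using hF eqF by blast
qed

end
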